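(* Let $D$ be a diagram of a long virtual knot $K$. For any $a,b\in\{0,1\}$, the Laurent polynomials \[F_{ab}(D;t)=f_{ab}(D;t),\] \[G_{ab}(D;t)=g_{ab}(D;t)-\omega_b(D)\,W_a(K;t),\] \[H_{ab}(D;t)=h_{ab}(D;t)-\omega_a(D)\,W_b(K;t)-\omega_b(D)\,W_a(K;t^{-1})\] are invariants of $K$; that is, they do not depend on the choice of the diagram $D$ of $K$.
   Context: A long virtual knot diagram is an immersed line in $\mathbb{R}^2$ that agrees with the $x$-axis outside some $2$-disk and has finitely many transversal double points, each being either a real crossing (with over/under information) or a virtual crossing (without it); it is oriented from $-\infty$ to $\infty$. A long virtual knot is an equivalence class of such diagrams under generalized Reidemeister moves (the classical moves I, II, III on real crossings, the three analogous moves on virtual crossings, and the mixed move passing a strand having only virtual crossings across a real crossing). Let $D$ be a long virtual knot diagram with real crossings $c_1,\dots,c_n$, and let $\varepsilon_i\in\{1,-1\}$ be the sign of $c_i$. The crossing $c_i$ is of type $0$ if, travelling along $D$ from $-\infty$ to $\infty$, one passes $c_i$ first over and then under; otherwise it is of type $1$. For $a\in\{0,1\}$ put $I_a=I_a(D)=\{i\mid c_i\text{ is of type }a\}$. A surface realization of $D$ is a closed, connected, oriented surface $\Sigma_g$ together with an oriented knot diagram on $\Sigma_g$ with a basepoint and with no virtual crossings, whose real crossings coincide with those of $D$ (same order of passage, over/under information and signs), and whose basepoint corresponds to $\pm\infty$ of $D$. Smoothing this diagram at $c_i$ (respecting orientation) gives two oriented loops on $\Sigma_g$: $\alpha_i$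 is the one not containing the basepoint and $\beta_i$ is the one containing it; they are regarded as homology cycles on $\Sigma_g$. For such cycles, $\gamma\cdot\gamma'\in\mathbb{Z}$ denotes the intersection number on $\Sigma_g$, which is independent of the choice of surface realization. The $a$-writhe polynomial is $W_a(K;t)=\sum_{i\in I_a}\varepsilon_i(t^{\alpha_i\cdot\beta_i}-1)\in\mathbb{Z}[t,t^{-1}]$, computed from any diagram $D$ of $K$; it is known to be an invariant of $K$. The $a$-writhe of $D$ is $\omega_a=\omega_a(D)=\sum_{i\in I_a}\varepsilon_i$. For $a,b\in\{0,1\}$ put \[f_{ab}(D;t)=\sum_{i\in I_a,\,j\in I_b}\varepsilon_i\varepsilon_j(t^{\alpha_i\cdot\alpha_j}-1),\quad g_{ab}(D;t)=\sum_{i\in I_a,\,j\in I_b}\varepsilon_i\varepsilon_j(t^{\alpha_i\cdot\beta_j}-1),\quad h_{ab}(D;t)=\sum_{i\in I_a,\,j\in I_b}\varepsilon_i\varepsilon_j(t^{\beta_i\cdot\beta_j}-1).\] *)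

theory Defs
  imports
    "HOL-Analysis.Analysis"
    "HOL-Combinatorics.Permutations"
    "HOL-Library.Poly_Mapping"
begin

section \<open>Long virtual knot diagrams\<close>

text \<open>
  The plane is the type \<^typ>\<open>complex\<close>. A diagram is a parametrised immersed line together
  with its real crossings. A real crossing is the pair \<open>(o, u)\<close> of the parameters at which it is
  passed over and under. The double points of the line that do not occur in \<open>real_crossings\<close> are
  the virtual crossings.
\<close>

record long_diagram =
  curve :: "real \<Rightarrow> complex"
  real_crossings :: "(real \<times> real) set"

text \<open>The pair \<open>(u, v)\<close> is a positively oriented basis iff \<open>cross u v > 0\<close>.\<close>

definition cross :: "complex \<Rightarrow> complex \<Rightarrow> real" where
  "cross u v = Re u * Im v - Im u * Re v"

abbreviation velocity :: "(real \<Rightarrow> complex) \<Rightarrow> real \<Rightarrow> complex" where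
  "velocity \<gamma> t \<equiv> vector_derivative \<gamma> (at t)"

text \<open>
  A curve with \<open>\<gamma> t = t\<close> for \<open>\<bar>t\<bar> \<ge> r\<close> is bounded on the remaining parameters, so it agrees with
  the \<open>x\<close>-axis, oriented from \<open>-\<infinity>\<close> to \<open>\<infinity>\<close>, outside a large disk.
\<close>

definition is_long_diagram :: "long_diagram \<Rightarrow> bool" where
  "is_long_diagram D \<longleftrightarrow>
     (let \<gamma> = curve D; C = real_crossings D in
       \<gamma> C1_differentiable_on UNIV \<and> (\<forall>t. velocity \<gamma> t \<noteq> 0) \<and>
       (\<exists>r. \<forall>t. \<bar>t\<bar> \<ge> r \<longrightarrow> \<gamma> t = of_real t) \<and>
       finite {(s, t). s < t \<and> \<gamma> s = \<gamma> t} \<and>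
       (\<forall>s t u. \<gamma> s = \<gamma> t \<and> \<gamma> t = \<gamma> u \<longrightarrow> s = t \<or> t = u \<or> s = u) \<and>
       (\<forall>s t. s \<noteq> t \<and> \<gamma> s = \<gamma> t \<longrightarrow> cross (velocity \<gamma> s) (velocity \<gamma> t) \<noteq> 0) \<and>
       (\<forall>(s, t) \<in> C. s \<noteq> t \<and> \<gamma> s = \<gamma> t \<and> (t, s) \<notin> C))"

definition crossing_sign :: "long_diagram \<Rightarrow> real \<times> real \<Rightarrow> int" where
  "crossing_sign D c =
     (if cross (velocity (curve D) (fst c)) (velocity (curve D) (snd c)) > 0 then 1 else -1)"

definition crossing_type :: "real \<times> real \<Rightarrow> nat" where
  "crossing_type c = (if fst c < snd c then 0 else 1)"

definition crossings_of_type :: "long_diagram \<Rightarrow> nat \<Rightarrow> (real \<times> real) set" where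
  "crossings_of_type D a = {c \<in> real_crossings D. crossing_type c = a}"


section \<open>Generalized Reidemeister moves\<close>

definition plane_diffeo :: "(complex \<Rightarrow> complex) \<Rightarrow> bool" where
  "plane_diffeo \<phi> \<longleftrightarrow> bij \<phi> \<and>
     (\<exists>\<phi>' :: complex \<Rightarrow> complex \<Rightarrow>\<^sub>L complex. continuous_on UNIV \<phi>' \<and>
        (\<forall>z. (\<phi> has_derivative blinfun_apply (\<phi>' z)) (at z)) \<and>
        (\<forall>z. cross (blinfun_apply (\<phi>' z) 1) (blinfun_apply (\<phi>' z) \<i>) > 0))"

text \<open>
  Diagrams are isotopic in the plane, up to reparametrisation, iff they are related by an
  orientation-preserving diffeomorphism with compact support, since the group of these is connected.
\<close>

definition planar_isotopy :: "long_diagram \<Rightarrow> long_diagram \<Rightarrow> bool" where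
  "planar_isotopy D D' \<longleftrightarrow>
     (\<exists>h \<rho>. plane_diffeo h \<and> bounded {z. h z \<noteq> z} \<and>
        \<rho> C1_differentiable_on UNIV \<and> (\<forall>t. deriv \<rho> t > 0) \<and> bij \<rho> \<and>
        curve D' = h \<circ> curve D \<circ> \<rho> \<and>
        real_crossings D = map_prod \<rho> \<rho> ` real_crossings D')"

text \<open>
  The other moves take place in a disk \<open>\<phi> ` square\<close>, where \<open>\<phi>\<close> is an orientation-preserving
  diffeomorphism of the plane. The predicate \<open>changes \<phi> T S D D'\<close> says that the parts of \<open>D\<close> and
  of \<open>D'\<close> in the disk are those parametrised by \<open>T\<close>, and that the two lines differ only on \<open>S\<close>.
\<close>

definition square :: "complex set" where
  "square = cbox (Complex (-1) (-1)) (Complex 1 1)"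

definition changes ::
    "(complex \<Rightarrow> complex) \<Rightarrow> real set \<Rightarrow> real set \<Rightarrow> long_diagram \<Rightarrow> long_diagram \<Rightarrow> bool" where
  "changes \<phi> T S D D' \<longleftrightarrow> plane_diffeo \<phi> \<and>
     (\<forall>t. curve D t \<in> \<phi> ` square \<longleftrightarrow> t \<in> T) \<and>
     (\<forall>t. curve D' t \<in> \<phi> ` square \<longleftrightarrow> t \<in> T) \<and>
     (\<forall>t. t \<notin> S \<longrightarrow> curve D' t = curve D t)"

definition strand :: "real set \<Rightarrow> bool" where
  "strand A \<longleftrightarrow> (\<exists>a b. a < b \<and> A = {a..b})"

definition function_graph :: "(real \<Rightarrow> real) \<Rightarrow> complex set" where
  "function_graph f = range (\<lambda>x. Complex x (f x))"

text \<open>Crossings of the strand \<open>A\<close> with the strand \<open>B\<close>, taken as real crossings with \<open>A\<close> over \<open>B\<close>.\<close>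

definition over_crossings ::
    "(real \<Rightarrow> complex) \<Rightarrow> real set \<Rightarrow> real set \<Rightarrow> (real \<times> real) set" where
  "over_crossings \<gamma> A B = {(s, t). s \<in> A \<and> t \<in> B \<and> \<gamma> s = \<gamma> t}"

text \<open>
  Creation of a kink. Up to isotopy, a kink is an arc in a disk with exactly one (transversal)
  double point. The crossing is virtual, or real with either over/under information.
\<close>

definition move_I :: "long_diagram \<Rightarrow> long_diagram \<Rightarrow> bool" where
  "move_I D D' \<longleftrightarrow>
     (\<exists>\<phi> A p q. strand A \<and> changes \<phi> A A D D' \<and> inj_on (curve D) A \<and>
        {(s, t). s \<in> A \<and> t \<in> A \<and> s < t \<and> curve D' s = curve D' t} = {(p, q)} \<and>
        real_crossings D' \<in> {real_crossings D,
          insert (p, q) (real_crossings D), insert (q, p) (real_crossings D)})"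

text \<open>
  Creation of a bigon: in the disk, the strand \<open>B\<close> is changed from a graph above the \<open>x\<close>-axis
  \<open>A\<close> to a graph with two zeros. The new crossings are both virtual, or both real with the same
  strand on top.
\<close>

definition move_II :: "long_diagram \<Rightarrow> long_diagram \<Rightarrow> bool" where
  "move_II D D' \<longleftrightarrow>
     (\<exists>\<phi> A B f g. strand A \<and> strand B \<and> A \<inter> B = {} \<and> changes \<phi> (A \<union> B) B D D' \<and>
        (\<forall>x\<in>{-1..1}. f differentiable (at x) \<and> 0 < f x \<and> f x < 1) \<and>
        (\<forall>x\<in>{-1..1}. g differentiable (at x) \<and> \<bar>g x\<bar> < 1) \<and>
        card {x \<in> {-1..1}. g x = 0} = 2 \<and>
        curve D ` A \<subseteq> \<phi> ` function_graph (\<lambda>_. 0) \<and>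
        curve D ` B \<subseteq> \<phi> ` function_graph f \<and> curve D' ` B \<subseteq> \<phi> ` function_graph g \<and>
        real_crossings D' \<in> {real_crossings D,
          real_crossings D \<union> over_crossings (curve D') A B,
          real_crossings D \<union> over_crossings (curve D') B A})"

text \<open>
  The planar picture of the third moves: the strand \<open>E\<close>, the graph of a function of slope in
  \<open>]-1, 1[\<close>, is moved from above to below the crossing of the diagonals \<open>A\<close> and \<open>B\<close>. Each
  strand may run in either direction.
\<close>

definition slide ::
    "real set \<Rightarrow> real set \<Rightarrow> real set \<Rightarrow> long_diagram \<Rightarrow> long_diagram \<Rightarrow> bool" where
  "slide A B E D D' \<longleftrightarrow>
     (\<exists>\<phi> f g. strand A \<and> strand B \<and> strand E \<and> A \<inter> B = {} \<and> A \<inter> E = {} \<and> B \<inter> E = {} \<and>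
        changes \<phi> (A \<union> B \<union> E) E D D' \<and>
        (\<forall>x\<in>{-1..1}. f differentiable (at x) \<and> \<bar>deriv f x\<bar> < 1 \<and> \<bar>f x\<bar> < 1) \<and> f 0 > 0 \<and>
        (\<forall>x\<in>{-1..1}. g differentiable (at x) \<and> \<bar>deriv g x\<bar> < 1 \<and> \<bar>g x\<bar> < 1) \<and> g 0 < 0 \<and>
        curve D ` A \<subseteq> \<phi> ` function_graph (\<lambda>x. x) \<and> curve D ` B \<subseteq> \<phi> ` function_graph (\<lambda>x. - x) \<and>
        curve D ` E \<subseteq> \<phi> ` function_graph f \<and> curve D' ` E \<subseteq> \<phi> ` function_graph g)"

definition layered_crossings ::
    "(real \<Rightarrow> complex) \<Rightarrow> real set \<Rightarrow> real set \<Rightarrow> real set \<Rightarrow> (real \<times> real) set" where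
  "layered_crossings \<gamma> P Q R = over_crossings \<gamma> P Q \<union> over_crossings \<gamma> P R \<union> over_crossings \<gamma> Q R"

definition move_III :: "long_diagram \<Rightarrow> long_diagram \<Rightarrow> bool" where
  "move_III D D' \<longleftrightarrow>
     (\<exists>A B E P Q R. slide A B E D D' \<and> {P, Q, R} = {A, B, E} \<and>
        (let T = A \<union> B \<union> E in
          real_crossings D' - T \<times> T = real_crossings D - T \<times> T \<and>
          real_crossings D \<inter> T \<times> T = layered_crossings (curve D) P Q R \<and>
          real_crossings D' \<inter> T \<times> T = layered_crossings (curve D') P Q R))"

definition virtual_move_III :: "long_diagram \<Rightarrow> long_diagram \<Rightarrow> bool" where
  "virtual_move_III D D' \<longleftrightarrow>
     (\<exists>A B E. slide A B E D D' \<and> real_crossings D' = real_crossings D \<and>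
        (let T = A \<union> B \<union> E in real_crossings D \<inter> T \<times> T = {}))"

definition mixed_move :: "long_diagram \<Rightarrow> long_diagram \<Rightarrow> bool" where
  "mixed_move D D' \<longleftrightarrow>
     (\<exists>A B E. slide A B E D D' \<and> real_crossings D' = real_crossings D \<and>
        (let T = A \<union> B \<union> E in real_crossings D \<inter> T \<times> T \<in>
           {over_crossings (curve D) A B, over_crossings (curve D) B A}))"

definition generalized_reidemeister :: "long_diagram \<Rightarrow> long_diagram \<Rightarrow> bool" where
  "generalized_reidemeister D D' \<longleftrightarrow> is_long_diagram D \<and> is_long_diagram D' \<and>
     (planar_isotopy D D' \<or> move_I D D' \<or> move_II D D' \<or>
      move_III D D' \<or> virtual_move_III D D' \<or> mixed_move D D')"

text \<open>Two diagrams represent the same long virtual knot.\<close>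

definition same_long_virtual_knot :: "long_diagram \<Rightarrow> long_diagram \<Rightarrow> bool" where
  "same_long_virtual_knot = equivclp generalized_reidemeister"


section \<open>Knot diagrams on closed surfaces\<close>

text \<open>
  A closed, connected, oriented surface is given by a cell decomposition, encoded as a
  combinatorial map: \<open>darts\<close> are the oriented edges, \<open>opp\<close> reverses a dart, and \<open>rot\<close> sends a
  dart to the next dart, counterclockwise, with the same initial vertex. The faces are the orbits
  of the composition of the two permutations. A closed path in the 1-skeleton is a list of darts
  and is read cyclically: passage \<open>k\<close> of \<open>w\<close> enters a vertex along \<open>w ! (k - 1)\<close> and
  leaves it along \<open>w ! k\<close>.
\<close>

record 'd surface =
  darts :: "'d set"
  opp :: "'d \<Rightarrow> 'd"
  rot :: "'d \<Rightarrow> 'd"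

definition closed_surface :: "('d, 'm) surface_scheme \<Rightarrow> bool" where
  "closed_surface M \<longleftrightarrow> finite (darts M) \<and> darts M \<noteq> {} \<and>
     opp M permutes darts M \<and> rot M permutes darts M \<and>
     (\<forall>d\<in>darts M. opp M d \<noteq> d \<and> opp M (opp M d) = d) \<and>
     (\<forall>c\<in>darts M. \<forall>d\<in>darts M. (c, d) \<in> {(x, y). y = opp M x \<or> y = rot M x}\<^sup>*)"

definition same_vertex :: "('d, 'm) surface_scheme \<Rightarrow> 'd \<Rightarrow> 'd \<Rightarrow> bool" where
  "same_vertex M c d \<longleftrightarrow> (\<exists>j. (rot M ^^ j) c = d)"

text \<open>The darts strictly between \<open>c\<close> and \<open>d\<close> in the counterclockwise order at their vertex.\<close>

definition between :: "('d, 'm) surface_scheme \<Rightarrow> 'd \<Rightarrow> 'd \<Rightarrow> 'd set" where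
  "between M c d = {(rot M ^^ j) c | j. 0 < j \<and> (\<forall>i. 0 < i \<and> i \<le> j \<longrightarrow> (rot M ^^ i) c \<noteq> d)}"

text \<open>The dart along which passage \<open>k\<close> enters, directed away from the vertex.\<close>

definition in_dart :: "('d, 'm) surface_scheme \<Rightarrow> 'd list \<Rightarrow> nat \<Rightarrow> 'd" where
  "in_dart M w k = opp M (w ! ((k + length w - 1) mod length w))"

definition left_side :: "('d, 'm) surface_scheme \<Rightarrow> 'd list \<Rightarrow> nat \<Rightarrow> 'd set" where
  "left_side M w k = between M (w ! k) (in_dart M w k)"

definition closed_path :: "('d, 'm) surface_scheme \<Rightarrow> 'd list \<Rightarrow> bool" where
  "closed_path M w \<longleftrightarrow> w \<noteq> [] \<and> set w \<subseteq> darts M \<and>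
     (\<forall>k < length w. same_vertex M (w ! k) (in_dart M w k))"

text \<open>The coefficient of the dart \<open>d\<close> in the 1-cycle of the closed path \<open>w\<close>.\<close>

definition path_coeff :: "('d, 'm) surface_scheme \<Rightarrow> 'd list \<Rightarrow> 'd \<Rightarrow> int" where
  "path_coeff M w d = int (count_list w d) - int (count_list w (opp M d))"

text \<open>
  The intersection number \<open>v \<cdot> w\<close> is counted with the transversal representative of the class of
  \<open>w\<close> obtained by pushing \<open>w\<close> slightly to its left. Near each passage, this curve crosses exactly
  the darts on the left side of the passage. A unit of \<open>v\<close> running away from the vertex along such a
  dart passes from right to left of the pushed curve, so the tangents to \<open>v\<close> and \<open>w\<close> form a
  negative basis.
\<close>

definition intersection_number :: "('d, 'm) surface_scheme \<Rightarrow> 'd list \<Rightarrow> 'd list \<Rightarrow> int" where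
  "intersection_number M v w = - (\<Sum>k < length w. \<Sum>d \<in> left_side M w k. path_coeff M v d)"

text \<open>
  A knot diagram is a closed path that uses no edge twice and is transversal to itself. The
  basepoint is the initial vertex of the path (passage \<open>0\<close>), which is not a double point. A
  crossing is the pair \<open>(o, u)\<close> of its over and under passages. Every double point is a crossing.
\<close>

record 'd surface_knot = "'d surface" +
  knot :: "'d list"
  knot_crossings :: "(nat \<times> nat) set"

definition double_passage :: "('d, 'm) surface_knot_scheme \<Rightarrow> nat \<Rightarrow> nat \<Rightarrow> bool" where
  "double_passage S k l \<longleftrightarrow> k < length (knot S) \<and> l < length (knot S) \<and> k \<noteq> l \<and>
     same_vertex S (knot S ! k) (knot S ! l)"

definition surface_knot_diagram :: "('d, 'm) surface_knot_scheme \<Rightarrow> bool" where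
  "surface_knot_diagram S \<longleftrightarrow> closed_surface S \<and> closed_path S (knot S) \<and>
     distinct (knot S) \<and> opp S ` set (knot S) \<inter> set (knot S) = {} \<and>
     (\<forall>k l m. double_passage S k l \<and> double_passage S k m \<longrightarrow> l = m) \<and>
     (\<forall>k l. double_passage S k l \<longrightarrow>
        (knot S ! l \<in> left_side S (knot S) k \<longleftrightarrow> in_dart S (knot S) l \<notin> left_side S (knot S) k)) \<and>
     (\<forall>l. \<not> double_passage S 0 l) \<and>
     (\<forall>(k, l) \<in> knot_crossings S. double_passage S k l \<and> (l, k) \<notin> knot_crossings S) \<and>
     (\<forall>k l. double_passage S k l \<longrightarrow> (k, l) \<in> knot_crossings S \<or> (l, k) \<in> knot_crossings S)"

definition surface_crossing_sign :: "('d, 'm) surface_knot_scheme \<Rightarrow> nat \<times> nat \<Rightarrow> int" where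
  "surface_crossing_sign S c =
     (if knot S ! snd c \<in> left_side S (knot S) (fst c) then 1 else -1)"

text \<open>The loops obtained by smoothing at a crossing, without and with the basepoint respectively.\<close>

definition alpha_loop :: "('d, 'm) surface_knot_scheme \<Rightarrow> nat \<times> nat \<Rightarrow> 'd list" where
  "alpha_loop S c = (let k = min (fst c) (snd c); l = max (fst c) (snd c) in
     drop k (take l (knot S)))"

definition beta_loop :: "('d, 'm) surface_knot_scheme \<Rightarrow> nat \<times> nat \<Rightarrow> 'd list" where
  "beta_loop S c = (let k = min (fst c) (snd c); l = max (fst c) (snd c) in
     drop l (knot S) @ take k (knot S))"

text \<open>
  \<open>S\<close> is a surface realization of \<open>D\<close>, where \<open>p\<close> sends the parameters of the real crossings of
  \<open>D\<close> to the corresponding passages of \<open>S\<close>.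
\<close>

definition surface_realization ::
    "long_diagram \<Rightarrow> ('d, 'm) surface_knot_scheme \<Rightarrow> (real \<Rightarrow> nat) \<Rightarrow> bool" where
  "surface_realization D S p \<longleftrightarrow> surface_knot_diagram S \<and>
     strict_mono_on (Field (real_crossings D)) p \<and>
     map_prod p p ` real_crossings D = knot_crossings S \<and>
     (\<forall>c \<in> real_crossings D. surface_crossing_sign S (map_prod p p c) = crossing_sign D c)"


section \<open>The polynomials\<close>

text \<open>\<open>\<int>[t, t\<^sup>-\<^sup>1]\<close> is the ring of finitely supported functions on \<open>\<int>\<close> with convolution.\<close>

type_synonym laurent = "int \<Rightarrow>\<^sub>0 int"

definition t_power :: "int \<Rightarrow> laurent" where
  "t_power k = Poly_Mapping.single k 1"

definition invert_t :: "laurent \<Rightarrow> laurent" where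
  "invert_t = Poly_Mapping.map_key uminus"

context
  fixes D :: long_diagram and S :: "('d, 'm) surface_knot_scheme" and p :: "real \<Rightarrow> nat"
begin

definition alpha :: "real \<times> real \<Rightarrow> 'd list" where
  "alpha i = alpha_loop S (map_prod p p i)"

definition beta :: "real \<times> real \<Rightarrow> 'd list" where
  "beta i = beta_loop S (map_prod p p i)"

definition writhe_polynomial :: "nat \<Rightarrow> laurent" where
  "writhe_polynomial a =
     (\<Sum>i \<in> crossings_of_type D a.
        of_int (crossing_sign D i) * (t_power (intersection_number S (alpha i) (beta i)) - 1))"

definition writhe :: "nat \<Rightarrow> int" where
  "writhe a = (\<Sum>i \<in> crossings_of_type D a. crossing_sign D i)"

definition f_poly :: "nat \<Rightarrow> nat \<Rightarrow> laurent" where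
  "f_poly a b =
     (\<Sum>i \<in> crossings_of_type D a. \<Sum>j \<in> crossings_of_type D b.
        of_int (crossing_sign D i * crossing_sign D j) *
        (t_power (intersection_number S (alpha i) (alpha j)) - 1))"

definition g_poly :: "nat \<Rightarrow> nat \<Rightarrow> laurent" where
  "g_poly a b =
     (\<Sum>i \<in> crossings_of_type D a. \<Sum>j \<in> crossings_of_type D b.
        of_int (crossing_sign D i * crossing_sign D j) *
        (t_power (intersection_number S (alpha i) (beta j)) - 1))"

definition h_poly :: "nat \<Rightarrow> nat \<Rightarrow> laurent" where
  "h_poly a b =
     (\<Sum>i \<in> crossings_of_type D a. \<Sum>j \<in> crossings_of_type D b.
        of_int (crossing_sign D i * crossing_sign D j) *
        (t_power (intersection_number S (beta i) (beta j)) - 1))"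

definition F_poly :: "nat \<Rightarrow> nat \<Rightarrow> laurent" where
  "F_poly a b = f_poly a b"

definition G_poly :: "nat \<Rightarrow> nat \<Rightarrow> laurent" where
  "G_poly a b = g_poly a b - of_int (writhe b) * writhe_polynomial a"

definition H_poly :: "nat \<Rightarrow> nat \<Rightarrow> laurent" where
  "H_poly a b = h_poly a b - of_int (writhe a) * writhe_polynomial b
     - of_int (writhe b) * invert_t (writhe_polynomial a)"

end

end

theory Submission
  imports Defs "HOL-Combinatorics.Cycles"
begin

text \<open>
  All exponents can be read off the Gauss diagram, that is, the set of pairs
  (over parameter, under parameter) with the signs. Give each passage twice the fraction of it
  that lies on the loop \<open>\<alpha>\<^sub>i\<close>: 2 inside the arc, 1 at its two ends, 0 outside. This is
  \<open>arc_weight i\<close>, and \<open>\<beta>\<^sub>i\<close> has the complementary weight \<open>2 - arc_weight i\<close>. If \<open>v\<close> and \<open>w\<close> are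
  loops on the knot with weights \<open>V\<close> and \<open>W\<close>, then

    \<open>4 v \<cdot> w = \<Sum> \<epsilon>\<^sub>c (V(o) W(u) - V(u) W(o))\<close>, summed over the crossings \<open>c = (o, u)\<close>

  (\<open>intersection_number_knot_loops\<close>). Since the form is alternating, the matrix
  \<open>X\<^sub>i\<^sub>j = 4 \<alpha>\<^sub>i \<cdot> \<alpha>\<^sub>j\<close> and the vector \<open>Y\<^sub>i = 4 \<alpha>\<^sub>i \<cdot> \<beta>\<^sub>i\<close> determine the other exponents:
  \<open>4 \<alpha>\<^sub>i \<cdot> \<beta>\<^sub>j = Y\<^sub>i - X\<^sub>i\<^sub>j\<close> and \<open>4 \<beta>\<^sub>i \<cdot> \<beta>\<^sub>j = Y\<^sub>j - Y\<^sub>i + X\<^sub>i\<^sub>j\<close>. Distributing the correction terms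
  over the double sums turns each of the three polynomials into a sum

    \<open>\<Sum> \<epsilon>\<^sub>i \<epsilon>\<^sub>j \<Phi>(Y\<^sub>i, Y\<^sub>j, X\<^sub>i\<^sub>j)\<close> over \<open>i\<close> of type \<open>a\<close> and \<open>j\<close> of type \<open>b\<close>,
    where \<open>\<Phi>(y, 0, 0) = \<Phi>(0, y, 0) = 0\<close>

  (\<open>polynomials_as_state_sums\<close>); the purpose of the corrections is exactly this vanishing.

  Every such sum is invariant. A kink is a crossing whose row of \<open>X\<close> and whose entry of \<open>Y\<close> are
  zero, so that all its terms vanish. The two crossings of a bigon have the same type, the same
  rows and opposite signs, so that their terms cancel. A third move on real crossings exchanges
  the two passages on each of three strands. In each entry of \<open>X\<close> and \<open>Y\<close> the exchange reverses
  the terms that are odd in the directions of the strands, and these terms cancel because of the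
  signs that the three crossings have in the plane (\<open>state_sum_triangle\<close>). The mixed
  move and the moves on virtual crossings do not change the Gauss diagram, and an isotopy only
  relabels its parameters monotonically.

  The geometry of the moves enters through one formula: two graphs \<open>F\<close> and \<open>G\<close>, run through in
  the directions \<open>\<sigma>\<close> and \<open>\<tau>\<close>, cross with the sign of \<open>\<sigma> \<tau> (G' - F')\<close>. A strand of a move does run
  through its graph monotonically, from one side of the square to the other
  (\<open>strand_is_graph\<close>), and a move keeps the ends of the strands, hence the directions.
\<close>

section \<open>Weighted Gauss diagrams\<close>

text \<open>
  The sign of \<open>y - x\<close>, defined on every linear order because it compares both parameters of a
  diagram and passages of a knot on a surface.
\<close>

definition order_sign :: "'a::linorder \<Rightarrow> 'a \<Rightarrow> int" where
  "order_sign x y = (if x < y then 1 else if y < x then -1 else 0)"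

text \<open>
  Between the two ends of \<open>i\<close> the two signs in the bracket are opposite, outside they are equal,
  and at an end one of them is 0. The first factor makes the weight positive whichever end comes
  first.
\<close>

definition arc_weight :: "'a::linorder \<times> 'a \<Rightarrow> 'a \<Rightarrow> int" where
  "arc_weight i x = order_sign (fst i) (snd i) * (order_sign (fst i) x - order_sign (snd i) x)"

text \<open>
  Four times the intersection form, in terms of doubled weights. A crossing contributes with the
  two passages in either role, and the sign of an ordered pair of passages changes when they are
  exchanged.
\<close>

definition pairing ::
    "('a \<times> 'a \<Rightarrow> int) \<Rightarrow> ('a \<times> 'a) set \<Rightarrow> ('a \<Rightarrow> int) \<Rightarrow> ('a \<Rightarrow> int) \<Rightarrow> int" where
  "pairing \<epsilon> C U V = (\<Sum>c\<in>C. \<epsilon> c * (U (fst c) * V (snd c) - U (snd c) * V (fst c)))"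

abbreviation loop_pairing ::
    "('a::linorder \<times> 'a \<Rightarrow> int) \<Rightarrow> ('a \<times> 'a) set \<Rightarrow> 'a \<times> 'a \<Rightarrow> 'a \<times> 'a \<Rightarrow> int" where
  "loop_pairing \<epsilon> C i j \<equiv> pairing \<epsilon> C (arc_weight i) (arc_weight j)"

text \<open>
  The constant weight 2 belongs to the whole knot. As \<open>\<beta>\<^sub>i\<close> is the whole knot minus \<open>\<alpha>\<^sub>i\<close>, this is
  four times \<open>\<alpha>\<^sub>i \<cdot> \<beta>\<^sub>i\<close>.
\<close>

abbreviation loop_index ::
    "('a::linorder \<times> 'a \<Rightarrow> int) \<Rightarrow> ('a \<times> 'a) set \<Rightarrow> 'a \<times> 'a \<Rightarrow> int" where
  "loop_index \<epsilon> C i \<equiv> pairing \<epsilon> C (arc_weight i) (\<lambda>_. 2)"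

lemma order_sign_swap: "order_sign y x = - order_sign x y"
  by (auto simp: order_sign_def)

lemma order_sign_self [simp]: "order_sign x x = 0"
  by (simp add: order_sign_def)

lemma order_sign_cases: "x \<noteq> y \<Longrightarrow> order_sign x y = 1 \<or> order_sign x y = -1"
  by (auto simp: order_sign_def)

lemma order_sign_strict_mono_on:
  "strict_mono_on A f \<Longrightarrow> x \<in> A \<Longrightarrow> y \<in> A \<Longrightarrow> order_sign (f x) (f y) = order_sign x y"
  by (auto simp: order_sign_def strict_mono_on_less)

lemma arc_weight_strict_mono_on:
  assumes "strict_mono_on A f" "fst i \<in> A" "snd i \<in> A" "x \<in> A"
  shows "arc_weight (map_prod f f i) (f x) = arc_weight i x"
  using assms by (simp add: arc_weight_def order_sign_strict_mono_on)

lemma crossing_type_order_sign: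
  assumes "order_sign (fst i) (snd i) = order_sign (fst j) (snd j)"
  shows "crossing_type i = crossing_type j"
  using assms by (auto simp: crossing_type_def order_sign_def split: if_splits)

lemma pairing_cong:
  assumes "\<And>c. c \<in> C \<Longrightarrow> U (fst c) = U' (fst c) \<and> U (snd c) = U' (snd c)"
    and "\<And>c. c \<in> C \<Longrightarrow> V (fst c) = V' (fst c) \<and> V (snd c) = V' (snd c)"
    and "\<And>c. c \<in> C \<Longrightarrow> \<epsilon> c = \<epsilon>' c"
  shows "pairing \<epsilon> C U V = pairing \<epsilon>' C U' V'"
  unfolding pairing_def by (rule sum.cong) (auto simp: assms)

lemma pairing_swap: "pairing \<epsilon> C V U = - pairing \<epsilon> C U V"
  unfolding pairing_def sum_negf[symmetric] by (rule sum.cong) (auto simp: algebra_simps)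

lemma pairing_self: "pairing \<epsilon> C U U = 0"
  unfolding pairing_def by (simp add: algebra_simps)

lemma pairing_insert:
  assumes "finite C" "c \<notin> C"
  shows "pairing \<epsilon> (insert c C) U V =
    \<epsilon> c * (U (fst c) * V (snd c) - U (snd c) * V (fst c)) + pairing \<epsilon> C U V"
  using assms by (simp add: pairing_def)

lemma pairing_diff_left:
  "pairing \<epsilon> C (\<lambda>x. U x - U' x) V = pairing \<epsilon> C U V - pairing \<epsilon> C U' V"
  unfolding pairing_def sum_subtractf[symmetric] by (rule sum.cong) (auto simp: algebra_simps)

lemma pairing_diff_right:
  "pairing \<epsilon> C U (\<lambda>x. V x - V' x) = pairing \<epsilon> C U V - pairing \<epsilon> C U V'"
  unfolding pairing_def sum_subtractf[symmetric] by (rule sum.cong) (auto simp: algebra_simps)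

lemma pairing_image:
  assumes "inj_on (map_prod f f) C"
  shows "pairing \<epsilon> (map_prod f f ` C) U V =
    pairing (\<epsilon> \<circ> map_prod f f) C (U \<circ> f) (V \<circ> f)"
  unfolding pairing_def by (simp add: sum.reindex[OF assms] case_prod_unfold)

text \<open>
  Extending the sign by 0 to the crossings of the other type lets both indices of a state sum run
  over all crossings.
\<close>

definition typed_sign :: "(real \<times> real \<Rightarrow> int) \<Rightarrow> nat \<Rightarrow> real \<times> real \<Rightarrow> int" where
  "typed_sign \<epsilon> a c = (if crossing_type c = a then \<epsilon> c else 0)"

definition state_sum ::
    "(int \<Rightarrow> int \<Rightarrow> int \<Rightarrow> laurent) \<Rightarrow> nat \<Rightarrow> nat \<Rightarrow> (real \<times> real \<Rightarrow> int) \<Rightarrow> (real \<times> real) set \<Rightarrow> laurent"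
  where
  "state_sum \<Phi> a b \<epsilon> C = (\<Sum>i\<in>C. \<Sum>j\<in>C. of_int (typed_sign \<epsilon> a i * typed_sign \<epsilon> b j) *
      \<Phi> (loop_index \<epsilon> C i) (loop_index \<epsilon> C j) (loop_pairing \<epsilon> C i j))"

text \<open>
  The crossing of a kink has index 0 and pairing 0 with every crossing, so these are the terms of
  a state sum that involve it.
\<close>

definition kink_free :: "(int \<Rightarrow> int \<Rightarrow> int \<Rightarrow> laurent) \<Rightarrow> bool" where
  "kink_free \<Phi> \<longleftrightarrow> (\<forall>y. \<Phi> y 0 0 = 0 \<and> \<Phi> 0 y 0 = 0)"

lemma state_sum_reindex:
  assumes "inj_on \<pi> C"
    and "\<And>c. c \<in> C \<Longrightarrow> crossing_type (\<pi> c) = crossing_type c"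
    and "\<And>c. c \<in> C \<Longrightarrow> \<epsilon>' (\<pi> c) = \<epsilon> c"
    and "\<And>i. i \<in> C \<Longrightarrow> loop_index \<epsilon>' (\<pi> ` C) (\<pi> i) = loop_index \<epsilon> C i"
    and "\<And>i j. i \<in> C \<Longrightarrow> j \<in> C \<Longrightarrow> loop_pairing \<epsilon>' (\<pi> ` C) (\<pi> i) (\<pi> j) = loop_pairing \<epsilon> C i j"
  shows "state_sum \<Phi> a b \<epsilon>' (\<pi> ` C) = state_sum \<Phi> a b \<epsilon> C"
proof -
  have "typed_sign \<epsilon>' a (\<pi> c) = typed_sign \<epsilon> a c" if "c \<in> C" for a c
    using that assms(2,3) by (simp add: typed_sign_def)
  then show ?thesis
    by (simp add: state_sum_def sum.reindex[OF assms(1)] assms(4,5) cong: sum.cong)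
qed

lemma state_sum_cong:
  assumes "\<And>c. c \<in> C \<Longrightarrow> \<epsilon>' c = \<epsilon> c"
  shows "state_sum \<Phi> a b \<epsilon>' C = state_sum \<Phi> a b \<epsilon> C"
proof -
  have "pairing \<epsilon>' C U V = pairing \<epsilon> C U V" for U V
    by (rule pairing_cong) (auto simp: assms)
  with state_sum_reindex[of id C \<epsilon>' \<epsilon> \<Phi> a b] show ?thesis by (simp add: assms)
qed

lemma state_sum_monotone_image:
  assumes "strict_mono \<rho>" and "\<And>c. c \<in> C \<Longrightarrow> \<epsilon>' (map_prod \<rho> \<rho> c) = \<epsilon> c"
  shows "state_sum \<Phi> a b \<epsilon>' (map_prod \<rho> \<rho> ` C) = state_sum \<Phi> a b \<epsilon> C"
proof -
  have inj: "inj_on (map_prod \<rho> \<rho>) C"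
    using strict_mono_eq[OF assms(1)] by (auto simp: inj_on_def)
  have aw: "arc_weight (\<rho> s, \<rho> t) (\<rho> x) = arc_weight (s, t) x" for s t x
    using order_sign_strict_mono_on[OF assms(1)] by (simp add: arc_weight_def)
  show ?thesis
  proof (rule state_sum_reindex[OF inj])
    fix c assume "c \<in> C"
    show "crossing_type (map_prod \<rho> \<rho> c) = crossing_type c"
      using strict_mono_less[OF assms(1)] by (simp add: crossing_type_def)
  qed (use assms(2) in \<open>auto simp: pairing_image[OF inj] aw intro!: pairing_cong\<close>)
qed

text \<open>
  Since no other passage separates the two ends of the kink, every other arc has the same weight at
  both ends, and so has the arc of the kink itself. The alternating contribution of the new
  crossing is therefore 0 in all pairings. The arc of the kink has weight 0 at all old passages,
  so its own pairings vanish too.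
\<close>

lemma state_sum_insert_kink:
  assumes "finite C" "c \<notin> C" "kink_free \<Phi>"
    and apart: "\<And>d z. d \<in> C \<Longrightarrow> z \<in> {fst d, snd d} \<Longrightarrow> order_sign z (fst c) = order_sign z (snd c)"
    and \<epsilon>: "\<And>d. d \<in> C \<Longrightarrow> \<epsilon>' d = \<epsilon> d"
  shows "state_sum \<Phi> a b \<epsilon>' (insert c C) = state_sum \<Phi> a b \<epsilon> C"
proof -
  have flat: "arc_weight d (fst c) = arc_weight d (snd c)" if "d \<in> C" for d
    using apart[OF that] by (simp add: arc_weight_def)
  have zero: "arc_weight c z = 0" if "d \<in> C" "z \<in> {fst d, snd d}" for d z
    using apart[OF that] order_sign_swap[of "fst c" z] order_sign_swap[of "snd c" z]
    by (simp add: arc_weight_def)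
  have ends: "arc_weight c (fst c) = arc_weight c (snd c)"
    using order_sign_swap[of "fst c" "snd c"] by (simp add: arc_weight_def)
  have unchanged: "pairing \<epsilon>' (insert c C) U V = pairing \<epsilon> C U V"
    if "U (fst c) = U (snd c)" "V (fst c) = V (snd c)" for U V
    using that \<epsilon> by (simp add: pairing_insert assms algebra_simps cong: pairing_cong)
  have null: "pairing \<epsilon> C (arc_weight c) V = 0" for V
    unfolding pairing_def by (rule sum.neutral) (simp add: zero)
  have X: "loop_pairing \<epsilon>' (insert c C) i j = loop_pairing \<epsilon> C i j"
    if "i \<in> insert c C" "j \<in> insert c C" for i j
    by (intro unchanged; use that flat ends in blast)
  have Y: "loop_index \<epsilon>' (insert c C) i = loop_index \<epsilon> C i" if "i \<in> insert c C" for i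
    by (intro unchanged refl; use that flat ends in blast)
  have sign: "typed_sign \<epsilon>' a d = typed_sign \<epsilon> a d" if "d \<in> C" for a d
    using that \<epsilon> by (simp add: typed_sign_def)
  have "loop_pairing \<epsilon> C i c = 0" for i
    by (subst pairing_swap) (simp add: null)
  then show ?thesis
    using assms(1-3) unfolding state_sum_def
    by (simp add: X Y null sign kink_free_def sum.distrib cong: sum.cong)
qed

text \<open>
  The rows of \<open>c\<close> and \<open>d\<close> cancel, and within every row so do the columns.
\<close>

lemma sum_sum_insert_cancelling_pair:
  fixes M :: "'i \<Rightarrow> 'i \<Rightarrow> laurent" and u v :: "'i \<Rightarrow> int"
  assumes "finite C" "c \<notin> C" "d \<notin> C" "c \<noteq> d"
    and "u d = - u c" "v d = - v c"
    and row: "\<And>j. j \<in> insert c (insert d C) \<Longrightarrow> M d j = M c j"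
    and col: "\<And>i. i \<in> insert c (insert d C) \<Longrightarrow> M i d = M i c"
  shows "(\<Sum>i\<in>insert c (insert d C). \<Sum>j\<in>insert c (insert d C). of_int (u i * v j) * M i j) =
    (\<Sum>i\<in>C. \<Sum>j\<in>C. of_int (u i * v j) * M i j)"
proof -
  let ?r = "\<lambda>i. \<Sum>j\<in>C. of_int (u i * v j) * M i j"
  have r: "(\<Sum>j\<in>insert c (insert d C). of_int (u i * v j) * M i j) = ?r i"
    if "i \<in> insert c (insert d C)" for i
    using assms(1-4,6) col[OF that] by simp
  have "?r d = - ?r c"
    unfolding sum_negf[symmetric] by (rule sum.cong) (auto simp: assms(5) row)
  then have "sum ?r (insert c (insert d C)) = sum ?r C"
    using assms(1-4) by (simp del: of_int_mult)
  then show ?thesis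
    by (simp only: r cong: sum.cong)
qed

text \<open>
  Old arcs do not distinguish the two crossings, so their contributions to old pairings cancel by
  the opposite signs. The arcs of \<open>c\<close> and \<open>d\<close> have the same weights at old passages. At the four
  new passages the weights involve the signs \<open>\<kappa>\<close> and \<open>\<mu>\<close> that record which crossing comes first on
  each strand, but these signs enter the pairings of both arcs in the same way.
\<close>

lemma state_sum_insert_bigon:
  assumes "finite C" "c \<notin> C" "d \<notin> C" "c \<noteq> d"
    and apart: "\<And>e z. e \<in> C \<Longrightarrow> z \<in> {fst e, snd e} \<Longrightarrow>
      order_sign z (fst c) = order_sign z (fst d) \<and> order_sign z (snd c) = order_sign z (snd d)"
    and ends: "fst c \<noteq> snd c" "order_sign (fst d) (snd d) = order_sign (fst c) (snd c)"
      "order_sign (fst c) (snd d) = order_sign (fst c) (snd c)"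
      "order_sign (fst d) (snd c) = order_sign (fst c) (snd c)"
    and \<epsilon>: "\<And>e. e \<in> C \<Longrightarrow> \<epsilon>' e = \<epsilon> e" "\<epsilon>' d = - \<epsilon>' c"
  shows "state_sum \<Phi> a b \<epsilon>' (insert c (insert d C)) = state_sum \<Phi> a b \<epsilon> C"
proof -
  let ?C = "insert c (insert d C)"
  define \<tau> \<kappa> \<mu> where "\<tau> = order_sign (fst c) (snd c)" and "\<kappa> = order_sign (fst c) (fst d)"
    and "\<mu> = order_sign (snd c) (snd d)"
  have \<tau>: "\<tau> * \<tau> = 1" using order_sign_cases[OF ends(1)] by (auto simp: \<tau>_def)
  have os: "order_sign (snd c) (fst c) = -\<tau>" "order_sign (snd d) (fst d) = -\<tau>"
    "order_sign (snd d) (fst c) = -\<tau>" "order_sign (snd c) (fst d) = -\<tau>"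
    "order_sign (fst d) (fst c) = -\<kappa>" "order_sign (snd d) (snd c) = -\<mu>"
    using order_sign_swap[of "fst c" "snd c"] order_sign_swap[of "fst d" "snd d"]
      order_sign_swap[of "fst c" "snd d"] order_sign_swap[of "fst d" "snd c"]
      order_sign_swap[of "fst d" "fst c"] order_sign_swap[of "snd d" "snd c"]
    by (simp_all add: \<tau>_def \<kappa>_def \<mu>_def ends)
  have aw_ends: "arc_weight c (fst c) = 1" "arc_weight c (snd c) = 1"
    "arc_weight c (fst d) = 1 + \<tau> * \<kappa>" "arc_weight c (snd d) = 1 - \<tau> * \<mu>"
    "arc_weight d (fst d) = 1" "arc_weight d (snd d) = 1"
    "arc_weight d (fst c) = 1 - \<tau> * \<kappa>" "arc_weight d (snd c) = 1 + \<tau> * \<mu>"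
    using \<tau> by (simp_all add: arc_weight_def ends os \<tau>_def[symmetric] \<kappa>_def[symmetric]
      \<mu>_def[symmetric] algebra_simps)
  have same: "arc_weight c z = arc_weight d z" if "e \<in> C" "z \<in> {fst e, snd e}" for e z
    using apart[OF that] order_sign_swap[of _ z] by (simp add: arc_weight_def ends)
  have flat: "arc_weight e (fst c) = arc_weight e (fst d) \<and> arc_weight e (snd c) = arc_weight e (snd d)"
    if "e \<in> C" for e
    using apart[OF that] by (simp add: arc_weight_def)
  have expand: "pairing \<epsilon>' ?C U V =
      \<epsilon>' c * (U (fst c) * V (snd c) - U (snd c) * V (fst c)
         - U (fst d) * V (snd d) + U (snd d) * V (fst d)) + pairing \<epsilon> C U V" for U V
    using assms(1-4) \<epsilon> by (simp add: pairing_insert algebra_simps cong: pairing_cong)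
  have old: "pairing \<epsilon>' ?C U V = pairing \<epsilon> C U V"
    if "U (fst c) = U (fst d)" "U (snd c) = U (snd d)" "V (fst c) = V (fst d)" "V (snd c) = V (snd d)"
    for U V
    using that by (simp add: expand algebra_simps)
  have Ccd: "pairing \<epsilon> C (arc_weight d) V = pairing \<epsilon> C (arc_weight c) V" for V
    by (rule pairing_cong) (auto simp: same)
  have twin: "pairing \<epsilon>' ?C (arc_weight d) V = pairing \<epsilon>' ?C (arc_weight c) V"
    if "V (fst c) = V (fst d)" "V (snd c) = V (snd d)" for V
    using that by (simp add: expand Ccd aw_ends algebra_simps)
  have "loop_pairing \<epsilon> C c d = 0" "loop_pairing \<epsilon> C d c = 0"
    using Ccd[of "arc_weight c"] Ccd[of "arc_weight d"] by (simp_all add: pairing_self)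
  then have cd: "loop_pairing \<epsilon>' ?C c d = 0" "loop_pairing \<epsilon>' ?C d c = 0"
    by (simp_all add: expand aw_ends algebra_simps)
  have row: "loop_pairing \<epsilon>' ?C d j = loop_pairing \<epsilon>' ?C c j" if j: "j \<in> ?C" for j
  proof -
    consider "j = c" | "j = d" | "j \<in> C" using j by blast
    then show ?thesis
    proof cases
      case 3
      then show ?thesis using flat[OF 3] by (intro twin) blast+
    qed (use cd in \<open>simp_all add: pairing_self\<close>)
  qed
  have col: "loop_pairing \<epsilon>' ?C j d = loop_pairing \<epsilon>' ?C j c" if "j \<in> ?C" for j
    using row[OF that] pairing_swap[of \<epsilon>' ?C "arc_weight j"] by simp
  have ind: "loop_index \<epsilon>' ?C d = loop_index \<epsilon>' ?C c"
    by (rule twin) auto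
  have type: "crossing_type d = crossing_type c"
    by (rule crossing_type_order_sign) (rule ends)
  have "state_sum \<Phi> a b \<epsilon>' ?C = (\<Sum>i\<in>C. \<Sum>j\<in>C. of_int (typed_sign \<epsilon>' a i * typed_sign \<epsilon>' b j) *
      \<Phi> (loop_index \<epsilon>' ?C i) (loop_index \<epsilon>' ?C j) (loop_pairing \<epsilon>' ?C i j))"
    unfolding state_sum_def
    by (rule sum_sum_insert_cancelling_pair)
      (use assms(1-4) in \<open>auto simp only: typed_sign_def type \<epsilon>(2) ind row col, auto\<close>)
  also have "\<dots> = state_sum \<Phi> a b \<epsilon> C"
    unfolding state_sum_def by (intro sum.cong refl) (simp add: old flat typed_sign_def \<epsilon>)
  finally show ?thesis .
qed

section \<open>The triangle of the third move\<close>

text \<open>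
  A strand is an interval, so a parameter off the strand lies on one side of it.
\<close>

lemma order_sign_strand:
  assumes "strand A" "z \<notin> A" "s \<in> A" "t \<in> A"
  shows "order_sign z s = order_sign z t"
  using assms by (auto simp: strand_def order_sign_def)

lemma order_sign_disjoint_strands:
  assumes "strand A" "strand B" "A \<inter> B = {}" "s \<in> A" "s' \<in> A" "t \<in> B" "t' \<in> B"
  shows "order_sign s t = order_sign s' t'"
proof -
  have "order_sign s t = order_sign s t'" using assms by (intro order_sign_strand) auto
  also have "order_sign t' s = order_sign t' s'" using assms by (intro order_sign_strand) auto
  then have "order_sign s t' = order_sign s' t'"
    using order_sign_swap[of s t'] order_sign_swap[of s' t'] by simp
  finally show ?thesis .
qed

text \<open>
  The crossing of a strand passing at \<open>x\<close> and a strand passing at \<open>y\<close>, where \<open>up\<close> says that the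
  first strand is on top.
\<close>

definition orient :: "bool \<Rightarrow> real \<Rightarrow> real \<Rightarrow> real \<times> real" where
  "orient up x y = (if up then (x, y) else (y, x))"

text \<open>
  The sign of the two strands as an ordered pair of directions. Exchanging over and under changes
  neither this sign nor the contribution of the crossing to a pairing.
\<close>

definition flat_sign :: "(real \<times> real \<Rightarrow> int) \<Rightarrow> bool \<Rightarrow> real \<Rightarrow> real \<Rightarrow> int" where
  "flat_sign \<epsilon> up x y = (if up then \<epsilon> (x, y) else - \<epsilon> (y, x))"

lemma orient_simps [simp]:
  "fst (orient up x y) = (if up then x else y)" "snd (orient up x y) = (if up then y else x)"
  by (auto simp: orient_def)

lemma arc_weight_orient: "arc_weight (orient up x y) = arc_weight (x, y)"
  using order_sign_swap[of x y] by (auto simp: arc_weight_def orient_def fun_eq_iff algebra_simps)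

lemma pairing_insert_orient:
  assumes "finite C" "orient up x y \<notin> C"
  shows "pairing \<epsilon> (insert (orient up x y) C) U V =
    flat_sign \<epsilon> up x y * (U x * V y - U y * V x) + pairing \<epsilon> C U V"
  using assms by (auto simp: pairing_insert orient_def flat_sign_def algebra_simps split: if_splits)

text \<open>
  The crossings of \<open>A\<close> with \<open>B\<close>, \<open>A\<close> with \<open>E\<close> and \<open>B\<close> with \<open>E\<close> have the passages \<open>(a1, b1)\<close>,
  \<open>(a2, e1)\<close> and \<open>(b2, e2)\<close>. The directions \<open>\<sigma>A\<close>, \<open>\<sigma>B\<close>, \<open>\<sigma>E\<close> determine the order of the two
  passages on each strand, and the move reverses all three orders. It does not change the flat
  signs, which are products of two directions.

  Let \<open>\<tau>\<close> move the six passages. Arcs of other crossings do not see the move, and arcs of the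
  three crossings keep their weights at other passages, so only the part \<open>tri\<close> of the form at the
  triangle matters. There the weights of the three arcs are affine functions of the directions, and
  the move reverses every direction in them. Hence the change of \<open>tri\<close> is twice its part that is
  odd in the directions, and the three flat signs make the odd part vanish.
\<close>

lemma state_sum_triangle:
  assumes "finite C" and strands: "strand A" "strand B" "strand E"
    and disjoint: "A \<inter> B = {}" "A \<inter> E = {}" "B \<inter> E = {}"
    and outside: "\<And>c z. c \<in> C \<Longrightarrow> z \<in> {fst c, snd c} \<Longrightarrow> z \<notin> A \<union> B \<union> E"
    and points: "{a1, a2, a1', a2'} \<subseteq> A" "{b1, b2, b1', b2'} \<subseteq> B" "{e1, e2, e1', e2'} \<subseteq> E"
    and \<sigma>: "\<sigma>A \<in> {1, -1}" "\<sigma>B \<in> {1, -1}" "\<sigma>E \<in> {1, -1}"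
    and order: "order_sign a1 a2 = \<sigma>A" "order_sign b1 b2 = - \<sigma>B" "order_sign e1 e2 = - \<sigma>E"
    and order': "order_sign a1' a2' = - \<sigma>A" "order_sign b1' b2' = \<sigma>B" "order_sign e1' e2' = \<sigma>E"
    and sign: "flat_sign \<epsilon> p a1 b1 = - (\<sigma>A * \<sigma>B)" "flat_sign \<epsilon> q a2 e1 = - (\<sigma>A * \<sigma>E)"
      "flat_sign \<epsilon> r b2 e2 = \<sigma>B * \<sigma>E"
    and sign': "flat_sign \<epsilon>' p a1' b1' = - (\<sigma>A * \<sigma>B)" "flat_sign \<epsilon>' q a2' e1' = - (\<sigma>A * \<sigma>E)"
      "flat_sign \<epsilon>' r b2' e2' = \<sigma>B * \<sigma>E"
    and \<epsilon>: "\<And>c. c \<in> C \<Longrightarrow> \<epsilon>' c = \<epsilon> c"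
  shows "state_sum \<Phi> a b \<epsilon>' ({orient p a1' b1', orient q a2' e1', orient r b2' e2'} \<union> C) =
    state_sum \<Phi> a b \<epsilon> ({orient p a1 b1, orient q a2 e1, orient r b2 e2} \<union> C)"
proof -
  define c d e where "c = orient p a1 b1" and "d = orient q a2 e1" and "e = orient r b2 e2"
  define N where "N = {c, d, e} \<union> C"
  define \<tau> where "\<tau> = (\<lambda>z. z)(a1 := a1', a2 := a2', b1 := b1', b2 := b2', e1 := e1', e2 := e2')"
  define \<pi> where "\<pi> = map_prod \<tau> \<tau>"
  define six where "six = {a1, a2, b1, b2, e1, e2}"
  have pts: "a1 \<in> A" "a2 \<in> A" "a1' \<in> A" "a2' \<in> A" "b1 \<in> B" "b2 \<in> B" "b1' \<in> B" "b2' \<in> B"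
    "e1 \<in> E" "e2 \<in> E" "e1' \<in> E" "e2' \<in> E"
    using points by auto
  have neq: "a1 \<noteq> a2" "b1 \<noteq> b2" "e1 \<noteq> e2" "a1' \<noteq> a2'" "b1' \<noteq> b2'" "e1' \<noteq> e2'"
    using order order' \<sigma> by (auto simp: order_sign_def)
  have across: "x \<noteq> y \<and> y \<noteq> x"
    if "x \<in> A \<and> y \<in> B \<or> x \<in> A \<and> y \<in> E \<or> x \<in> B \<and> y \<in> E" for x y
    using that disjoint by blast
  have \<tau>_six: "\<tau> a1 = a1'" "\<tau> a2 = a2'" "\<tau> b1 = b1'" "\<tau> b2 = b2'" "\<tau> e1 = e1'" "\<tau> e2 = e2'"
    using neq points by (auto simp: \<tau>_def across)
  have \<tau>_id: "\<tau> z = z" if "z \<notin> A \<union> B \<union> E" for z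
    using that points by (auto simp: \<tau>_def)
  have inj_\<tau>: "inj_on \<tau> (six \<union> - (A \<union> B \<union> E))"
  proof -
    have "inj_on \<tau> six"
      using neq points by (auto simp: inj_on_def six_def \<tau>_six across)
    moreover have "inj_on \<tau> (- (A \<union> B \<union> E))"
      by (simp add: inj_on_def \<tau>_id)
    moreover have "\<tau> ` six \<subseteq> A \<union> B \<union> E"
      using points by (auto simp: six_def \<tau>_six)
    ultimately show ?thesis
      by (subst inj_on_Un) (auto simp: \<tau>_id)
  qed
  have N_ends: "fst i \<in> six \<union> - (A \<union> B \<union> E) \<and> snd i \<in> six \<union> - (A \<union> B \<union> E)" if "i \<in> N" for i
    using that outside[of i]
    by (cases p; cases q; cases r) (auto simp: N_def c_def d_def e_def six_def)
  have inj_\<pi>: "inj_on \<pi> N"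
    unfolding \<pi>_def inj_on_def using N_ends inj_onD[OF inj_\<tau>] by (auto simp: prod_eq_iff)
  have \<pi>_id: "\<pi> i = i" if "i \<in> C" for i
    using outside[OF that] by (simp add: \<pi>_def \<tau>_id map_prod_def case_prod_unfold)
  have \<pi>_new: "\<pi> c = orient p a1' b1'" "\<pi> d = orient q a2' e1'" "\<pi> e = orient r b2' e2'"
    by (simp_all add: \<pi>_def c_def d_def e_def orient_def \<tau>_six)
  have new: "c \<notin> insert d (insert e C) \<and> d \<notin> insert e C \<and> e \<notin> C"
    using outside[of c] outside[of d] outside[of e] points disjoint
    by (cases p; cases q; cases r) (auto simp: c_def d_def e_def orient_def)

  define \<alpha> \<beta> \<gamma> where "\<alpha> = order_sign a1 b1" and "\<beta> = order_sign a1 e1" and "\<gamma> = order_sign b1 e1"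
  have units: "\<alpha> = 1 \<or> \<alpha> = -1" "\<beta> = 1 \<or> \<beta> = -1" "\<gamma> = 1 \<or> \<gamma> = -1"
    "\<sigma>A = 1 \<or> \<sigma>A = -1" "\<sigma>B = 1 \<or> \<sigma>B = -1" "\<sigma>E = 1 \<or> \<sigma>E = -1"
    using \<sigma> points across unfolding \<alpha>_def \<beta>_def \<gamma>_def by (auto intro!: order_sign_cases)
  have AB: "order_sign s t = \<alpha>" if "s \<in> A" "t \<in> B" for s t unfolding \<alpha>_def
    by (rule order_sign_disjoint_strands[OF strands(1,2) disjoint(1) that(1) pts(1) that(2) pts(5)])
  have AE: "order_sign s t = \<beta>" if "s \<in> A" "t \<in> E" for s t unfolding \<beta>_def
    by (rule order_sign_disjoint_strands[OF strands(1,3) disjoint(2) that(1) pts(1) that(2) pts(9)])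
  have BE: "order_sign s t = \<gamma>" if "s \<in> B" "t \<in> E" for s t unfolding \<gamma>_def
    by (rule order_sign_disjoint_strands[OF strands(2,3) disjoint(3) that(1) pts(5) that(2) pts(9)])
  have BA: "order_sign t s = - \<alpha>" if "s \<in> A" "t \<in> B" for s t
    using AB[OF that] order_sign_swap[of t s] by simp
  have EA: "order_sign t s = - \<beta>" if "s \<in> A" "t \<in> E" for s t
    using AE[OF that] order_sign_swap[of t s] by simp
  have EB: "order_sign t s = - \<gamma>" if "s \<in> B" "t \<in> E" for s t
    using BE[OF that] order_sign_swap[of t s] by simp
  have order_rev: "order_sign a2 a1 = - \<sigma>A" "order_sign b2 b1 = \<sigma>B" "order_sign e2 e1 = \<sigma>E"
    "order_sign a2' a1' = \<sigma>A" "order_sign b2' b1' = - \<sigma>B" "order_sign e2' e1' = - \<sigma>E"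
    using order order' order_sign_swap[of a2 a1] order_sign_swap[of b2 b1] order_sign_swap[of e2 e1]
      order_sign_swap[of a2' a1'] order_sign_swap[of b2' b1'] order_sign_swap[of e2' e1'] by auto
  note orders = AB AE BE BA EA EB order order' order_rev

  (* old and new weights, both as functions of the old parameters *)
  define W W' where "W i = arc_weight i" and "W' i = arc_weight (\<pi> i) \<circ> \<tau>" for i
  have N_cases: thesis
    if "i \<in> N" "i = c \<Longrightarrow> thesis" "i = d \<Longrightarrow> thesis" "i = e \<Longrightarrow> thesis" "i \<in> C \<Longrightarrow> thesis" for i thesis
    using that by (auto simp: N_def)
  have type: "crossing_type (\<pi> i) = crossing_type i" if "i \<in> N" for i
  proof (rule crossing_type_order_sign)
    from that show "order_sign (fst (\<pi> i)) (snd (\<pi> i)) = order_sign (fst i) (snd i)"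
    proof (rule N_cases)
      show ?thesis if "i = c"
        unfolding that \<pi>_new unfolding c_def using pts by (simp add: orders)
      show ?thesis if "i = d"
        unfolding that \<pi>_new unfolding d_def using pts by (simp add: orders)
      show ?thesis if "i = e"
        unfolding that \<pi>_new unfolding e_def using pts by (simp add: orders)
    qed (simp add: \<pi>_id)
  qed
  have \<epsilon>_\<pi>: "\<epsilon>' (\<pi> i) = \<epsilon> i" if "i \<in> N" for i
    using that
  proof (rule N_cases)
    show ?thesis if "i = c" unfolding that \<pi>_new unfolding c_def
      using sign(1) sign'(1) by (cases p) (simp_all add: orient_def flat_sign_def)
    show ?thesis if "i = d" unfolding that \<pi>_new unfolding d_def
      using sign(2) sign'(2) by (cases q) (simp_all add: orient_def flat_sign_def)
    show ?thesis if "i = e" unfolding that \<pi>_new unfolding e_def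
      using sign(3) sign'(3) by (cases r) (simp_all add: orient_def flat_sign_def)
  qed (simp add: \<pi>_id \<epsilon>)

  have flat: "W i a1 = W i a2 \<and> W i b1 = W i b2 \<and> W i e1 = W i e2" if "i \<in> C" for i
    using order_sign_strand[OF strands(1), of _ a1 a2] order_sign_strand[OF strands(2), of _ b1 b2]
      order_sign_strand[OF strands(3), of _ e1 e2] outside[OF that] pts
    by (simp add: W_def arc_weight_def)
  have flat': "W' i z = W i z" if "i \<in> C" "z \<in> six" for i z
    using order_sign_strand[OF strands(1), of _ z "\<tau> z"]
      order_sign_strand[OF strands(2), of _ z "\<tau> z"]
      order_sign_strand[OF strands(3), of _ z "\<tau> z"] outside[OF that(1)] pts that
    by (auto simp: W_def W'_def arc_weight_def six_def \<pi>_id \<tau>_six)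
  have old: "W' i z = W i z" if i: "i \<in> N" and z: "z \<notin> A \<union> B \<union> E" for i z
  proof -
    have *: "order_sign s z = order_sign s' z"
      if "s \<in> A \<and> s' \<in> A \<or> s \<in> B \<and> s' \<in> B \<or> s \<in> E \<and> s' \<in> E" for s s'
      using that z strands order_sign_strand[of _ z s s'] order_sign_swap[of _ z] by auto
    have ends: "order_sign a1' z = order_sign a1 z" "order_sign a2' z = order_sign a2 z"
      "order_sign b1' z = order_sign b1 z" "order_sign b2' z = order_sign b2 z"
      "order_sign e1' z = order_sign e1 z" "order_sign e2' z = order_sign e2 z"
      using pts by (auto intro!: *)
    from i show ?thesis
    proof (rule N_cases)
      show ?thesis if "i = c" unfolding that W_def W'_def comp_def \<tau>_id[OF z] \<pi>_new
        unfolding c_def arc_weight_orient using pts by (simp add: arc_weight_def orders ends)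
      show ?thesis if "i = d" unfolding that W_def W'_def comp_def \<tau>_id[OF z] \<pi>_new
        unfolding d_def arc_weight_orient using pts by (simp add: arc_weight_def orders ends)
      show ?thesis if "i = e" unfolding that W_def W'_def comp_def \<tau>_id[OF z] \<pi>_new
        unfolding e_def arc_weight_orient using pts by (simp add: arc_weight_def orders ends)
    qed (simp add: W_def W'_def \<pi>_id \<tau>_id[OF z])
  qed
  have W: "W c = arc_weight (a1, b1)" "W d = arc_weight (a2, e1)" "W e = arc_weight (b2, e2)"
    by (simp_all add: W_def c_def d_def e_def arc_weight_orient)
  have W': "W' c z = arc_weight (a1', b1') (\<tau> z)" "W' d z = arc_weight (a2', e1') (\<tau> z)"
    "W' e z = arc_weight (b2', e2') (\<tau> z)" for z
    unfolding W'_def comp_def \<pi>_new arc_weight_orient by (rule refl)+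
  have squares: "\<alpha> * \<alpha> = 1" "\<beta> * \<beta> = 1" "\<gamma> * \<gamma> = 1"
    "\<sigma>A * \<sigma>A = 1" "\<sigma>B * \<sigma>B = 1" "\<sigma>E * \<sigma>E = 1" using units by auto
  have squares': "\<alpha> * (\<alpha> * x) = x" "\<beta> * (\<beta> * x) = x" "\<gamma> * (\<gamma> * x) = x"
    "\<sigma>A * (\<sigma>A * x) = x" "\<sigma>B * (\<sigma>B * x) = x" "\<sigma>E * (\<sigma>E * x) = x" for x
    unfolding mult.assoc[symmetric] squares by simp_all
  have weights:
    "W c a1 = 1" "W c b1 = 1" "W c a2 = 1 + \<alpha> * \<sigma>A" "W c b2 = 1 + \<alpha> * \<sigma>B"
    "W c e1 = \<alpha> * (\<beta> - \<gamma>)" "W c e2 = \<alpha> * (\<beta> - \<gamma>)"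
    "W d a2 = 1" "W d e1 = 1" "W d a1 = 1 - \<beta> * \<sigma>A" "W d e2 = 1 + \<beta> * \<sigma>E"
    "W d b1 = \<beta> * (\<alpha> + \<gamma>)" "W d b2 = \<beta> * (\<alpha> + \<gamma>)"
    "W e b2 = 1" "W e e2 = 1" "W e b1 = 1 + \<gamma> * \<sigma>B" "W e e1 = 1 - \<gamma> * \<sigma>E"
    "W e a1 = \<gamma> * (\<beta> - \<alpha>)" "W e a2 = \<gamma> * (\<beta> - \<alpha>)"
    "W' c a1 = 1" "W' c b1 = 1" "W' c a2 = 1 - \<alpha> * \<sigma>A" "W' c b2 = 1 - \<alpha> * \<sigma>B"
    "W' c e1 = \<alpha> * (\<beta> - \<gamma>)" "W' c e2 = \<alpha> * (\<beta> - \<gamma>)"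
    "W' d a2 = 1" "W' d e1 = 1" "W' d a1 = 1 + \<beta> * \<sigma>A" "W' d e2 = 1 - \<beta> * \<sigma>E"
    "W' d b1 = \<beta> * (\<alpha> + \<gamma>)" "W' d b2 = \<beta> * (\<alpha> + \<gamma>)"
    "W' e b2 = 1" "W' e e2 = 1" "W' e b1 = 1 - \<gamma> * \<sigma>B" "W' e e1 = 1 + \<gamma> * \<sigma>E"
    "W' e a1 = \<gamma> * (\<beta> - \<alpha>)" "W' e a2 = \<gamma> * (\<beta> - \<alpha>)"
    using pts squares by (simp_all add: W W' \<tau>_six arc_weight_def orders algebra_simps)

  define tri where "tri U V = - (\<sigma>A * \<sigma>B) * (U a1 * V b1 - U b1 * V a1)
    - \<sigma>A * \<sigma>E * (U a2 * V e1 - U e1 * V a2) + \<sigma>B * \<sigma>E * (U b2 * V e2 - U e2 * V b2)"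
    for U V :: "real \<Rightarrow> int"
  have tri_swap: "tri V U = - tri U V" for U V
    by (simp add: tri_def algebra_simps)
  (* pairings with an arc or the whole knot that does not distinguish passages on a strand *)
  have tri_flat: "tri (W' i) V' = tri (W i) V"
    if i: "i \<in> N" and flat_V: "V a1 = V a2 \<and> V b1 = V b2 \<and> V e1 = V e2"
      and same_V: "\<And>z. z \<in> six \<Longrightarrow> V' z = V z" for i V V'
  proof -
    have V': "V' a1 = V a1" "V' a2 = V a1" "V' b1 = V b1" "V' b2 = V b1" "V' e1 = V e1" "V' e2 = V e1"
      using flat_V same_V by (auto simp: six_def)
    have V: "V a2 = V a1" "V b2 = V b1" "V e2 = V e1" using flat_V by auto
    consider "i = c" | "i = d" | "i = e" | "i \<in> C" using i by (auto simp: N_def)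
    then show ?thesis
    proof cases
      case 1
      show ?thesis unfolding tri_def V' V 1 weights
        by (simp add: algebra_simps squares squares')
    next
      case 2
      show ?thesis unfolding tri_def V' V 2 weights
        by (simp add: algebra_simps squares squares')
    next
      case 3
      show ?thesis unfolding tri_def V' V 3 weights
        by (simp add: algebra_simps squares squares')
    next
      case 4
      then show ?thesis using flat'[OF 4] by (simp add: tri_def V' V six_def)
    qed
  qed
  have tri_cd: "tri (W' c) (W' d) = tri (W c) (W d)"
    unfolding tri_def weights by (simp add: algebra_simps squares squares')
  have tri_ce: "tri (W' c) (W' e) = tri (W c) (W e)"
    unfolding tri_def weights by (simp add: algebra_simps squares squares')
  have tri_de: "tri (W' d) (W' e) = tri (W d) (W e)"
    unfolding tri_def weights by (simp add: algebra_simps squares squares')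
  have tri_W: "tri (W' i) (W' j) = tri (W i) (W j)" if ij: "i \<in> N" "j \<in> N" for i j
  proof -
    have self: "tri U U = 0" for U by (simp add: tri_def)
    consider "j \<in> C" | "i \<in> C" | "i \<in> {c, d, e}" "j \<in> {c, d, e}"
      using ij by (auto simp: N_def)
    then show ?thesis
    proof cases
      case 1
      then show ?thesis using tri_flat[OF ij(1) flat[OF 1]] flat'[OF 1] by blast
    next
      case 2
      then have "tri (W' j) (W' i) = tri (W j) (W i)"
        using tri_flat[OF ij(2) flat[OF 2]] flat'[OF 2] by blast
      then show ?thesis using tri_swap[of "W' i" "W' j"] tri_swap[of "W i" "W j"] by simp
    next
      case 3
      then show ?thesis using tri_cd tri_ce tri_de self
        tri_swap[of "W' d" "W' c"] tri_swap[of "W' e" "W' c"] tri_swap[of "W' e" "W' d"]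
        tri_swap[of "W d" "W c"] tri_swap[of "W e" "W c"] tri_swap[of "W e" "W d"] by auto
    qed
  qed
  have expand: "pairing \<epsilon> N U V = tri U V + pairing \<epsilon> C U V" for U V
    using new assms(1)
    by (simp add: N_def c_def d_def e_def pairing_insert_orient sign tri_def algebra_simps)
  have new_pairing: "pairing \<epsilon>' (\<pi> ` N) (arc_weight (\<pi> i)) V =
      tri (W' i) (V \<circ> \<tau>) + pairing \<epsilon> C (W i) (V \<circ> \<tau>)" if "i \<in> N" for i V
  proof -
    have "pairing \<epsilon>' (\<pi> ` N) (arc_weight (\<pi> i)) V = pairing (\<epsilon>' \<circ> \<pi>) N (W' i) (V \<circ> \<tau>)"
      unfolding \<pi>_def W'_def by (rule pairing_image) (use inj_\<pi> in \<open>simp add: \<pi>_def\<close>)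
    also have "\<dots> = pairing \<epsilon> N (W' i) (V \<circ> \<tau>)"
      by (rule pairing_cong) (auto simp: \<epsilon>_\<pi>)
    also have "\<dots> = tri (W' i) (V \<circ> \<tau>) + pairing \<epsilon> C (W' i) (V \<circ> \<tau>)"
      by (rule expand)
    also have "pairing \<epsilon> C (W' i) (V \<circ> \<tau>) = pairing \<epsilon> C (W i) (V \<circ> \<tau>)"
      by (rule pairing_cong) (use outside old[OF that] in auto)
    finally show ?thesis .
  qed
  have "loop_index \<epsilon>' (\<pi> ` N) (\<pi> i) = loop_index \<epsilon> N i" if "i \<in> N" for i
  proof -
    have "tri (W' i) (\<lambda>_. 2) = tri (W i) (\<lambda>_. 2)" by (rule tri_flat[OF that]) auto
    then show ?thesis by (simp add: new_pairing[OF that] expand W_def comp_def)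
  qed
  moreover have "loop_pairing \<epsilon>' (\<pi> ` N) (\<pi> i) (\<pi> j) = loop_pairing \<epsilon> N i j"
    if ij: "i \<in> N" "j \<in> N" for i j
  proof -
    have "pairing \<epsilon> C (W i) (W' j) = pairing \<epsilon> C (W i) (W j)"
      by (rule pairing_cong) (use outside old[OF ij(2)] in auto)
    then show ?thesis
      using tri_W[OF ij] by (simp add: new_pairing[OF ij(1)] expand W_def W'_def)
  qed
  ultimately have "state_sum \<Phi> a b \<epsilon>' (\<pi> ` N) = state_sum \<Phi> a b \<epsilon> N"
    by (intro state_sum_reindex inj_\<pi> type \<epsilon>_\<pi>)
  moreover have "\<pi> ` N = {orient p a1' b1', orient q a2' e1', orient r b2' e2'} \<union> C"
    by (simp add: N_def image_Un \<pi>_new \<pi>_id)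
  ultimately show ?thesis by (simp add: N_def c_def d_def e_def)
qed

section \<open>The cyclic order at a vertex of a surface\<close>

lemma count_list_distinct: "distinct xs \<Longrightarrow> count_list xs x = of_bool (x \<in> set xs)"
  by (induction xs) auto

text \<open>
  The number of steps of the rotation from \<open>c\<close> to \<open>d\<close>. It linearises the cyclic order at the vertex,
  with \<open>c\<close> as the least dart.
\<close>

definition turn :: "('d, 'm) surface_scheme \<Rightarrow> 'd \<Rightarrow> 'd \<Rightarrow> nat" where
  "turn M c d = (LEAST j. (rot M ^^ j) c = d)"

lemma turn_works: "same_vertex M c d \<Longrightarrow> (rot M ^^ turn M c d) c = d"
  unfolding turn_def same_vertex_def by (rule LeastI_ex)

lemma turn_le: "(rot M ^^ j) c = d \<Longrightarrow> turn M c d \<le> j"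
  unfolding turn_def by (rule Least_le)

lemma same_vertex_refl [simp]: "same_vertex M c c"
  unfolding same_vertex_def by (rule exI[of _ 0]) simp

lemma same_vertex_trans:
  assumes "same_vertex M c d" "same_vertex M d e"
  shows "same_vertex M c e"
proof -
  from assms obtain i j where "(rot M ^^ i) c = d" "(rot M ^^ j) d = e"
    by (auto simp: same_vertex_def)
  then have "(rot M ^^ (j + i)) c = e" by (simp add: funpow_add)
  then show ?thesis unfolding same_vertex_def by blast
qed

context
  fixes M :: "('d, 'm) surface_scheme"
  assumes M: "closed_surface M"
begin

lemma rot_period: "\<exists>n>0. \<forall>c. (rot M ^^ n) c = c"
proof -
  have "permutation (rot M)"
    using M unfolding closed_surface_def permutation_permutes by blast
  then show ?thesis
    using permutation_is_nilpotent[of "rot M"] by (metis id_apply)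
qed

lemma same_vertex_sym:
  assumes "same_vertex M c d" shows "same_vertex M d c"
proof -
  from assms obtain j where j: "(rot M ^^ j) c = d" by (auto simp: same_vertex_def)
  from rot_period obtain n where n: "n > 0" "\<And>c. (rot M ^^ n) c = c" by blast
  have mult: "(rot M ^^ (n * i)) c = c" for i
    by (induction i) (simp_all add: funpow_add n(2))
  have "j \<le> n * j" using n(1) by simp
  then have "(rot M ^^ (n * j - j)) d = (rot M ^^ (n * j)) c"
    using j by (simp flip: funpow_add[THEN fun_cong, unfolded comp_def] j)
  then show ?thesis unfolding same_vertex_def using mult by metis
qed

text \<open>
  Otherwise a full period could be removed from the least rotation.
\<close>

lemma turn_less_period:
  assumes "same_vertex M c d" "(rot M ^^ n) c = c" "n > 0"
  shows "turn M c d < n"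
proof (rule ccontr)
  assume "\<not> turn M c d < n"
  then have "n \<le> turn M c d" by simp
  then have "(rot M ^^ (turn M c d - n)) ((rot M ^^ n) c) = d"
    using turn_works[OF assms(1)] by (simp flip: funpow_add[THEN fun_cong, unfolded comp_def])
  then have "turn M c d \<le> turn M c d - n" using assms(2) by (intro turn_le) simp
  with \<open>n \<le> turn M c d\<close> assms(3) show False by simp
qed

lemma between_iff:
  assumes "same_vertex M c d" "c \<noteq> d"
  shows "e \<in> between M c d \<longleftrightarrow> same_vertex M c e \<and> e \<noteq> c \<and> turn M c e < turn M c d"
proof
  assume "e \<in> between M c d"
  then obtain j where j: "e = (rot M ^^ j) c" "0 < j" "\<And>i. 0 < i \<Longrightarrow> i \<le> j \<Longrightarrow> (rot M ^^ i) c \<noteq> d"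
    by (auto simp: between_def)
  have pos: "0 < turn M c d"
    using turn_works[OF assms(1)] assms(2) by (cases "turn M c d") auto
  have less: "j < turn M c d"
    using j(3)[OF pos] turn_works[OF assms(1)] by fastforce
  moreover have "turn M c e \<le> j" using j(1) by (intro turn_le) simp
  moreover have "e \<noteq> c"
    using turn_less_period[OF assms(1), of j] j(1,2) less by auto
  ultimately show "same_vertex M c e \<and> e \<noteq> c \<and> turn M c e < turn M c d"
    using j(1) by (auto simp: same_vertex_def)
next
  assume e: "same_vertex M c e \<and> e \<noteq> c \<and> turn M c e < turn M c d"
  then have w: "(rot M ^^ turn M c e) c = e" by (simp add: turn_works)
  have "0 < turn M c e" using w e by (cases "turn M c e") auto
  moreover have "(rot M ^^ i) c \<noteq> d" if "i \<le> turn M c e" for i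
    using turn_le[where j = i and c = c and d = d] that e by fastforce
  ultimately show "e \<in> between M c d"
    unfolding between_def using w by (intro CollectI exI[of _ "turn M c e"]) auto
qed

lemma between_asym:
  assumes "same_vertex M c d" "same_vertex M c e" "c \<noteq> d" "c \<noteq> e" "d \<noteq> e"
  shows "e \<in> between M c d \<longleftrightarrow> d \<notin> between M c e"
proof -
  have "turn M c d \<noteq> turn M c e"
    using turn_works[OF assms(1)] turn_works[OF assms(2)] assms(5) by metis
  then show ?thesis using assms between_iff[of c d e] between_iff[of c e d] by auto
qed

text \<open>
  The relation "\<open>c\<close>, \<open>e\<close>, \<open>d\<close> are in counterclockwise order" is invariant under cyclic permutation:
  measured from \<open>e\<close> instead of \<open>c\<close>, the dart \<open>d\<close> comes before the rotation returns to \<open>c\<close>.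
\<close>

lemma between_rotate:
  assumes "same_vertex M c d" "c \<noteq> d" "e \<in> between M c d"
  shows "d \<in> between M e c"
proof -
  have e: "same_vertex M c e" "e \<noteq> c" "turn M c e < turn M c d"
    using between_iff[OF assms(1,2)] assms(3) by auto
  have ec: "same_vertex M e c" using same_vertex_sym[OF e(1)] .
  have ed: "same_vertex M e d" using same_vertex_trans[OF ec assms(1)] .
  have "(rot M ^^ (turn M e c + turn M c e)) c = c"
    using turn_works[OF e(1)] turn_works[OF ec] by (simp add: funpow_add)
  moreover have "0 < turn M c e"
    using turn_works[OF e(1)] e(2) by (cases "turn M c e") auto
  ultimately have "turn M c d < turn M e c + turn M c e"
    by (intro turn_less_period assms(1)) auto
  moreover have "(rot M ^^ (turn M c d - turn M c e)) ((rot M ^^ turn M c e) c) = d"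
    using e(3) turn_works[OF assms(1)] by (simp flip: funpow_add[THEN fun_cong, unfolded comp_def])
  then have "turn M e d \<le> turn M c d - turn M c e"
    using turn_works[OF e(1)] by (intro turn_le) simp
  ultimately have "turn M e d < turn M e c" using e(3) by simp
  moreover have "d \<noteq> e" using e(3) by auto
  ultimately show ?thesis using between_iff[OF ec e(2)] ed by simp
qed

lemma between_subset_darts: "c \<in> darts M \<Longrightarrow> between M c d \<subseteq> darts M"
proof -
  assume c: "c \<in> darts M"
  have "rot M permutes darts M" using M by (simp add: closed_surface_def)
  then have "(rot M ^^ j) c \<in> darts M" for j
    by (induction j) (simp_all add: c permutes_in_image)
  then show ?thesis by (auto simp: between_def)
qed

end

section \<open>Intersection numbers of loops on a knot\<close>

definition pred_mod :: "nat \<Rightarrow> nat \<Rightarrow> nat" where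
  "pred_mod n m = (m + n - 1) mod n"

definition succ_mod :: "nat \<Rightarrow> nat \<Rightarrow> nat" where
  "succ_mod n m = (m + 1) mod n"

lemma pred_mod_eq: "m < n \<Longrightarrow> pred_mod n m = (if m = 0 then n - 1 else m - 1)"
proof (cases m)
  case (Suc k)
  assume "m < n"
  then have "(m + n - 1) mod n = (k + n) mod n" using Suc by simp
  then show ?thesis using \<open>m < n\<close> Suc by (simp add: pred_mod_def)
qed (simp add: pred_mod_def)

lemma succ_mod_eq: "m < n \<Longrightarrow> succ_mod n m = (if m + 1 = n then 0 else m + 1)"
  by (auto simp: succ_mod_def)

lemma pred_mod_less: "m < n \<Longrightarrow> pred_mod n m < n"
  by (auto simp: pred_mod_eq)

lemma succ_mod_less: "m < n \<Longrightarrow> succ_mod n m < n"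
  by (simp add: succ_mod_eq)

lemma pred_succ_mod: "m < n \<Longrightarrow> pred_mod n (succ_mod n m) = m"
  by (auto simp: succ_mod_eq pred_mod_eq)

lemma succ_pred_mod: "m < n \<Longrightarrow> succ_mod n (pred_mod n m) = m"
  by (auto simp: succ_mod_eq pred_mod_eq)

lemma bij_betw_pred_mod: "bij_betw (pred_mod n) {..<n} {..<n}"
  by (rule bij_betw_byWitness[of _ "succ_mod n"])
    (auto simp: pred_succ_mod succ_pred_mod pred_mod_less succ_mod_less)

lemma sum_nth_distinct: "distinct xs \<Longrightarrow> (\<Sum>j<length xs. f (xs ! j)) = sum f (set xs)"
  using sum.reindex_bij_betw[OF bij_betw_nth[OF _ refl refl], of xs f] by simp

text \<open>
  A loop on the knot is encoded by the list of the indices of its darts. The dart with index \<open>m\<close>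
  leaves passage \<open>m\<close>, and the dart that enters passage \<open>m\<close> has the index \<open>pred_mod (length (knot S)) m\<close>.
\<close>

definition occupies :: "nat set \<Rightarrow> nat \<Rightarrow> int" where
  "occupies R m = of_bool (m \<in> R)"

text \<open>
  The number of the two half-strands of passage \<open>m\<close> that belong to the loop, which is twice the
  fraction of the passage on the loop.
\<close>

definition passage_weight :: "('d, 'm) surface_knot_scheme \<Rightarrow> nat set \<Rightarrow> nat \<Rightarrow> int" where
  "passage_weight S R m = occupies R m + occupies R (pred_mod (length (knot S)) m)"

text \<open>
  Kirchhoff's law: the chain with the given darts has no boundary at any vertex.
\<close>

definition balanced :: "('d, 'm) surface_knot_scheme \<Rightarrow> nat set \<Rightarrow> bool" where
  "balanced S R \<longleftrightarrow>
     (\<forall>m<length (knot S). (\<forall>m'. \<not> double_passage S m m') \<longrightarrow>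
        occupies R m = occupies R (pred_mod (length (knot S)) m)) \<and>
     (\<forall>m m'. double_passage S m m' \<longrightarrow> occupies R m + occupies R m' =
        occupies R (pred_mod (length (knot S)) m) + occupies R (pred_mod (length (knot S)) m'))"

text \<open>
  At each of its vertices the loop goes straight on or turns into the other passage of a double
  point, as in a smoothing that respects the orientation. The passage \<open>q\<close> is the one entered by the
  preceding dart.
\<close>

definition knot_loop :: "('d, 'm) surface_knot_scheme \<Rightarrow> nat list \<Rightarrow> bool" where
  "knot_loop S rs \<longleftrightarrow>
     rs \<noteq> [] \<and> distinct rs \<and> set rs \<subseteq> {..<length (knot S)} \<and> balanced S (set rs) \<and>
     (\<forall>j<length rs. let q = succ_mod (length (knot S)) (rs ! pred_mod (length rs) j) in
        q = rs ! j \<or> double_passage S (rs ! j) q)"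

text \<open>
  The set of summands is empty or consists of the other passage of a double point.
\<close>

definition crossing_weight :: "('d, 'm) surface_knot_scheme \<Rightarrow> nat set \<Rightarrow> nat \<Rightarrow> int" where
  "crossing_weight S R m =
     (\<Sum>m' | double_passage S m m'. surface_crossing_sign S (m, m') * passage_weight S R m')"

context
  fixes S :: "('d, 'm) surface_knot_scheme"
  assumes S: "surface_knot_diagram S"
begin

abbreviation (input) "K \<equiv> knot S"
abbreviation (input) "L \<equiv> length (knot S)"
abbreviation (input) "double \<equiv> double_passage S"
abbreviation (input) "outgoing m \<equiv> knot S ! m"
abbreviation (input) "incoming \<equiv> in_dart S (knot S)"
abbreviation (input) "osign k l \<equiv> surface_crossing_sign S (k, l)"

lemma surface: "closed_surface S" and knot_path: "closed_path S K" and distinct_knot: "distinct K"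
  and opp_knot: "opp S ` set K \<inter> set K = {}"
  using S by (auto simp: surface_knot_diagram_def)

lemma knot_in_darts: "m < L \<Longrightarrow> outgoing m \<in> darts S"
  using knot_path by (auto simp: closed_path_def)

lemma opp_opp: "m < L \<Longrightarrow> opp S (opp S (outgoing m)) = outgoing m"
  using surface knot_in_darts by (auto simp: closed_surface_def)

lemma incoming_eq: "incoming m = opp S (outgoing (pred_mod L m))"
  by (simp add: in_dart_def pred_mod_def)

lemma same_vertex_incoming: "m < L \<Longrightarrow> same_vertex S (outgoing m) (incoming m)"
  using knot_path by (simp add: closed_path_def)

lemma outgoing_eq_iff: "m < L \<Longrightarrow> m' < L \<Longrightarrow> outgoing m = outgoing m' \<longleftrightarrow> m = m'"
  using distinct_knot by (simp add: nth_eq_iff_index_eq)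

lemma outgoing_neq_incoming: "m < L \<Longrightarrow> m' < L \<Longrightarrow> outgoing m \<noteq> incoming m'"
  using opp_knot pred_mod_less[of m' L] nth_mem[of m K] nth_mem[of "pred_mod L m'" K]
  unfolding incoming_eq by fastforce

lemma incoming_eq_iff: "m < L \<Longrightarrow> m' < L \<Longrightarrow> incoming m = incoming m' \<longleftrightarrow> m = m'"
  by (metis incoming_eq opp_opp outgoing_eq_iff pred_mod_less succ_pred_mod)

lemma double_less: "double m m' \<Longrightarrow> m < L \<and> m' < L \<and> m \<noteq> m'"
  by (simp add: double_passage_def)

lemma double_sym: "double m m' \<Longrightarrow> double m' m"
  using same_vertex_sym[OF surface] by (auto simp: double_passage_def)

lemma double_unique: "double m m' \<Longrightarrow> double m m'' \<Longrightarrow> m'' = m'"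
  using S unfolding surface_knot_diagram_def by blast

lemma knot_crossing_double: "(k, l) \<in> knot_crossings S \<Longrightarrow> double k l \<and> (l, k) \<notin> knot_crossings S"
  using S by (auto simp: surface_knot_diagram_def)

lemma double_knot_crossing: "double k l \<Longrightarrow> (k, l) \<in> knot_crossings S \<or> (l, k) \<in> knot_crossings S"
  using S by (simp add: surface_knot_diagram_def)

lemma double_set: "double m m' \<Longrightarrow> {m'. double m m'} = {m'}"
  using double_unique by blast

lemma same_vertex_double:
  assumes "double m m'"
  shows "same_vertex S (outgoing m) (outgoing m')" "same_vertex S (outgoing m) (incoming m')"
  using assms same_vertex_incoming[of m'] same_vertex_trans by (auto simp: double_passage_def)

lemma knot_darts_at_passage:
  assumes "m < L" "same_vertex S (outgoing m) d" "d \<in> set K \<union> opp S ` set K"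
  obtains m' where "m' = m \<or> double m m'" "d = outgoing m' \<or> d = incoming m'"
proof -
  obtain r where r: "r < L" "d = outgoing r \<or> d = opp S (outgoing r)"
    using assms(3) by (auto simp: in_set_conv_nth)
  define m' where "m' = (if d = outgoing r then r else succ_mod L r)"
  have m': "m' < L" "d = outgoing m' \<or> d = incoming m'"
    using r by (auto simp: m'_def incoming_eq pred_succ_mod succ_mod_less)
  have "same_vertex S d (outgoing m')"
    using m' same_vertex_sym[OF surface same_vertex_incoming] by auto
  then have "same_vertex S (outgoing m) (outgoing m')"
    using assms(2) same_vertex_trans by metis
  then have "m' = m \<or> double m m'" using assms(1) m'(1) by (auto simp: double_passage_def)
  with m'(2) that show ?thesis by blast
qed

lemma transversal:
  "double k l \<Longrightarrow> outgoing l \<in> between S (outgoing k) (incoming k) \<longleftrightarrow>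
     incoming l \<notin> between S (outgoing k) (incoming k)"
  using S unfolding surface_knot_diagram_def left_side_def by blast

lemma osign_iff:
  "osign k l = 1 \<longleftrightarrow> outgoing l \<in> between S (outgoing k) (incoming k)"
  "osign k l = 1 \<or> osign k l = -1"
  by (simp_all add: surface_crossing_sign_def left_side_def)

lemma four_darts_distinct:
  assumes "double k l"
  shows "outgoing k \<noteq> incoming k" "outgoing k \<noteq> incoming l" "outgoing l \<noteq> incoming k"
    "outgoing l \<noteq> incoming l" "outgoing k \<noteq> outgoing l" "incoming k \<noteq> incoming l"
  using double_less[OF assms] by (auto simp: outgoing_eq_iff incoming_eq_iff outgoing_neq_incoming)

text \<open>
  Count the turns from the outgoing dart of \<open>k\<close>. By transversality the incoming dart of \<open>k\<close> lies
  between the two darts of \<open>l\<close>. If the outgoing dart of \<open>l\<close> is the first of these three, the corner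
  from \<open>l\<close> to \<open>k\<close> has the two darts on its left; otherwise the incoming dart of \<open>l\<close> is the first,
  and the corner has no dart of the knot on its left.
\<close>

lemma left_of_corner:
  assumes kl: "double k l"
  shows "outgoing l \<in> between S (outgoing k) (incoming l) \<longleftrightarrow> osign k l = 1"
    "incoming k \<in> between S (outgoing k) (incoming l) \<longleftrightarrow> osign k l = 1"
proof -
  note v = same_vertex_incoming[of k] same_vertex_double[OF kl]
  have k: "k < L" using double_less[OF kl] by simp
  note d = four_darts_distinct[OF kl]
  have turns: "e \<in> between S (outgoing k) f \<longleftrightarrow> turn S (outgoing k) e < turn S (outgoing k) f"
    if "e \<in> {incoming k, outgoing l, incoming l}" "f \<in> {incoming k, outgoing l, incoming l}" for e f
    using that v k d between_iff[OF surface, of "outgoing k" f e] by auto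
  have "turn S (outgoing k) e \<noteq> turn S (outgoing k) f"
    if "e \<in> {incoming k, outgoing l, incoming l}" "f \<in> {incoming k, outgoing l, incoming l}" "e \<noteq> f"
    for e f
    using that v k turn_works[of S "outgoing k"] by (metis insert_iff singletonD)
  from this[of "incoming k" "incoming l"] this[of "incoming k" "outgoing l"] transversal[OF kl] d
  show "outgoing l \<in> between S (outgoing k) (incoming l) \<longleftrightarrow> osign k l = 1"
    "incoming k \<in> between S (outgoing k) (incoming l) \<longleftrightarrow> osign k l = 1"
    unfolding osign_iff by (auto simp: turns)
qed

text \<open>
  The cyclic order of the four darts at a crossing is one of two. Rotating it from the outgoing
  dart of \<open>k\<close> to that of \<open>l\<close> exchanges left and right.
\<close>

lemma osign_swap: "double k l \<Longrightarrow> osign l k = - osign k l"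
proof -
  have half: "osign l k = -1" if kl: "double k l" and "osign k l = 1" for k l
  proof -
    have "outgoing l \<in> between S (outgoing k) (incoming l)"
      using left_of_corner[OF kl] that by simp
    then have "incoming l \<in> between S (outgoing l) (outgoing k)"
      using between_rotate[OF surface same_vertex_double(2)[OF kl]] four_darts_distinct[OF kl] by simp
    then have "outgoing k \<notin> between S (outgoing l) (incoming l)"
      using between_asym[OF surface, of "outgoing l" "outgoing k" "incoming l"]
        four_darts_distinct[OF kl] same_vertex_double[OF double_sym[OF kl]]
        same_vertex_incoming[of l] double_less[OF kl] by simp
    then show ?thesis using osign_iff[of l k] by auto
  qed
  have other: "osign l k = 1" if kl: "double k l" and "osign k l = -1" for k l
  proof -
    have "outgoing l \<notin> between S (outgoing k) (incoming l)"
      using left_of_corner[OF kl] that by simp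
    then have "incoming l \<in> between S (outgoing k) (outgoing l)"
      using between_asym[OF surface, of "outgoing k" "outgoing l" "incoming l"]
        four_darts_distinct[OF kl] same_vertex_double[OF kl] by simp
    then have "outgoing l \<in> between S (incoming l) (outgoing k)"
      using between_rotate[OF surface same_vertex_double(1)[OF kl]] four_darts_distinct[OF kl] by simp
    then have "outgoing k \<in> between S (outgoing l) (incoming l)"
      using between_rotate[OF surface, of "incoming l" "outgoing k" "outgoing l"]
        same_vertex_sym[OF surface same_vertex_double(2)[OF kl]] four_darts_distinct[OF kl] by simp
    then show ?thesis using osign_iff[of l k] by auto
  qed
  assume kl: "double k l"
  show "osign l k = - osign k l" using half[OF kl] other[OF kl] osign_iff(2)[of k l] by auto
qed

lemma path_coeff_knot:
  assumes "distinct rv" "set rv \<subseteq> {..<L}"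
  defines "v \<equiv> map ((!) K) rv"
  shows "m < L \<Longrightarrow> path_coeff S v (outgoing m) = occupies (set rv) m"
    and "m < L \<Longrightarrow> path_coeff S v (incoming m) = - occupies (set rv) (pred_mod L m)"
    and "d \<in> darts S \<Longrightarrow> d \<notin> set K \<union> opp S ` set K \<Longrightarrow> path_coeff S v d = 0"
proof -
  have "inj_on ((!) K) (set rv)"
    using assms(2) distinct_knot by (meson inj_on_nth subset_iff lessThan_iff)
  then have dist: "distinct v" using assms(1) by (simp add: v_def distinct_map)
  have sub: "set v \<subseteq> set K" using assms(2) by (auto simp: v_def)
  have out: "outgoing m \<in> set v \<longleftrightarrow> m \<in> set rv" if "m < L" for m
    using that assms(2) by (auto simp: v_def outgoing_eq_iff subset_iff)
  have opp_out: "opp S (outgoing m) \<notin> set v" if "m < L" for m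
    using that sub opp_knot nth_mem[of m K] by blast
  show "path_coeff S v (outgoing m) = occupies (set rv) m" if "m < L"
    using that by (simp add: path_coeff_def count_list_distinct[OF dist] out opp_out occupies_def)
  show "path_coeff S v (incoming m) = - occupies (set rv) (pred_mod L m)" if "m < L"
    using pred_mod_less[OF that]
    by (simp add: path_coeff_def count_list_distinct[OF dist] incoming_eq opp_opp out opp_out
        occupies_def)
  show "path_coeff S v d = 0" if "d \<in> darts S" "d \<notin> set K \<union> opp S ` set K"
  proof -
    have "opp S d \<notin> set K"
    proof
      assume "opp S d \<in> set K"
      then have "opp S (opp S d) \<in> opp S ` set K" by blast
      then show False using that surface by (simp add: closed_surface_def)
    qed
    then show ?thesis using that sub by (auto simp: path_coeff_def count_list_distinct[OF dist])
  qed
qed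

text \<open>
  Twice the sum over the left side is the difference of the left and the right sum plus the sum of
  both. By Kirchhoff's law the sum over all darts at the vertex is 0, so the sum of both sides comes
  from the two darts of the passage only. This gives the last term, which telescopes along a closed
  path. The difference of the sides is symmetric in the two half-strands of each passage that is met
  and gives the weights, once for the passage that is entered and once for the one that is left.
\<close>

lemma sum_left_of_passage:
  assumes r: "r < L" and qr: "q = r \<or> double r q"
    and "distinct rv" "set rv \<subseteq> {..<L}" "balanced S (set rv)"
  shows "4 * (\<Sum>d \<in> between S (outgoing r) (incoming q). path_coeff S (map ((!) K) rv) d) =
    crossing_weight S (set rv) r + crossing_weight S (set rv) q
      - 2 * (occupies (set rv) r - occupies (set rv) (pred_mod L q))"
proof -
  let ?cf = "path_coeff S (map ((!) K) rv)" and ?R = "set rv"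
  note cf = path_coeff_knot[OF assms(3,4)]
  have q: "q < L" using qr r double_less[of r q] by auto
  have vq: "same_vertex S (outgoing r) (incoming q)"
    using qr same_vertex_incoming[OF r] same_vertex_double[of r q] by auto
  have ne: "outgoing r \<noteq> incoming q" using outgoing_neq_incoming r q by blast
  have restrict: "(\<Sum>d \<in> between S (outgoing r) (incoming q). ?cf d) =
      (\<Sum>d \<in> F. if d \<in> between S (outgoing r) (incoming q) then ?cf d else 0)"
    if "finite F" and F: "\<And>m' d. m' = r \<or> double r m' \<Longrightarrow> d = outgoing m' \<or> d = incoming m' \<Longrightarrow>
      d \<noteq> outgoing r \<Longrightarrow> d \<noteq> incoming q \<Longrightarrow> d \<in> F" for F
  proof -
    have sub: "between S (outgoing r) (incoming q) \<subseteq> darts S"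
      by (rule between_subset_darts[OF surface knot_in_darts[OF r]])
    have fin: "finite (between S (outgoing r) (incoming q))"
      by (rule finite_subset[OF sub]) (use surface in \<open>simp add: closed_surface_def\<close>)
    have "?cf d = 0" if "d \<in> between S (outgoing r) (incoming q) - F" for d
    proof (rule cf(3))
      have *: "same_vertex S (outgoing r) d" "d \<noteq> outgoing r" "d \<noteq> incoming q"
        using that between_iff[OF surface vq ne, of d] by auto
      show "d \<notin> set K \<union> opp S ` set K"
      proof
        assume "d \<in> set K \<union> opp S ` set K"
        from knot_darts_at_passage[OF r *(1) this] F[OF _ _ *(2,3)] that show False by blast
      qed
    qed (use that sub in blast)
    then have "(\<Sum>d \<in> between S (outgoing r) (incoming q). ?cf d) =
        (\<Sum>d \<in> between S (outgoing r) (incoming q) \<inter> F. ?cf d)"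
      by (intro sum.mono_neutral_right fin) auto
    then show ?thesis by (simp add: sum.inter_restrict[OF that(1)] Int_commute)
  qed
  show ?thesis
  proof (cases "\<exists>l. double r l")
    case False
    then have "q = r" using qr by blast
    moreover have "(\<Sum>d \<in> between S (outgoing r) (incoming q). ?cf d) = 0"
      by (subst restrict[of "{}"]) (use False \<open>q = r\<close> in auto)
    moreover have "crossing_weight S ?R r = 0" using False by (simp add: crossing_weight_def)
    moreover have "occupies ?R r = occupies ?R (pred_mod L r)"
      using assms(5) False r by (simp add: balanced_def)
    ultimately show ?thesis by simp
  next
    case True
    then obtain l where rl: "double r l" by blast
    note lr = double_sym[OF rl]
    note d4 = four_darts_distinct[OF rl]
    have l: "l < L" using double_less[OF rl] by simp
    have bal: "occupies ?R r + occupies ?R l =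
        occupies ?R (pred_mod L r) + occupies ?R (pred_mod L l)"
      using assms(5) rl unfolding balanced_def by blast
    have cw: "crossing_weight S ?R r = osign r l * passage_weight S ?R l"
      "crossing_weight S ?R l = - osign r l * passage_weight S ?R r"
      by (simp_all add: crossing_weight_def double_set[OF rl] double_set[OF lr] osign_swap[OF rl])
    show ?thesis
    proof (cases "q = r")
      case True
      have "(\<Sum>d \<in> between S (outgoing r) (incoming q). ?cf d) =
          (\<Sum>d \<in> {outgoing l, incoming l}.
             if d \<in> between S (outgoing r) (incoming q) then ?cf d else 0)"
        by (rule restrict) (use True double_unique[OF rl] in auto)
      also have "\<dots> = (if osign r l = 1 then occupies ?R l else - occupies ?R (pred_mod L l))"
        using d4 True transversal[OF rl] by (simp add: cf l osign_iff)
      finally show ?thesis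
        using bal osign_iff(2)[of r l] True by (auto simp: cw passage_weight_def)
    next
      case False
      then have ql: "q = l" using qr double_unique[OF rl] by blast
      have "(\<Sum>d \<in> between S (outgoing r) (incoming q). ?cf d) =
          (\<Sum>d \<in> {outgoing l, incoming r}.
             if d \<in> between S (outgoing r) (incoming q) then ?cf d else 0)"
        by (rule restrict) (use ql double_unique[OF rl] in auto)
      also have "\<dots> = (if osign r l = 1 then occupies ?R l - occupies ?R (pred_mod L r) else 0)"
        using d4 left_of_corner[OF rl] by (simp add: cf l r ql)
      finally show ?thesis
        using bal osign_iff(2)[of r l] ql by (auto simp: cw passage_weight_def)
    qed
  qed
qed

text \<open>
  Summing the local formula along the second loop, the boundary terms telescope. The crossing
  weights are counted once for each outgoing and once for each incoming dart of the second loop,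
  so they are multiplied by its passage weight. The sign is the one in the definition of the
  intersection number.
\<close>

lemma intersection_number_knot_loops:
  assumes rv: "knot_loop S rv" and rw: "knot_loop S rw"
  shows "4 * intersection_number S (map ((!) K) rv) (map ((!) K) rw) =
    pairing (surface_crossing_sign S) (knot_crossings S)
      (passage_weight S (set rv)) (passage_weight S (set rw))"
proof -
  let ?v = "map ((!) K) rv" and ?w = "map ((!) K) rw" and ?R = "set rv" and ?W = "set rw"
  let ?n = "length rw"
  have rvp: "distinct rv" "set rv \<subseteq> {..<L}" "balanced S (set rv)" using rv by (auto simp: knot_loop_def)
  have rwp: "rw \<noteq> []" "distinct rw" "set rw \<subseteq> {..<L}" using rw by (auto simp: knot_loop_def)
  define q where "q j = succ_mod L (rw ! pred_mod ?n j)" for j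
  have rw_less: "rw ! j < L" if "j < ?n" for j using that rwp(3) by (auto simp: subset_iff)
  have in_w: "in_dart S ?w j = opp S (?w ! pred_mod ?n j)" for j
    by (simp add: in_dart_def pred_mod_def)
  have left: "left_side S ?w j = between S (outgoing (rw ! j)) (incoming (q j))" if "j < ?n" for j
    using that pred_mod_less[OF that]
    by (simp add: left_side_def in_w incoming_eq q_def pred_succ_mod rw_less)
  have shift: "(\<Sum>j<?n. f (pred_mod ?n j)) = (\<Sum>j<?n. f j)" for f :: "nat \<Rightarrow> int"
    by (rule sum.reindex_bij_betw[OF bij_betw_pred_mod])
  have "4 * (\<Sum>j<?n. \<Sum>d\<in>left_side S ?w j. path_coeff S ?v d) =
      (\<Sum>j<?n. crossing_weight S ?R (rw ! j) + crossing_weight S ?R (q j)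
        - 2 * (occupies ?R (rw ! j) - occupies ?R (pred_mod L (q j))))"
    unfolding sum_distrib_left
  proof (rule sum.cong[OF refl])
    fix j assume "j \<in> {..<?n}"
    then have j: "j < ?n" by simp
    have "q j = rw ! j \<or> double (rw ! j) (q j)"
      using rw j by (simp add: knot_loop_def q_def Let_def)
    then show "(\<Sum>d\<in>left_side S ?w j. 4 * path_coeff S ?v d) =
        crossing_weight S ?R (rw ! j) + crossing_weight S ?R (q j)
        - 2 * (occupies ?R (rw ! j) - occupies ?R (pred_mod L (q j)))"
      unfolding left[OF j] sum_distrib_left[symmetric]
      by (rule sum_left_of_passage[OF rw_less[OF j] _ rvp])
  qed
  also have "\<dots> = (\<Sum>j<?n. crossing_weight S ?R (rw ! j)) + (\<Sum>j<?n. crossing_weight S ?R (q j))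
      - 2 * ((\<Sum>j<?n. occupies ?R (rw ! j)) - (\<Sum>j<?n. occupies ?R (pred_mod L (q j))))"
    by (simp add: sum.distrib sum_subtractf sum_distrib_left)
  also have "(\<Sum>j<?n. occupies ?R (pred_mod L (q j))) = (\<Sum>j<?n. occupies ?R (rw ! j))"
    unfolding shift[of "\<lambda>j. occupies ?R (rw ! j)", symmetric]
    by (rule sum.cong) (auto simp: q_def pred_succ_mod rw_less pred_mod_less)
  also have "(\<Sum>j<?n. crossing_weight S ?R (q j)) = (\<Sum>r\<in>?W. crossing_weight S ?R (succ_mod L r))"
    unfolding q_def shift[of "\<lambda>j. crossing_weight S ?R (succ_mod L (rw ! j))"]
    by (rule sum_nth_distinct[OF rwp(2)])
  also have "(\<Sum>r\<in>?W. crossing_weight S ?R (succ_mod L r)) =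
      (\<Sum>m<L. crossing_weight S ?R m * occupies ?W (pred_mod L m))"
  proof -
    have "(\<Sum>m<L. crossing_weight S ?R m * occupies ?W (pred_mod L m)) =
        (\<Sum>m<L. crossing_weight S ?R (succ_mod L (pred_mod L m)) * occupies ?W (pred_mod L m))"
      by (rule sum.cong) (auto simp: succ_pred_mod)
    also have "\<dots> = (\<Sum>r<L. crossing_weight S ?R (succ_mod L r) * occupies ?W r)"
      by (rule sum.reindex_bij_betw[OF bij_betw_pred_mod])
    also have "\<dots> = (\<Sum>r\<in>?W. crossing_weight S ?R (succ_mod L r) * occupies ?W r)"
      by (rule sum.mono_neutral_right) (use rwp(3) in \<open>auto simp: occupies_def\<close>)
    finally show ?thesis by (simp add: occupies_def)
  qed
  also have "(\<Sum>j<?n. crossing_weight S ?R (rw ! j)) = (\<Sum>m<L. crossing_weight S ?R m * occupies ?W m)"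
  proof -
    have "(\<Sum>j<?n. crossing_weight S ?R (rw ! j)) = (\<Sum>m\<in>?W. crossing_weight S ?R m * occupies ?W m)"
      by (simp add: sum_nth_distinct[OF rwp(2)] occupies_def)
    also have "\<dots> = (\<Sum>m<L. crossing_weight S ?R m * occupies ?W m)"
      by (rule sum.mono_neutral_left) (use rwp(3) in \<open>auto simp: occupies_def\<close>)
    finally show ?thesis .
  qed
  finally have "4 * (\<Sum>j<?n. \<Sum>d\<in>left_side S ?w j. path_coeff S ?v d) =
      (\<Sum>m<L. crossing_weight S ?R m * passage_weight S ?W m)"
    by (simp add: passage_weight_def sum.distrib algebra_simps)
  also have "\<dots> = (\<Sum>m<L. \<Sum>m' | double m m'.
      osign m m' * passage_weight S ?R m' * passage_weight S ?W m)"
    by (simp add: crossing_weight_def sum_distrib_right)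
  also have "\<dots> = (\<Sum>(m, m') \<in> {(m, m'). double m m'}.
      osign m m' * passage_weight S ?R m' * passage_weight S ?W m)"
  proof -
    have "{(m, m'). double m m'} = (SIGMA m:{..<L}. {m'. double m m'})"
      using double_less by auto
    moreover have "finite {m'. double m m'}" for m
      by (rule finite_subset[of _ "{..<L}"]) (use double_less in auto)
    ultimately show ?thesis by (simp add: sum.Sigma)
  qed
  also have "\<dots> = (\<Sum>(k, l) \<in> knot_crossings S \<union> prod.swap ` knot_crossings S.
      osign k l * passage_weight S ?R l * passage_weight S ?W k)"
  proof (rule sum.cong[OF _ refl], rule set_eqI)
    have swap: "(k, l) \<in> prod.swap ` X \<longleftrightarrow> (l, k) \<in> X" for k l and X :: "(nat \<times> nat) set"
      by force
    show "c \<in> {(k, l). double k l} \<longleftrightarrow>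
        c \<in> knot_crossings S \<union> prod.swap ` knot_crossings S" for c
      using knot_crossing_double[of "fst c" "snd c"] knot_crossing_double[of "snd c" "fst c"]
        double_knot_crossing[of "fst c" "snd c"] double_sym[of "snd c" "fst c"]
      by (cases c) (auto simp: swap)
  qed
  also have "\<dots> = (\<Sum>(k, l) \<in> knot_crossings S. osign k l * passage_weight S ?R l * passage_weight S ?W k)
      + (\<Sum>(k, l) \<in> prod.swap ` knot_crossings S. osign k l * passage_weight S ?R l * passage_weight S ?W k)"
  proof (rule sum.union_disjoint)
    have sub: "knot_crossings S \<subseteq> {..<L} \<times> {..<L}"
      using knot_crossing_double double_less by fastforce
    show "finite (knot_crossings S)" by (rule finite_subset[OF sub]) simp
    then show "finite (prod.swap ` knot_crossings S)" by simp
    show "knot_crossings S \<inter> prod.swap ` knot_crossings S = {}"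
      using knot_crossing_double by auto
  qed
  also have "(\<Sum>(k, l) \<in> prod.swap ` knot_crossings S.
        osign k l * passage_weight S ?R l * passage_weight S ?W k) =
      (\<Sum>(k, l) \<in> knot_crossings S. - osign k l * passage_weight S ?R k * passage_weight S ?W l)"
  proof -
    have "osign l k = - osign k l" if "(k, l) \<in> knot_crossings S" for k l
      using that knot_crossing_double osign_swap by blast
    then show ?thesis
      by (subst sum.reindex) (auto simp: case_prod_unfold intro!: sum.cong)
  qed
  also have "(\<Sum>(k, l) \<in> knot_crossings S. osign k l * passage_weight S ?R l * passage_weight S ?W k) +
      (\<Sum>(k, l) \<in> knot_crossings S. - osign k l * passage_weight S ?R k * passage_weight S ?W l) =
      - pairing (surface_crossing_sign S) (knot_crossings S) (passage_weight S ?R) (passage_weight S ?W)"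
    unfolding pairing_def sum_negf[symmetric] sum.distrib[symmetric]
    by (rule sum.cong) (auto simp: algebra_simps)
  finally show ?thesis by (simp add: intersection_number_def)
qed

end

section \<open>The loops of a crossing\<close>

definition alpha_passages :: "nat \<times> nat \<Rightarrow> nat list" where
  "alpha_passages c = [min (fst c) (snd c)..<max (fst c) (snd c)]"

definition beta_passages :: "('d, 'm) surface_knot_scheme \<Rightarrow> nat \<times> nat \<Rightarrow> nat list" where
  "beta_passages S c = [max (fst c) (snd c)..<length (knot S)] @ [0..<min (fst c) (snd c)]"

context
  fixes S :: "('d, 'm) surface_knot_scheme"
  assumes S: "surface_knot_diagram S"
begin

lemma alpha_loop_passages:
  assumes "fst c < length (knot S)" "snd c < length (knot S)"
  shows "alpha_loop S c = map ((!) (knot S)) (alpha_passages c)"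
  using assms by (intro nth_equalityI) (auto simp: alpha_loop_def alpha_passages_def Let_def)

lemma beta_loop_passages:
  assumes "fst c < length (knot S)" "snd c < length (knot S)"
  shows "beta_loop S c = map ((!) (knot S)) (beta_passages S c)"
proof -
  have "drop l (knot S) = map ((!) (knot S)) [l..<length (knot S)]" for l
    by (intro nth_equalityI) auto
  moreover have "take k (knot S) = map ((!) (knot S)) [0..<k]" if "k \<le> length (knot S)" for k
    using that by (intro nth_equalityI) auto
  ultimately show ?thesis using assms by (simp add: beta_loop_def beta_passages_def Let_def)
qed

text \<open>
  The basepoint is not a double point, so passage 0 belongs to no crossing.
\<close>

lemma double_positive: "double_passage S k l \<Longrightarrow> 0 < k \<and> 0 < l"
  using S double_sym[OF S] unfolding surface_knot_diagram_def by (metis neq0_conv)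

lemma occupies_interval:
  assumes "0 < k" "k < l" "l < length (knot S)" "m < length (knot S)"
  shows "occupies {k..<l} m - occupies {k..<l} (pred_mod (length (knot S)) m) =
    of_bool (m = k) - of_bool (m = l)"
  using assms by (auto simp: occupies_def pred_mod_eq)

text \<open>
  Along the knot the chain starts at one passage of a crossing and stops at the other one (or the
  reverse, if \<open>s = - 1\<close>), so the two boundary points lie at the same vertex and cancel.
\<close>

lemma balancedI:
  assumes kl: "double_passage S k l"
    and step: "\<And>m. m < length (knot S) \<Longrightarrow>
      occupies R m - occupies R (pred_mod (length (knot S)) m) = s * (of_bool (m = k) - of_bool (m = l))"
  shows "balanced S R"
  unfolding balanced_def
proof (intro conjI allI impI)
  fix m assume "m < length (knot S)" "\<forall>m'. \<not> double_passage S m m'"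
  then have "m \<noteq> k" "m \<noteq> l" using kl double_sym[OF S kl] by auto
  then show "occupies R m = occupies R (pred_mod (length (knot S)) m)"
    using step[OF \<open>m < _\<close>] by simp
next
  fix m m' assume d: "double_passage S m m'"
  have "m = k \<longleftrightarrow> m' = l" "m = l \<longleftrightarrow> m' = k"
    using d kl double_unique[OF S] double_sym[OF S] by metis+
  then have "of_bool (m = k) - of_bool (m = l) + (of_bool (m' = k) - of_bool (m' = l)) = (0::int)"
    using double_less[OF S kl] by auto
  then have "s * (of_bool (m = k) - of_bool (m = l)) + s * (of_bool (m' = k) - of_bool (m' = l)) = 0"
    unfolding distrib_left[symmetric] by simp
  then show "occupies R m + occupies R m' = occupies R (pred_mod (length (knot S)) m) +
      occupies R (pred_mod (length (knot S)) m')"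
    using step[of m] step[of m'] double_less[OF S d] by simp
qed

lemma knot_loop_alpha:
  assumes "double_passage S (fst c) (snd c)"
  shows "knot_loop S (alpha_passages c)"
proof -
  define k l where "k = min (fst c) (snd c)" and "l = max (fst c) (snd c)"
  note d = double_less[OF S assms]
  have kl: "double_passage S k l"
    using assms double_sym[OF S assms] by (auto simp: k_def l_def min_def max_def)
  have o: "0 < k" "k < l" "l < length (knot S)"
    using d double_positive[OF kl] by (auto simp: k_def l_def)
  have "balanced S {k..<l}"
    by (rule balancedI[OF kl, of _ 1]) (simp add: occupies_interval[OF o])
  moreover have "succ_mod (length (knot S)) ([k..<l] ! pred_mod (l - k) j) = [k..<l] ! j \<or>
      double_passage S ([k..<l] ! j) (succ_mod (length (knot S)) ([k..<l] ! pred_mod (l - k) j))"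
    if "j < l - k" for j
  proof (cases "j = 0")
    case True
    then have "[k..<l] ! pred_mod (l - k) j = l - 1" "[k..<l] ! j = k"
      using o by (simp_all add: pred_mod_eq)
    then show ?thesis using kl o by (simp add: succ_mod_eq)
  next
    case False
    then have "[k..<l] ! pred_mod (l - k) j = k + j - 1" "[k..<l] ! j = k + j"
      using o that by (simp_all add: pred_mod_eq)
    then show ?thesis using o that False by (simp add: succ_mod_def)
  qed
  ultimately show ?thesis
    using o unfolding knot_loop_def alpha_passages_def k_def[symmetric] l_def[symmetric] Let_def by auto
qed

lemma knot_loop_beta:
  assumes "double_passage S (fst c) (snd c)"
  shows "knot_loop S (beta_passages S c)"
proof -
  define k l n where "k = min (fst c) (snd c)" and "l = max (fst c) (snd c)" and "n = length (knot S)"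
  note d = double_less[OF S assms]
  have kl: "double_passage S k l" "double_passage S l k"
    using assms double_sym[OF S assms] by (auto simp: k_def l_def min_def max_def)
  have o: "0 < k" "k < l" "l < n"
    using d double_positive[OF kl(1)] by (auto simp: k_def l_def n_def)
  define rs where "rs = [l..<n] @ [0..<k]"
  have len: "length rs = n - l + k" by (simp add: rs_def)
  have set: "set rs = {..<n} - {k..<l}" using o by (auto simp: rs_def)
  have rest: "occupies (set rs) m = 1 - occupies {k..<l} m" if "m < n" for m
    using that by (simp add: set occupies_def)
  have "balanced S (set rs)"
  proof (rule balancedI[OF kl(1), of _ "-1"])
    fix m assume m: "m < length (knot S)"
    show "occupies (set rs) m - occupies (set rs) (pred_mod (length (knot S)) m) =
        -1 * (of_bool (m = k) - of_bool (m = l))"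
      using occupies_interval[OF o[unfolded n_def] m] rest[of m] m
        rest[of "pred_mod n m"] pred_mod_less[OF m] by (simp add: n_def)
  qed
  moreover have "succ_mod n (rs ! pred_mod (length rs) j) = rs ! j \<or>
      double_passage S (rs ! j) (succ_mod n (rs ! pred_mod (length rs) j))"
    if j: "j < length rs" for j
  proof -
    consider "j = 0" | "0 < j" "j < n - l" | "j = n - l" | "n - l < j" by linarith
    then show ?thesis
    proof cases
      case 1
      then have "rs ! pred_mod (length rs) j = k - 1" "rs ! j = l"
        using o by (simp_all add: pred_mod_eq len rs_def nth_append)
      then show ?thesis using kl o by (simp add: succ_mod_eq)
    next
      case 2
      then have "rs ! pred_mod (length rs) j = l + j - 1" "rs ! j = l + j"
        using o j by (simp_all add: pred_mod_eq len rs_def nth_append)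
      then show ?thesis using o 2 by (simp add: succ_mod_def)
    next
      case 3
      then have "rs ! pred_mod (length rs) j = n - 1" "rs ! j = 0"
        using o j by (simp_all add: pred_mod_eq len rs_def nth_append)
      then show ?thesis using o by (simp add: succ_mod_def)
    next
      case 4
      then have "rs ! pred_mod (length rs) j = j - (n - l) - 1" "rs ! j = j - (n - l)"
        using o j by (simp_all add: pred_mod_eq len rs_def nth_append)
      moreover have "Suc (j - (n - l) - 1) = j - (n - l)" "j - (n - l) < n"
        using o 4 j by (simp_all add: len)
      ultimately show ?thesis by (simp add: succ_mod_def)
    qed
  qed
  moreover have "distinct rs" "rs \<noteq> []" "set rs \<subseteq> {..<n}" using o by (auto simp: rs_def)
  ultimately show ?thesis
    unfolding knot_loop_def beta_passages_def k_def[symmetric] l_def[symmetric] n_def[symmetric]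
      rs_def[symmetric] Let_def by blast
qed

lemma passage_weight_alpha:
  assumes "double_passage S (fst c) (snd c)" "m < length (knot S)"
  shows "passage_weight S (set (alpha_passages c)) m = arc_weight c m"
  using double_less[OF S assms(1)] double_positive[OF assms(1)] assms(2)
  by (auto simp: passage_weight_def occupies_def alpha_passages_def arc_weight_def order_sign_def
      pred_mod_eq min_def max_def)

lemma passage_weight_beta:
  assumes "double_passage S (fst c) (snd c)" "m < length (knot S)"
  shows "passage_weight S (set (beta_passages S c)) m = 2 - arc_weight c m"
proof -
  have "occupies (set (beta_passages S c)) i = 1 - occupies (set (alpha_passages c)) i"
    if "i < length (knot S)" for i
    using that double_less[OF S assms(1)]
    by (auto simp: occupies_def alpha_passages_def beta_passages_def)
  then have "passage_weight S (set (beta_passages S c)) m = 2 - passage_weight S (set (alpha_passages c)) m"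
    using assms(2) pred_mod_less[OF assms(2)] by (simp add: passage_weight_def)
  then show ?thesis by (simp only: passage_weight_alpha[OF assms])
qed

end

section \<open>Velocities and diffeomorphisms of the plane\<close>

text \<open>
  The factor is the determinant of \<open>f\<close>.
\<close>

lemma cross_linear:
  assumes "linear f"
  shows "cross (f u) (f v) = cross (f 1) (f \<i>) * cross u v"
proof -
  have "f z = Re z *\<^sub>R f 1 + Im z *\<^sub>R f \<i>" for z
  proof -
    have "f z = f (Re z *\<^sub>R 1 + Im z *\<^sub>R \<i>)"
      by (rule arg_cong[of _ _ f]) (simp add: complex_eq_iff)
    then show ?thesis by (simp only: linear_add[OF assms] linear_scale[OF assms])
  qed
  from arg_cong2[OF this[of u] this[of v], of cross] show ?thesis
    by (simp add: cross_def algebra_simps)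
qed

lemma cross_swap: "cross v u = - cross u v"
  by (simp add: cross_def)

lemma cross_scaleR: "cross (r *\<^sub>R u) (s *\<^sub>R v) = r * s * cross u v"
  by (simp add: cross_def algebra_simps)

abbreviation jacobian :: "(complex \<Rightarrow> complex) \<Rightarrow> complex \<Rightarrow> complex \<Rightarrow> complex" where
  "jacobian \<phi> z \<equiv> frechet_derivative \<phi> (at z)"

lemma plane_diffeo_jacobian:
  assumes "plane_diffeo \<phi>"
  shows "(\<phi> has_derivative jacobian \<phi> z) (at z)" "linear (jacobian \<phi> z)"
    "cross (jacobian \<phi> z 1) (jacobian \<phi> z \<i>) > 0"
proof -
  obtain \<psi> :: "complex \<Rightarrow>\<^sub>L complex" where
    \<psi>: "(\<phi> has_derivative blinfun_apply \<psi>) (at z)"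
      "cross (blinfun_apply \<psi> 1) (blinfun_apply \<psi> \<i>) > 0"
    using assms unfolding plane_diffeo_def by blast
  have "jacobian \<phi> z = blinfun_apply \<psi>"
    by (rule frechet_derivative_at[OF \<psi>(1), symmetric])
  with \<psi> show "(\<phi> has_derivative jacobian \<phi> z) (at z)"
    "cross (jacobian \<phi> z 1) (jacobian \<phi> z \<i>) > 0"
    by simp_all
  then show "linear (jacobian \<phi> z)" by (intro has_derivative_linear)
qed

lemma plane_diffeo_inv:
  assumes "plane_diffeo \<phi>"
  shows "\<phi> (inv \<phi> z) = z" "inv \<phi> (\<phi> z) = z"
  using assms by (simp_all add: plane_diffeo_def bij_is_inj bij_is_surj surj_f_inv_f)

text \<open>
  The derivative is injective because its determinant is positive, so the inverse function theorem
  applies.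
\<close>

lemma plane_diffeo_inv_differentiable:
  assumes \<phi>: "plane_diffeo \<phi>"
  shows "inv \<phi> differentiable (at w)"
proof -
  note J = plane_diffeo_jacobian[OF \<phi>]
  define z where "z = inv \<phi> w"
  have w: "\<phi> z = w" by (simp add: z_def plane_diffeo_inv[OF \<phi>])
  have "u = 0" if "jacobian \<phi> z u = 0" for u
  proof -
    have "cross u v = 0" for v
      using cross_linear[OF J(2)[of z], of u v] J(3)[of z] that by (simp add: cross_def)
    from this[of 1] this[of \<i>] show "u = 0" by (simp add: cross_def complex_eq_iff)
  qed
  then have "inj (jacobian \<phi> z)"
    by (simp add: linear_injective_0[OF J(2)])
  then obtain g where g: "jacobian \<phi> z \<circ> g = id"
    using linear_injective_isomorphism[OF J(2)[of z]] by (auto simp: fun_eq_iff)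
  have "(inv \<phi> has_derivative g) (at (\<phi> z))"
  proof (rule has_derivative_inverse_strong[OF open_UNIV UNIV_I _ _ J(1) g])
    show "continuous_on UNIV \<phi>"
      by (intro continuous_at_imp_continuous_on ballI has_derivative_continuous[OF J(1)])
  qed (rule plane_diffeo_inv(2)[OF \<phi>])
  then show ?thesis unfolding w differentiable_def by blast
qed

lemma plane_diffeo_velocity:
  assumes "plane_diffeo \<phi>" "c differentiable (at (t::real))"
  shows "(\<phi> \<circ> c has_vector_derivative jacobian \<phi> (c t) (velocity c t)) (at t)"
    "velocity (\<phi> \<circ> c) t = jacobian \<phi> (c t) (velocity c t)"
proof -
  have "(c has_vector_derivative velocity c t) (at t)"
    using assms(2) by (simp add: vector_derivative_works)
  then show "(\<phi> \<circ> c has_vector_derivative jacobian \<phi> (c t) (velocity c t)) (at t)"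
    by (rule vector_derivative_diff_chain_within
        [OF _ has_derivative_at_withinI[OF plane_diffeo_jacobian(1)[OF assms(1)]]])
  then show "velocity (\<phi> \<circ> c) t = jacobian \<phi> (c t) (velocity c t)"
    by (rule vector_derivative_at)
qed

text \<open>
  At a double point both velocities are transformed by the same derivative, which preserves the
  orientation.
\<close>

lemma plane_diffeo_cross_sign:
  assumes "plane_diffeo \<phi>" "c differentiable (at s)" "c differentiable (at t)" "c s = c t"
  shows "sgn (cross (velocity (\<phi> \<circ> c) s) (velocity (\<phi> \<circ> c) t)) =
    sgn (cross (velocity c s) (velocity c t))"
  using plane_diffeo_jacobian(3)[OF assms(1), of "c t"]
    cross_linear[OF plane_diffeo_jacobian(2)[OF assms(1), of "c t"],
      of "velocity c s" "velocity c t"]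
  by (simp add: plane_diffeo_velocity assms sgn_mult)

lemma long_diagramD:
  assumes "is_long_diagram D"
  shows "curve D differentiable (at t)" "velocity (curve D) t \<noteq> 0" "isCont (curve D) t"
    "finite (real_crossings D)"
    "c \<in> real_crossings D \<Longrightarrow> fst c \<noteq> snd c \<and> curve D (fst c) = curve D (snd c)"
    "s \<noteq> u \<Longrightarrow> curve D s = curve D u \<Longrightarrow> cross (velocity (curve D) s) (velocity (curve D) u) \<noteq> 0"
proof -
  let ?\<gamma> = "curve D"
  let ?X = "{(s, t). s < t \<and> ?\<gamma> s = ?\<gamma> t}"
  note D = assms[unfolded is_long_diagram_def Let_def]
  obtain V where V: "\<And>t. (?\<gamma> has_vector_derivative V t) (at t)"
    using D by (auto simp: C1_differentiable_on_def)
  from V[of t] show "?\<gamma> differentiable (at t)" by (rule differentiableI_vector)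
  from V[of t] show "isCont ?\<gamma> t" by (rule has_vector_derivative_continuous)
  show "velocity ?\<gamma> t \<noteq> 0" using D by blast
  show crossing: "fst c \<noteq> snd c \<and> ?\<gamma> (fst c) = ?\<gamma> (snd c)" if "c \<in> real_crossings D" for c
    using D that by (auto simp: case_prod_unfold)
  have fin: "finite ?X" using D by blast
  have "real_crossings D \<subseteq> ?X \<union> prod.swap ` ?X"
  proof
    fix c assume "c \<in> real_crossings D"
    from crossing[OF this] show "c \<in> ?X \<union> prod.swap ` ?X"
      by (cases c) (auto simp: image_iff not_less_iff_gr_or_eq)
  qed
  with fin show "finite (real_crossings D)" by (meson finite_UnI finite_imageI finite_subset)
  show "cross (velocity ?\<gamma> s) (velocity ?\<gamma> u) \<noteq> 0" if "s \<noteq> u" "?\<gamma> s = ?\<gamma> u"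
    using D that by blast
qed

lemma velocity_eq_off_closed:
  assumes "closed A" "\<And>t. t \<notin> A \<Longrightarrow> \<gamma>' t = \<gamma> t" "t \<notin> A"
  shows "velocity \<gamma>' t = velocity \<gamma> t"
proof -
  have "(\<gamma>' has_vector_derivative v) (at t) \<longleftrightarrow> (\<gamma> has_vector_derivative v) (at t)" for v
    using has_vector_derivative_transform_within_open[of _ v t "- A"] assms
    by (metis ComplD ComplI open_Compl)
  then show ?thesis by (simp add: vector_derivative_def)
qed

lemma crossing_sign_eq_off_closed:
  assumes "closed A" "\<And>t. t \<notin> A \<Longrightarrow> curve D' t = curve D t" "fst c \<notin> A" "snd c \<notin> A"
  shows "crossing_sign D' c = crossing_sign D c"
  using velocity_eq_off_closed[OF assms(1), of "curve D'" "curve D"] assms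
  by (simp add: crossing_sign_def)

lemma closed_strand: "strand A \<Longrightarrow> closed A"
  by (auto simp: strand_def)

text \<open>
  A strand is closed, so its ends are limits of parameters at which the curve is not changed.
\<close>

lemma changed_ends_agree:
  fixes \<gamma> \<gamma>' :: "real \<Rightarrow> complex"
  assumes "isCont \<gamma> a" "isCont \<gamma>' a" "\<And>t. t < a \<Longrightarrow> \<gamma>' t = \<gamma> t"
  shows "\<gamma>' a = \<gamma> a"
proof -
  have "(\<gamma> \<longlongrightarrow> \<gamma> a) (at_left a)" "(\<gamma>' \<longlongrightarrow> \<gamma>' a) (at_left a)"
    using assms(1,2) by (auto simp: isCont_def filterlim_at_split)
  moreover have "eventually (\<lambda>t. \<gamma>' t = \<gamma> t) (at_left a)"
    using assms(3) by (auto simp: eventually_at_filter)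
  ultimately show ?thesis
    using tendsto_unique[OF trivial_limit_at_left_real] by (metis tendsto_cong)
qed

section \<open>Strands that run along a graph\<close>

text \<open>
  In the square, the curve \<open>c\<close> runs on the parameters \<open>A\<close> monotonically through the whole graph of
  \<open>F\<close>, to the right if \<open>\<sigma> = 1\<close> and to the left if \<open>\<sigma> = - 1\<close>.
\<close>

definition graph_strand :: "(real \<Rightarrow> complex) \<Rightarrow> real set \<Rightarrow> (real \<Rightarrow> real) \<Rightarrow> real \<Rightarrow> bool" where
  "graph_strand c A F \<sigma> \<longleftrightarrow> \<sigma> \<in> {1, -1} \<and> (\<forall>t\<in>A. Im (c t) = F (Re (c t))) \<and>
     (\<lambda>t. Re (c t)) ` A = {-1..1} \<and>
     (\<forall>s\<in>A. \<forall>t\<in>A. s < t \<longrightarrow> \<sigma> * Re (c s) < \<sigma> * Re (c t)) \<and>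
     (\<forall>t\<in>A. \<exists>m>0. velocity c t = Complex (\<sigma> * m) (\<sigma> * m * deriv F (Re (c t))))"

lemma mem_square: "z \<in> square \<longleftrightarrow> \<bar>Re z\<bar> \<le> 1 \<and> \<bar>Im z\<bar> \<le> 1"
  by (auto simp: square_def in_cbox_complex_iff)

text \<open>
  The chain rule along the graph gives \<open>y' = F'(x) x'\<close>. As the velocity is nonzero, \<open>x'\<close> has no
  zero, and \<open>x\<close> is injective by Rolle's theorem. At the ends the curve leaves the square, and
  inside the square the graph stays away from the upper and the lower side, so \<open>x\<close> is \<open>1\<close> or \<open>- 1\<close>
  there. Injectivity makes the two ends different, and the intermediate value theorem yields
  monotonicity and surjectivity.
\<close>

lemma graph_strandI:
  assumes ab: "a < b" and diff: "\<And>t. c differentiable (at t)" and "\<And>t. velocity c t \<noteq> 0"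
    and sq: "\<And>t. t \<in> {a..b} \<Longrightarrow> c t \<in> square"
    and graph: "\<And>t. t \<in> {a..b} \<Longrightarrow> Im (c t) = F (Re (c t))"
    and F: "\<And>x. x \<in> {-1..1} \<Longrightarrow> F differentiable (at x)" "\<And>x. \<bar>x\<bar> < 1 \<Longrightarrow> \<bar>F x\<bar> < 1"
    and ends: "\<And>t. t \<in> {a, b} \<Longrightarrow> t \<in> closure {t. c t \<notin> square}"
  obtains \<sigma> where "graph_strand c {a..b} F \<sigma>" "Re (c a) = - \<sigma>"
proof -
  define x where "x t = Re (c t)" for t
  have c': "(c has_vector_derivative velocity c t) (at t)" for t
    using diff by (simp add: vector_derivative_works)
  have x': "(x has_real_derivative Re (velocity c t)) (at t)" for t
    unfolding x_def has_real_derivative_iff_has_vector_derivative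
    using bounded_linear.has_vector_derivative[OF bounded_linear_Re c'] .
  have y': "((\<lambda>t. Im (c t)) has_vector_derivative Im (velocity c t)) (at t)" for t
    using bounded_linear.has_vector_derivative[OF bounded_linear_Im c'] .
  have x_range: "x t \<in> {-1..1}" if "t \<in> {a..b}" for t
    using sq[OF that] by (simp add: mem_square x_def abs_le_iff)
  (* one-sided derivatives, because the curve need not follow the graph beyond the ends *)
  have slope: "Im (velocity c t) = deriv F (x t) * Re (velocity c t)" if t: "t \<in> {a..b}" for t
  proof -
    have "(F has_real_derivative deriv F (x t)) (at (x t))"
      using F(1)[OF x_range[OF t]] by (simp add: DERIV_deriv_iff_real_differentiable)
    then have "((\<lambda>t. F (x t)) has_real_derivative deriv F (x t) * Re (velocity c t)) (at t)"
      by (rule DERIV_chain2[OF _ x'])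
    then have "((\<lambda>t. F (x t)) has_vector_derivative deriv F (x t) * Re (velocity c t))
        (at t within {a..b})"
      using has_real_derivative_iff_has_vector_derivative has_vector_derivative_at_within by blast
    then have "((\<lambda>t. Im (c t)) has_vector_derivative deriv F (x t) * Re (velocity c t))
        (at t within {a..b})"
      by (rule has_vector_derivative_transform[rotated 2]) (use t graph in \<open>auto simp: x_def\<close>)
    then show ?thesis
      using vector_derivative_unique_within_closed_interval[OF ab, of t] t
        has_vector_derivative_at_within[OF y'] by (metis box_real(2))
  qed
  have nonzero: "Re (velocity c t) \<noteq> 0" if t: "t \<in> {a..b}" for t
    using slope[OF t] assms(3)[of t] by (auto simp: complex_eq_iff)
  have cont: "continuous_on X x" for X
    using x' by (meson DERIV_isCont continuous_at_imp_continuous_on)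
  have inj: "x s \<noteq> x t" if st: "s \<in> {a..b}" "t \<in> {a..b}" "s < t" for s t
  proof
    assume "x s = x t"
    then obtain z where "s < z" "z < t" "(x has_real_derivative 0) (at z)"
      using Rolle[OF st(3), of x] cont x' by (meson real_differentiable_def)
    then show False using nonzero[of z] st DERIV_unique[OF x'[of z]] by auto
  qed
  have end_x: "\<bar>x t\<bar> = 1" if t: "t \<in> {a, b}" for t
  proof (rule ccontr)
    assume "\<bar>x t\<bar> \<noteq> 1"
    then have less: "\<bar>x t\<bar> < 1" using x_range[of t] t ab by auto
    define U where "U = c -` box (Complex (-1) (-1)) (Complex 1 1)"
    have "t \<in> U"
      using less F(2)[OF less] graph[of t] t ab
      by (auto simp: U_def in_box_complex_iff x_def abs_less_iff)
    moreover have "open U"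
      unfolding U_def using diff
      by (intro open_vimage open_box continuous_at_imp_continuous_on)
        (auto intro: differentiable_imp_continuous_within)
    ultimately obtain s where "s \<in> U" "c s \<notin> square"
      using ends[OF t] by (auto simp: closure_iff_nhds_not_empty)
    then show False
      by (auto simp: U_def in_box_complex_iff mem_square)
  qed
  define \<sigma> where "\<sigma> = - x a"
  have \<sigma>: "\<sigma> \<in> {1, -1}" using end_x[of a] by (auto simp: \<sigma>_def abs_if split: if_splits)
  have xb: "x b = \<sigma>"
    using end_x[of a] end_x[of b] inj[of a b] ab by (auto simp: \<sigma>_def abs_if split: if_splits)
  define z where "z t = \<sigma> * x t" for t
  have z_cont: "continuous_on X z" for X
    unfolding z_def by (intro continuous_intros cont)
  have z_ends: "z a = -1" "z b = 1" using \<sigma> xb by (auto simp: z_def \<sigma>_def)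
  have z_inj: "z s \<noteq> z t" if "s \<in> {a..b}" "t \<in> {a..b}" "s < t" for s t
    using inj[OF that] \<sigma> by (auto simp: z_def)
  have z_range: "z t \<in> {-1..1}" if "t \<in> {a..b}" for t
    using x_range[OF that] \<sigma> by (auto simp: z_def)
  have mono: "z s < z t" if st: "s \<in> {a..b}" "t \<in> {a..b}" "s < t" for s t
  proof (rule ccontr)
    assume "\<not> z s < z t"
    then obtain u where "a \<le> u" "u \<le> s" "z u = z t"
      using IVT'[of z a "z t" s] z_range[OF st(2)] z_ends(1) st(1) z_cont by auto
    then show False using z_inj[of u t] st by auto
  qed
  have z': "(z has_real_derivative \<sigma> * Re (velocity c t)) (at t within {a..b})" for t
    unfolding z_def by (rule DERIV_cmult[OF has_field_derivative_at_within[OF x']])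
  have pos: "\<sigma> * Re (velocity c t) > 0" if t: "t \<in> {a..b}" for t
  proof (rule ccontr)
    assume "\<not> \<sigma> * Re (velocity c t) > 0"
    then have neg: "\<sigma> * Re (velocity c t) < 0" using nonzero[OF t] \<sigma> by auto
    show False
    proof (cases "t < b")
      case True
      obtain d where d: "d > 0" "\<And>h. h > 0 \<Longrightarrow> t + h \<in> {a..b} \<Longrightarrow> h < d \<Longrightarrow> z (t + h) < z t"
        using has_real_derivative_neg_dec_right[OF z' neg] by blast
      define h where "h = min (d / 2) (b - t)"
      have "h > 0" "h < d" "t + h \<in> {a..b}" using d(1) True t by (auto simp: h_def min_def)
      then show False using d(2)[of h] mono[of t "t + h"] t by auto
    next
      case False
      then have tb: "t = b" using t by simp
      obtain d where d: "d > 0" "\<And>h. h > 0 \<Longrightarrow> t - h \<in> {a..b} \<Longrightarrow> h < d \<Longrightarrow> z t < z (t - h)"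
        using has_real_derivative_neg_dec_left[OF z' neg] by blast
      define h where "h = min (d / 2) (b - a)"
      have "h > 0" "h < d" "t - h \<in> {a..b}" using d(1) ab tb by (auto simp: h_def min_def)
      then show False using d(2)[of h] mono[of "t - h" t] t by auto
    qed
  qed
  have "z ` {a..b} = {-1..1}"
  proof
    show "z ` {a..b} \<subseteq> {-1..1}" using z_range by blast
    show "{-1..1} \<subseteq> z ` {a..b}"
    proof
      fix y :: real assume "y \<in> {-1..1}"
      then obtain t where "a \<le> t" "t \<le> b" "z t = y"
        using IVT'[of z a y b] z_ends ab z_cont by auto
      then show "y \<in> z ` {a..b}" by auto
    qed
  qed
  moreover have \<sigma>2: "\<sigma> * (\<sigma> * y) = y" for y using \<sigma> by auto
  have "(\<lambda>t. Re (c t)) ` {a..b} = (\<lambda>y. \<sigma> * y) ` z ` {a..b}"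
    by (simp only: image_image z_def x_def \<sigma>2)
  moreover have "(\<lambda>y. \<sigma> * y) ` {-1..1} = {-1..1}"
    using \<sigma> by (auto simp: image_uminus_atLeastAtMost)
  ultimately have image: "(\<lambda>t. Re (c t)) ` {a..b} = {-1..1}"
    by simp
  have velocity: "\<exists>m>0. velocity c t = Complex (\<sigma> * m) (\<sigma> * m * deriv F (Re (c t)))"
    if "t \<in> {a..b}" for t
  proof (intro exI[of _ "\<sigma> * Re (velocity c t)"] conjI pos[OF that])
    show "velocity c t = Complex (\<sigma> * (\<sigma> * Re (velocity c t)))
        (\<sigma> * (\<sigma> * Re (velocity c t)) * deriv F (Re (c t)))"
      using slope[OF that] by (simp only: \<sigma>2) (simp add: complex_eq_iff x_def mult.commute)
  qed
  have mono': "\<sigma> * Re (c s) < \<sigma> * Re (c t)" if "s \<in> {a..b}" "t \<in> {a..b}" "s < t" for s t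
    using mono[OF that] by (simp only: z_def x_def)
  have "graph_strand c {a..b} F \<sigma>"
    unfolding graph_strand_def
    by (intro conjI ballI impI; (fact \<sigma> graph image mono' velocity | rule graph mono' velocity; assumption))
  moreover have "Re (c a) = - \<sigma>" by (simp add: \<sigma>_def x_def)
  ultimately show ?thesis by (rule that)
qed

lemma graph_strand_mono:
  assumes "graph_strand c A F \<sigma>" "s \<in> A" "t \<in> A" "s < t"
  shows "\<sigma> * Re (c s) < \<sigma> * Re (c t)"
  using assms by (simp add: graph_strand_def)

lemma graph_strand_inj:
  assumes "graph_strand c A F \<sigma>" "s \<in> A" "t \<in> A" "Re (c s) = Re (c t)"
  shows "s = t"
  using graph_strand_mono[OF assms(1,2,3)] graph_strand_mono[OF assms(1,3,2)] assms(4)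
  by (cases s t rule: linorder_cases) auto

lemma graph_strand_point:
  assumes "graph_strand c A F \<sigma>" "x \<in> {-1..1}"
  obtains t where "t \<in> A" "c t = Complex x (F x)"
proof -
  have "(\<lambda>t. Re (c t)) ` A = {-1..1}" and graph: "\<forall>t\<in>A. Im (c t) = F (Re (c t))"
    using assms(1) unfolding graph_strand_def by simp_all
  with assms(2) obtain t where "t \<in> A" "x = Re (c t)" by (metis imageE)
  with graph show ?thesis by (intro that[of t]) (simp_all add: complex_eq_iff)
qed

lemma graph_strand_value:
  assumes "graph_strand c A F \<sigma>" "t \<in> A"
  shows "Re (c t) \<in> {-1..1}" "Im (c t) = F (Re (c t))"
proof -
  have "(\<lambda>t. Re (c t)) ` A = {-1..1}" and graph: "\<forall>t\<in>A. Im (c t) = F (Re (c t))"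
    using assms(1) unfolding graph_strand_def by simp_all
  with assms(2) show "Re (c t) \<in> {-1..1}" "Im (c t) = F (Re (c t))"
    by (metis imageI, blast)
qed

lemma graph_strand_velocity:
  assumes "graph_strand c A F \<sigma>" "t \<in> A"
  shows "\<exists>m>0. velocity c t = Complex (\<sigma> * m) (\<sigma> * m * deriv F (Re (c t)))"
proof -
  have "\<forall>t\<in>A. \<exists>m>0. velocity c t = Complex (\<sigma> * m) (\<sigma> * m * deriv F (Re (c t)))"
    using assms(1) unfolding graph_strand_def by (elim conjE)
  with assms(2) show ?thesis by (rule bspec[rotated])
qed

text \<open>
  The velocities are positive multiples of \<open>\<sigma> (1, F')\<close> and \<open>\<tau> (1, G')\<close>.
\<close>

lemma graph_strands_cross:
  assumes "graph_strand c A F \<sigma>" "graph_strand c B G \<tau>" "s \<in> A" "t \<in> B" "c s = c t"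
  shows "sgn (cross (velocity c s) (velocity c t)) =
    \<sigma> * \<tau> * sgn (deriv G (Re (c t)) - deriv F (Re (c t)))"
proof -
  obtain m where m: "m > 0" "velocity c s = Complex (\<sigma> * m) (\<sigma> * m * deriv F (Re (c s)))"
    using graph_strand_velocity[OF assms(1,3)] by blast
  obtain n where n: "n > 0" "velocity c t = Complex (\<tau> * n) (\<tau> * n * deriv G (Re (c t)))"
    using graph_strand_velocity[OF assms(2,4)] by blast
  have "cross (velocity c s) (velocity c t) =
      (\<sigma> * \<tau>) * (m * n) * (deriv G (Re (c t)) - deriv F (Re (c t)))"
    by (simp add: cross_def m n assms(5) algebra_simps)
  moreover have "\<sigma> \<in> {1, -1}" "\<tau> \<in> {1, -1}"
    using assms(1,2) by (simp_all add: graph_strand_def)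
  then have "sgn \<sigma> = \<sigma>" "sgn \<tau> = \<tau>" by auto
  ultimately show ?thesis using m(1) n(1) by (simp add: sgn_mult)
qed

text \<open>
  Both strands cover the whole interval, so every common point of the graphs is a double point of
  the curve, passed once by each strand.
\<close>

lemma over_crossings_graphs:
  assumes A: "graph_strand c A F \<sigma>" and B: "graph_strand c B G \<tau>"
    and "x \<in> {-1..1}" "F x = G x"
  obtains s t where "s \<in> A" "t \<in> B" "c s = Complex x (F x)" "c t = Complex x (F x)"
    "\<forall>s'\<in>A. \<forall>t'\<in>B. c s' = c t' \<longrightarrow> Re (c t') = x \<longrightarrow> s' = s \<and> t' = t"
proof -
  obtain s where s: "s \<in> A" "c s = Complex x (F x)" using graph_strand_point[OF A assms(3)] .
  obtain t where t: "t \<in> B" "c t = Complex x (G x)" using graph_strand_point[OF B assms(3)] .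
  show ?thesis
  proof (rule that[OF s(1) t(1) s(2)])
    show "c t = Complex x (F x)" by (simp only: t(2) assms(4))
    show "\<forall>s'\<in>A. \<forall>t'\<in>B. c s' = c t' \<longrightarrow> Re (c t') = x \<longrightarrow> s' = s \<and> t' = t"
    proof (intro ballI impI)
      fix s' t' assume *: "s' \<in> A" "t' \<in> B" "c s' = c t'" "Re (c t') = x"
      have "s' = s" by (rule graph_strand_inj[OF A *(1) s(1)]) (simp only: s(2) * complex.sel)
      moreover have "t' = t" by (rule graph_strand_inj[OF B *(2) t(1)]) (simp only: t(2) * complex.sel)
      ultimately show "s' = s \<and> t' = t" ..
    qed
  qed
qed

text \<open>
  The diffeomorphism turns the disk into the square. The other strands in the disk are parametrised
  by a closed set \<open>R\<close> that does not contain the ends of \<open>A\<close>, so parameters just outside \<open>A\<close> are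
  mapped outside the square.
\<close>

lemma strand_is_graph:
  assumes D: "is_long_diagram D" and \<phi>: "plane_diffeo \<phi>" and A: "A = {a..b}" "a < b"
    and R: "closed R" "A \<inter> R = {}"
    and disk: "\<And>t. curve D t \<in> \<phi> ` square \<longleftrightarrow> t \<in> A \<union> R"
    and graph: "curve D ` A \<subseteq> \<phi> ` function_graph F"
    and F: "\<And>x. x \<in> {-1..1} \<Longrightarrow> F differentiable (at x)" "\<And>x. \<bar>x\<bar> < 1 \<Longrightarrow> \<bar>F x\<bar> < 1"
  obtains \<sigma> where "graph_strand (inv \<phi> \<circ> curve D) A F \<sigma>" "Re (inv \<phi> (curve D a)) = - \<sigma>"
proof -
  define c where "c = inv \<phi> \<circ> curve D"
  have bij: "bij \<phi>" using \<phi> by (simp add: plane_diffeo_def)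
  have \<gamma>: "curve D = \<phi> \<circ> c"
    by (simp add: c_def fun_eq_iff plane_diffeo_inv[OF \<phi>])
  have mem: "curve D t \<in> \<phi> ` X \<longleftrightarrow> c t \<in> X" for t X
    using bij by (simp add: \<gamma> inj_image_mem_iff bij_is_inj)
  have diff: "c differentiable (at t)" for t
    unfolding c_def using long_diagramD(1)[OF D] plane_diffeo_inv_differentiable[OF \<phi>]
    by (intro differentiable_chain_at)
  have nonzero: "velocity c t \<noteq> 0" for t
    using long_diagramD(2)[OF D, of t] plane_diffeo_velocity(2)[OF \<phi> diff[of t]]
      linear_0[OF plane_diffeo_jacobian(2)[OF \<phi>]]
    unfolding \<gamma> by auto
  have sq: "c t \<in> square" if "t \<in> {a..b}" for t
    using that disk[of t] A by (simp add: mem)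
  have on_graph: "Im (c t) = F (Re (c t))" if "t \<in> {a..b}" for t
  proof -
    have "c t \<in> function_graph F" using graph that A mem by blast
    then show ?thesis by (auto simp: function_graph_def)
  qed
  have ends: "t \<in> closure {t. c t \<notin> square}" if t: "t \<in> {a, b}" for t
    unfolding closure_approachable
  proof (intro allI impI)
    fix e :: real assume "e > 0"
    have "t \<in> - R" "open (- R)" using t A R by auto
    then obtain d where d: "d > 0" "ball t d \<subseteq> - R" by (meson open_contains_ball)
    define h where "h = min d e / 2"
    have h: "0 < h" "h < d" "h < e" using d(1) \<open>e > 0\<close> by (auto simp: h_def)
    define s where "s = (if t = a then a - h else b + h)"
    have "dist s t < d" "dist s t < e" using h t by (auto simp: s_def dist_real_def)
    moreover have "s \<notin> A" using h t A by (auto simp: s_def)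
    ultimately have "s \<notin> A \<union> R" using d(2) by (auto simp: dist_commute subset_iff)
    then have "c s \<notin> square" using disk mem by blast
    with \<open>dist s t < e\<close> show "\<exists>s\<in>{t. c t \<notin> square}. dist s t < e" by blast
  qed
  obtain \<sigma> where "graph_strand c {a..b} F \<sigma>" "Re (c a) = - \<sigma>"
    using graph_strandI[OF A(2) diff nonzero sq on_graph F ends] by metis
  then show ?thesis using that A(1) by (simp add: c_def)
qed

section \<open>Invariance under the generalized Reidemeister moves\<close>

abbreviation diagram_sum :: "(int \<Rightarrow> int \<Rightarrow> int \<Rightarrow> laurent) \<Rightarrow> nat \<Rightarrow> nat \<Rightarrow> long_diagram \<Rightarrow> laurent" where
  "diagram_sum \<Phi> a b D \<equiv> state_sum \<Phi> a b (crossing_sign D) (real_crossings D)"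

lemma crossing_sign_cong_sgn:
  assumes "sgn (cross (velocity (curve D) (fst c)) (velocity (curve D) (snd c))) =
    sgn (cross (velocity (curve D') (fst c')) (velocity (curve D') (snd c')))"
  shows "crossing_sign D c = crossing_sign D' c'"
  using assms by (simp add: crossing_sign_def sgn_if split: if_splits)

lemma velocity_reparametrized:
  fixes \<rho> :: "real \<Rightarrow> real"
  assumes "\<rho> differentiable (at t)" "\<gamma> differentiable (at (\<rho> t))"
  shows "(\<gamma> \<circ> \<rho> has_vector_derivative deriv \<rho> t *\<^sub>R velocity \<gamma> (\<rho> t)) (at t)"
proof (rule vector_diff_chain_at)
  show "(\<rho> has_vector_derivative deriv \<rho> t) (at t)"
    using assms(1) by (simp add: DERIV_deriv_iff_real_differentiable
        has_real_derivative_iff_has_vector_derivative[symmetric])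
  show "(\<gamma> has_vector_derivative velocity \<gamma> (\<rho> t)) (at (\<rho> t))"
    using assms(2) by (simp add: vector_derivative_works)
qed

text \<open>
  The parameters are relabelled monotonically. A reparametrisation scales velocities by positive
  factors, and the diffeomorphism preserves their orientation.
\<close>

lemma diagram_sum_planar_isotopy:
  assumes D: "is_long_diagram D" and "planar_isotopy D D'"
  shows "diagram_sum \<Phi> a b D = diagram_sum \<Phi> a b D'"
proof -
  obtain h \<rho> where h: "plane_diffeo h" and C1: "\<rho> C1_differentiable_on UNIV"
    and pos: "\<And>t. deriv \<rho> t > 0" and curve: "curve D' = h \<circ> (curve D \<circ> \<rho>)"
    and C: "real_crossings D = map_prod \<rho> \<rho> ` real_crossings D'"
    using assms(2) unfolding planar_isotopy_def comp_assoc by blast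
  have diff: "\<rho> differentiable (at t)" for t
    using C1 by (auto simp: C1_differentiable_on_def intro: differentiableI_vector)
  have der: "(\<rho> has_real_derivative deriv \<rho> t) (at t)" for t
    using diff by (simp add: DERIV_deriv_iff_real_differentiable)
  have mono: "strict_mono \<rho>"
  proof (rule strict_monoI)
    fix s t :: real assume "s < t"
    then show "\<rho> s < \<rho> t"
      by (rule DERIV_pos_imp_increasing) (use der pos in blast)
  qed
  note rep = velocity_reparametrized[OF diff long_diagramD(1)[OF D]]
  have rep_diff: "curve D \<circ> \<rho> differentiable (at t)" for t
    by (rule differentiableI_vector[OF rep])
  have sign: "crossing_sign D (map_prod \<rho> \<rho> c) = crossing_sign D' c"
    if c: "c \<in> real_crossings D'" for c
  proof (rule crossing_sign_cong_sgn)
    have "map_prod \<rho> \<rho> c \<in> real_crossings D" using c C by blast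
    then have "(curve D \<circ> \<rho>) (fst c) = (curve D \<circ> \<rho>) (snd c)"
      using long_diagramD(5)[OF D, of "map_prod \<rho> \<rho> c"] by simp
    then have "sgn (cross (velocity (curve D') (fst c)) (velocity (curve D') (snd c))) =
        sgn (cross (velocity (curve D \<circ> \<rho>) (fst c)) (velocity (curve D \<circ> \<rho>) (snd c)))"
      unfolding curve by (intro plane_diffeo_cross_sign h rep_diff)
    then show "sgn (cross (velocity (curve D) (fst (map_prod \<rho> \<rho> c)))
          (velocity (curve D) (snd (map_prod \<rho> \<rho> c)))) =
        sgn (cross (velocity (curve D') (fst c)) (velocity (curve D') (snd c)))"
      using pos by (simp add: vector_derivative_at[OF rep] cross_scaleR sgn_mult)
  qed
  show ?thesis
    unfolding C by (rule state_sum_monotone_image[OF mono]) (rule sign)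
qed

lemma changesD:
  assumes "changes \<phi> T S D D'"
  shows "plane_diffeo \<phi>" "curve D t \<in> \<phi> ` square \<longleftrightarrow> t \<in> T" "curve D' t \<in> \<phi> ` square \<longleftrightarrow> t \<in> T"
    "t \<notin> S \<Longrightarrow> curve D' t = curve D t"
  using assms by (simp_all add: changes_def)

text \<open>
  Both passages of a crossing are at the same point of the plane, so they are in the disk together.
\<close>

lemma crossing_in_disk:
  assumes "is_long_diagram D" "\<And>t. curve D t \<in> X \<longleftrightarrow> t \<in> T" "c \<in> real_crossings D"
  shows "fst c \<in> T \<longleftrightarrow> snd c \<in> T"
  using assms(2)[of "fst c"] assms(2)[of "snd c"] long_diagramD(5)[OF assms(1,3)] by simp

text \<open>
  As the old arc is injective, no old crossing has a passage in the disk. Hence no passage lies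
  between the two passages of the kink.
\<close>

lemma diagram_sum_move_I:
  assumes D: "is_long_diagram D" and "move_I D D'" and "kink_free \<Phi>"
  shows "diagram_sum \<Phi> a b D' = diagram_sum \<Phi> a b D"
proof -
  obtain \<phi> A p q where A: "strand A" and ch: "changes \<phi> A A D D'" and inj: "inj_on (curve D) A"
    and pq: "{(s, t). s \<in> A \<and> t \<in> A \<and> s < t \<and> curve D' s = curve D' t} = {(p, q)}"
    and C': "real_crossings D' \<in> {real_crossings D,
          insert (p, q) (real_crossings D), insert (q, p) (real_crossings D)}"
    using assms(2) unfolding move_I_def by blast
  have pA: "p \<in> A" "q \<in> A" using pq by auto
  have outside: "fst d \<notin> A \<and> snd d \<notin> A" if d: "d \<in> real_crossings D" for d
  proof -
    have "fst d \<in> A \<longleftrightarrow> snd d \<in> A"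
      by (rule crossing_in_disk[OF D changesD(2)[OF ch] d])
    then show ?thesis using inj_onD[OF inj] long_diagramD(5)[OF D d] by blast
  qed
  have sign: "crossing_sign D' d = crossing_sign D d" if "d \<in> real_crossings D" for d
    by (rule crossing_sign_eq_off_closed[OF closed_strand[OF A]])
      (use changesD(4)[OF ch] outside[OF that] in auto)
  have kink: "state_sum \<Phi> a b (crossing_sign D') (insert c (real_crossings D)) = diagram_sum \<Phi> a b D"
    if "c \<in> {(p, q), (q, p)}" for c
  proof (rule state_sum_insert_kink[OF long_diagramD(4)[OF D] _ assms(3) _ sign])
    show "c \<notin> real_crossings D" using outside[of c] pA that by auto
    show "order_sign z (fst c) = order_sign z (snd c)"
      if "d \<in> real_crossings D" "z \<in> {fst d, snd d}" for d z
      using that outside[OF that(1)] \<open>c \<in> _\<close> pA by (intro order_sign_strand[OF A]) auto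
  qed
  from C' consider "real_crossings D' = real_crossings D"
    | c where "c \<in> {(p, q), (q, p)}" "real_crossings D' = insert c (real_crossings D)"
    by blast
  then show ?thesis
  proof cases
    case 1
    then show ?thesis using state_sum_cong[OF sign] by simp
  next
    case 2
    then show ?thesis using kink by simp
  qed
qed

text \<open>
  The order of passages on a strand is the order of their positions on the graph, up to the
  direction.
\<close>

lemma graph_strand_order:
  assumes "graph_strand c A F \<sigma>" "s \<in> A" "t \<in> A"
  shows "real_of_int (order_sign s t) = \<sigma> * sgn (Re (c t) - Re (c s))"
proof -
  have \<sigma>: "\<sigma> = 1 \<or> \<sigma> = -1" using assms(1) by (simp add: graph_strand_def)
  consider "s < t" | "s = t" | "t < s" by linarith
  then show ?thesis
  proof cases
    case 1
    then show ?thesis using graph_strand_mono[OF assms(1,2,3)] \<sigma> by (auto simp: order_sign_def)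
  next
    case 3
    then show ?thesis using graph_strand_mono[OF assms(1,3,2)] \<sigma> by (auto simp: order_sign_def)
  qed simp
qed

lemma chart_eq_iff:
  assumes "plane_diffeo \<phi>"
  shows "inv \<phi> z = inv \<phi> w \<longleftrightarrow> z = w"
  using plane_diffeo_inv(1)[OF assms] by metis

text \<open>
  The slopes differ because a double point of a diagram is transversal.
\<close>

lemma flat_sign_graphs:
  assumes D: "is_long_diagram D" and \<phi>: "plane_diffeo \<phi>"
    and A: "graph_strand (inv \<phi> \<circ> curve D) A F \<sigma>" and B: "graph_strand (inv \<phi> \<circ> curve D) B G \<tau>"
    and "s \<in> A" "t \<in> B" "s \<noteq> t" "inv \<phi> (curve D s) = inv \<phi> (curve D t)"
  shows "real_of_int (flat_sign (crossing_sign D) up s t) =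
      \<sigma> * \<tau> * sgn (deriv G (Re (inv \<phi> (curve D t))) - deriv F (Re (inv \<phi> (curve D t))))"
    and "deriv F (Re (inv \<phi> (curve D t))) \<noteq> deriv G (Re (inv \<phi> (curve D t)))"
proof -
  let ?c = "inv \<phi> \<circ> curve D" and ?n = "cross (velocity (curve D) s) (velocity (curve D) t)"
  have \<gamma>: "curve D = \<phi> \<circ> ?c" by (simp add: fun_eq_iff plane_diffeo_inv[OF \<phi>])
  have diff: "?c differentiable (at t)" for t
    using long_diagramD(1)[OF D] plane_diffeo_inv_differentiable[OF \<phi>]
    by (intro differentiable_chain_at)
  have "?n \<noteq> 0"
    using long_diagramD(6)[OF D assms(7)] assms(8) by (simp add: chart_eq_iff[OF \<phi>])
  moreover have "sgn ?n = sgn (cross (velocity ?c s) (velocity ?c t))"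
    using plane_diffeo_cross_sign[OF \<phi> diff diff, of s t] assms(8) by (simp flip: \<gamma>)
  moreover have "\<dots> = \<sigma> * \<tau> * sgn (deriv G (Re (?c t)) - deriv F (Re (?c t)))"
    by (rule graph_strands_cross[OF A B assms(5,6)]) (simp add: assms(8))
  ultimately have sgn: "sgn ?n = \<sigma> * \<tau> * sgn (deriv G (Re (?c t)) - deriv F (Re (?c t)))" "?n \<noteq> 0"
    by simp_all
  have "real_of_int (flat_sign (crossing_sign D) up s t) = sgn ?n"
    using sgn(2) cross_swap[of "velocity (curve D) t" "velocity (curve D) s"]
    by (simp add: flat_sign_def crossing_sign_def sgn_if)
  with sgn show "real_of_int (flat_sign (crossing_sign D) up s t) =
      \<sigma> * \<tau> * sgn (deriv G (Re (inv \<phi> (curve D t))) - deriv F (Re (inv \<phi> (curve D t))))"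
    "deriv F (Re (inv \<phi> (curve D t))) \<noteq> deriv G (Re (inv \<phi> (curve D t)))"
    by (auto simp: sgn_0_0)
qed

text \<open>
  If both slopes had the same sign, the function would have opposite signs just after the first
  zero and just before the second one, hence a third zero in between.
\<close>

lemma zeros_alternate:
  fixes g :: "real \<Rightarrow> real"
  assumes diff: "\<And>x. x \<in> {-1..1} \<Longrightarrow> g differentiable (at x)"
    and zeros: "{x \<in> {-1..1}. g x = 0} = {x1, x2}" "x1 < x2"
    and slopes: "deriv g x1 \<noteq> 0" "deriv g x2 \<noteq> 0"
  shows "sgn (deriv g x2) = - sgn (deriv g x1)"
proof (rule ccontr)
  assume "sgn (deriv g x2) \<noteq> - sgn (deriv g x1)"
  then have same: "sgn (deriv g x2) = sgn (deriv g x1)"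
    using slopes by (auto simp: sgn_if split: if_splits)
  define k where "k = sgn (deriv g x1)"
  define h where "h x = k * g x" for x
  have range: "x1 \<in> {-1..1}" "x2 \<in> {-1..1}" using zeros(1) by auto
  have h': "(h has_real_derivative k * deriv g x) (at x)" if "x \<in> {-1..1}" for x
    unfolding h_def using diff[OF that] by (intro DERIV_cmult) (simp add: DERIV_deriv_iff_real_differentiable)
  have pos: "k * deriv g x1 > 0" "k * deriv g x2 > 0"
    using slopes same by (auto simp: k_def sgn_mult_self_eq sgn_if split: if_splits)
  have zero: "h x1 = 0" "h x2 = 0" using zeros(1) by (auto simp: h_def)
  obtain d1 where d1: "d1 > 0" "\<And>e. e > 0 \<Longrightarrow> e < d1 \<Longrightarrow> h (x1 + e) > 0"
    using DERIV_pos_inc_right[OF h'[OF range(1)] pos(1)] zero by auto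
  obtain d2 where d2: "d2 > 0" "\<And>e. e > 0 \<Longrightarrow> e < d2 \<Longrightarrow> h (x2 - e) < 0"
    using DERIV_pos_inc_left[OF h'[OF range(2)] pos(2)] zero by auto
  define e where "e = min (min d1 d2) (x2 - x1) / 3"
  have e3: "3 * e \<le> d1" "3 * e \<le> d2" "3 * e \<le> x2 - x1" by (simp_all add: e_def)
  have "0 < e" using d1(1) d2(1) zeros(2) by (simp add: e_def)
  with e3 have e: "0 < e" "e < d1" "e < d2" "x1 + e < x2 - e" by linarith+
  have "\<exists>x\<ge>x1 + e. x \<le> x2 - e \<and> h x = 0"
  proof (rule IVT2)
    show "\<forall>x. x1 + e \<le> x \<and> x \<le> x2 - e \<longrightarrow> isCont h x"
    proof (intro allI impI)
      fix x assume "x1 + e \<le> x \<and> x \<le> x2 - e"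
      then have "x \<in> {-1..1}" using range e(1) by auto
      then show "isCont h x" using h' DERIV_isCont by blast
    qed
  qed (use d1(2)[OF e(1,2)] d2(2)[OF e(1,3)] e(4) in auto)
  then obtain x where x: "x1 + e \<le> x" "x \<le> x2 - e" "h x = 0" by blast
  moreover have "k \<noteq> 0" using slopes by (simp add: k_def sgn_0_0)
  ultimately have "x \<in> {x \<in> {-1..1}. g x = 0}" using range e(1) by (auto simp: h_def)
  then have "x = x1 \<or> x = x2" unfolding zeros(1) by simp
  then show False using x(1,2) e(1) by auto
qed

text \<open>
  The strand \<open>A\<close> runs along the axis. Before the move the graph of \<open>f\<close> does not meet the axis, so
  no crossing has a passage in the disk. Afterwards there are two, at the two zeros of \<open>g\<close>. Their
  signs are opposite since the slopes of \<open>g\<close> at its zeros are, while the directions of the strands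
  are the same at both.
\<close>

lemma diagram_sum_move_II:
  assumes D: "is_long_diagram D" and D': "is_long_diagram D'" and "move_II D D'"
  shows "diagram_sum \<Phi> a b D' = diagram_sum \<Phi> a b D"
proof -
  obtain \<phi> A B f g where strands: "strand A" "strand B" "A \<inter> B = {}"
    and ch: "changes \<phi> (A \<union> B) B D D'"
    and fs: "\<forall>x\<in>{-1..1}. f differentiable (at x) \<and> 0 < f x \<and> f x < 1"
    and gs: "\<forall>x\<in>{-1..1}. g differentiable (at x) \<and> \<bar>g x\<bar> < 1"
    and zeros: "card {x \<in> {-1..1}. g x = 0} = 2"
    and graphs: "curve D ` A \<subseteq> \<phi> ` function_graph (\<lambda>_. 0)" "curve D ` B \<subseteq> \<phi> ` function_graph f"
      "curve D' ` B \<subseteq> \<phi> ` function_graph g"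
    and C': "real_crossings D' \<in> {real_crossings D,
          real_crossings D \<union> over_crossings (curve D') A B,
          real_crossings D \<union> over_crossings (curve D') B A}"
    using assms(3) unfolding move_II_def by (elim exE conjE) (rule that)
  note f = bspec[OF fs] and g = bspec[OF gs]
  obtain a1 a2 where A: "A = {a1..a2}" "a1 < a2" using strands(1) unfolding strand_def by (elim exE conjE) (rule that)
  obtain b1 b2 where B: "B = {b1..b2}" "b1 < b2" using strands(2) unfolding strand_def by (elim exE conjE) (rule that)
  note \<phi> = changesD(1)[OF ch] and disk = changesD(2,3)[OF ch] and same = changesD(4)[OF ch]
  have BA: "B \<inter> A = {}" using strands(3) by blast
  have disk_BA: "\<And>t. curve D t \<in> \<phi> ` square \<longleftrightarrow> t \<in> B \<union> A"
    "\<And>t. curve D' t \<in> \<phi> ` square \<longleftrightarrow> t \<in> B \<union> A" unfolding disk by (simp_all add: Un_commute)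
  have graph_A': "curve D' ` A \<subseteq> \<phi> ` function_graph (\<lambda>_. 0)"
  proof -
    have "curve D' ` A = curve D ` A" by (rule image_cong) (use same strands(3) in auto)
    then show ?thesis using graphs(1) by simp
  qed
  note cA = closed_strand[OF strands(1)] and cB = closed_strand[OF strands(2)]
  have flat: "(\<lambda>_. 0 :: real) differentiable (at x)" "\<bar>0 :: real\<bar> < 1" for x :: real by simp_all
  have f_smooth: "f differentiable (at x)" if "x \<in> {-1..1}" for x using f[OF that] by simp
  have f_bound: "\<bar>f x\<bar> < 1" if "\<bar>x\<bar> < 1" for x using f[of x] that by (simp add: abs_less_iff)
  have g_smooth: "g differentiable (at x)" if "x \<in> {-1..1}" for x using g[OF that] by simp
  have g_bound: "\<bar>g x\<bar> < 1" if "\<bar>x\<bar> < 1" for x using g[of x] that by (simp add: abs_less_iff)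
  obtain \<sigma>0 where A0: "graph_strand (inv \<phi> \<circ> curve D) A (\<lambda>_. 0) \<sigma>0"
    by (rule strand_is_graph[OF D \<phi> A cB strands(3) disk(1) graphs(1) flat])
  obtain \<tau>0 where B0: "graph_strand (inv \<phi> \<circ> curve D) B f \<tau>0"
    by (rule strand_is_graph[OF D \<phi> B cA BA disk_BA(1) graphs(2) f_smooth f_bound])
  obtain \<sigma> where A1: "graph_strand (inv \<phi> \<circ> curve D') A (\<lambda>_. 0) \<sigma>"
    by (rule strand_is_graph[OF D' \<phi> A cB strands(3) disk(2) graph_A' flat])
  obtain \<tau> where B1: "graph_strand (inv \<phi> \<circ> curve D') B g \<tau>"
    by (rule strand_is_graph[OF D' \<phi> B cA BA disk_BA(2) graphs(3) g_smooth g_bound])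
  let ?c = "inv \<phi> \<circ> curve D" and ?c' = "inv \<phi> \<circ> curve D'"
  have no_AB: False if st: "s \<in> A" "t \<in> B" and c: "?c s = ?c t" for s t
  proof -
    have "Im (?c t) = 0" unfolding c[symmetric] by (rule graph_strand_value(2)[OF A0 st(1)])
    moreover have "Im (?c t) = f (Re (?c t))" by (rule graph_strand_value(2)[OF B0 st(2)])
    moreover have "0 < f (Re (?c t))" using f[OF graph_strand_value(1)[OF B0 st(2)]] by blast
    ultimately show False by linarith
  qed
  have outside: "fst d \<notin> A \<union> B \<and> snd d \<notin> A \<union> B" if d: "d \<in> real_crossings D" for d
  proof -
    have dd: "fst d \<in> A \<union> B \<longleftrightarrow> snd d \<in> A \<union> B"
      by (rule crossing_in_disk[OF D disk(1) d])
    have ne: "fst d \<noteq> snd d" and eq: "?c (fst d) = ?c (snd d)"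
      using long_diagramD(5)[OF D d] by simp_all
    have re: "Re (?c (fst d)) = Re (?c (snd d))" by (rule arg_cong[OF eq])
    have "\<not> (fst d \<in> A \<and> snd d \<in> A)"
      using graph_strand_inj[OF A0 _ _ re] ne by blast
    moreover have "\<not> (fst d \<in> B \<and> snd d \<in> B)"
      using graph_strand_inj[OF B0 _ _ re] ne by blast
    ultimately show ?thesis
      using dd no_AB[of "fst d" "snd d", OF _ _ eq] no_AB[of "snd d" "fst d", OF _ _ eq[symmetric]]
      by blast
  qed
  have sign: "crossing_sign D' d = crossing_sign D d" if "d \<in> real_crossings D" for d
    by (rule crossing_sign_eq_off_closed[OF cB same]) (use outside[OF that] in auto)
  obtain x1 x2 where x: "{x \<in> {-1..1}. g x = 0} = {x1, x2}" "x1 < x2"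
  proof -
    obtain u v where uv: "{x \<in> {-1..1}. g x = 0} = {u, v}" "u \<noteq> v"
      using zeros unfolding card_2_iff by (elim exE conjE) (rule that)
    show ?thesis
    proof (rule that)
      show "{x \<in> {-1..1}. g x = 0} = {min u v, max u v}" unfolding uv(1) by (auto simp: min_def max_def)
      show "min u v < max u v" using uv(2) by auto
    qed
  qed
  have "x1 \<in> {x \<in> {-1..1}. g x = 0}" "x2 \<in> {x \<in> {-1..1}. g x = 0}" unfolding x(1) by simp_all
  then have xr: "x1 \<in> {-1..1}" "x2 \<in> {-1..1}" "g x1 = 0" "g x2 = 0" by simp_all
  obtain s1 t1 where p1: "s1 \<in> A" "t1 \<in> B" "?c' s1 = Complex x1 0" "?c' t1 = Complex x1 0"
    and u1: "\<forall>s\<in>A. \<forall>t\<in>B. ?c' s = ?c' t \<longrightarrow> Re (?c' t) = x1 \<longrightarrow> s = s1 \<and> t = t1"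
    by (rule over_crossings_graphs[OF A1 B1 xr(1) xr(3)[symmetric]])
  obtain s2 t2 where p2: "s2 \<in> A" "t2 \<in> B" "?c' s2 = Complex x2 0" "?c' t2 = Complex x2 0"
    and u2: "\<forall>s\<in>A. \<forall>t\<in>B. ?c' s = ?c' t \<longrightarrow> Re (?c' t) = x2 \<longrightarrow> s = s2 \<and> t = t2"
    by (rule over_crossings_graphs[OF A1 B1 xr(2) xr(4)[symmetric]])
  have eq': "curve D' s = curve D' t \<longleftrightarrow> ?c' s = ?c' t" for s t
    unfolding comp_def chart_eq_iff[OF \<phi>] by (rule refl)
  have meet: "s \<in> A \<and> t \<in> B \<and> curve D' s = curve D' t \<longleftrightarrow> (s, t) = (s1, t1) \<or> (s, t) = (s2, t2)" for s t
  proof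
    assume *: "s \<in> A \<and> t \<in> B \<and> curve D' s = curve D' t"
    then have st: "s \<in> A" "t \<in> B" and m: "curve D' s = curve D' t" by blast+
    have c: "?c' s = ?c' t" by (rule iffD1[OF eq' m])
    have "g (Re (?c' t)) = Im (?c' t)" by (rule graph_strand_value(2)[OF B1 st(2), symmetric])
    also have "\<dots> = 0" unfolding c[symmetric] by (rule graph_strand_value(2)[OF A1 st(1)])
    finally have "Re (?c' t) \<in> {x \<in> {-1..1}. g x = 0}"
      using graph_strand_value(1)[OF B1 st(2)] by simp
    then have "Re (?c' t) = x1 \<or> Re (?c' t) = x2" unfolding x(1) by simp
    then show "(s, t) = (s1, t1) \<or> (s, t) = (s2, t2)"
      using u1[THEN bspec, OF st(1), THEN bspec, OF st(2), THEN mp, OF c]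
        u2[THEN bspec, OF st(1), THEN bspec, OF st(2), THEN mp, OF c] by blast
  next
    assume *: "(s, t) = (s1, t1) \<or> (s, t) = (s2, t2)"
    have "?c' s1 = ?c' t1" "?c' s2 = ?c' t2" unfolding p1(3,4) p2(3,4) by (rule refl)+
    then have "curve D' s1 = curve D' t1" "curve D' s2 = curve D' t2" by (simp_all only: eq')
    with * p1(1,2) p2(1,2) show "s \<in> A \<and> t \<in> B \<and> curve D' s = curve D' t" by blast
  qed
  have meet': "s \<in> B \<and> t \<in> A \<and> curve D' s = curve D' t \<longleftrightarrow> (t, s) = (s1, t1) \<or> (t, s) = (s2, t2)" for s t
    unfolding meet[symmetric] by auto
  have crossings: "over_crossings (curve D') A B = {orient True s1 t1, orient True s2 t2}"
    "over_crossings (curve D') B A = {orient False s1 t1, orient False s2 t2}"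
    unfolding over_crossings_def meet meet' by (auto simp: orient_def)
  have st: "s1 \<noteq> t1" "s2 \<noteq> t2" using p1 p2 strands(3) by auto
  note fs = flat_sign_graphs[OF D' \<phi> A1 B1]
  have c1: "inv \<phi> (curve D' s1) = inv \<phi> (curve D' t1)" and re1: "Re (inv \<phi> (curve D' t1)) = x1"
    using p1(3,4) by simp_all
  have c2: "inv \<phi> (curve D' s2) = inv \<phi> (curve D' t2)" and re2: "Re (inv \<phi> (curve D' t2)) = x2"
    using p2(3,4) by simp_all
  have fs1: "real_of_int (flat_sign (crossing_sign D') up s1 t1) = \<sigma> * \<tau> * sgn (deriv g x1)" for up
    using fs(1)[OF p1(1,2) st(1) c1, of up] unfolding re1 by simp
  have fs2: "real_of_int (flat_sign (crossing_sign D') up s2 t2) = \<sigma> * \<tau> * sgn (deriv g x2)" for up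
    using fs(1)[OF p2(1,2) st(2) c2, of up] unfolding re2 by simp
  have slope: "deriv g x1 \<noteq> 0" "deriv g x2 \<noteq> 0"
    using fs(2)[OF p1(1,2) st(1) c1] fs(2)[OF p2(1,2) st(2) c2] unfolding re1 re2 by simp_all
  have alt: "sgn (deriv g x2) = - sgn (deriv g x1)"
    by (rule zeros_alternate[OF _ x slope]) (use g in blast)
  have opposite: "crossing_sign D' (orient up s2 t2) = - crossing_sign D' (orient up s1 t1)" for up
  proof -
    have "real_of_int (flat_sign (crossing_sign D') up s2 t2) =
        real_of_int (- flat_sign (crossing_sign D') up s1 t1)"
      by (simp add: fs1 fs2 alt)
    then have "flat_sign (crossing_sign D') up s2 t2 = - flat_sign (crossing_sign D') up s1 t1"
      by (simp only: of_int_eq_iff)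
    then show ?thesis by (cases up) (simp_all add: flat_sign_def orient_def)
  qed
  have ne: "s1 \<noteq> s2" "t1 \<noteq> t2"
    using p1(3,4) p2(3,4) x(2) by auto
  have AB: "order_sign s t = order_sign s1 t1" if "s \<in> A" "t \<in> B" for s t
    by (rule order_sign_disjoint_strands[OF strands that(1) p1(1) that(2) p1(2)])
  have BA': "order_sign t s = order_sign t1 s1" if "s \<in> A" "t \<in> B" for s t
    by (rule order_sign_disjoint_strands[OF strands(2,1) BA that(2) p1(2) that(1) p1(1)])
  note across = AB[OF p2(1,2)] AB[OF p1(1) p2(2)] AB[OF p2(1) p1(2)]
    BA'[OF p2(1,2)] BA'[OF p1(1) p2(2)] BA'[OF p2(1) p1(2)]
  have bigon: "state_sum \<Phi> a b (crossing_sign D')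
      (insert (orient up s1 t1) (insert (orient up s2 t2) (real_crossings D))) = diagram_sum \<Phi> a b D"
    for up
  proof (rule state_sum_insert_bigon[OF long_diagramD(4)[OF D] _ _ _ _ _ _ _ _ sign opposite])
    show "orient up s1 t1 \<notin> real_crossings D" "orient up s2 t2 \<notin> real_crossings D"
      using outside[of "orient up s1 t1"] outside[of "orient up s2 t2"] p1 p2 by (auto split: if_splits)
    show "orient up s1 t1 \<noteq> orient up s2 t2" using ne by (simp add: orient_def)
    show "order_sign z (fst (orient up s1 t1)) = order_sign z (fst (orient up s2 t2)) \<and>
        order_sign z (snd (orient up s1 t1)) = order_sign z (snd (orient up s2 t2))"
      if "e \<in> real_crossings D" "z \<in> {fst e, snd e}" for e z
    proof -
      have "z \<notin> A" "z \<notin> B" using outside[OF that(1)] that(2) by auto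
      then show ?thesis
        using order_sign_strand[OF strands(1), of z s1 s2] order_sign_strand[OF strands(2), of z t1 t2] p1 p2
        by simp
    qed
    show "fst (orient up s1 t1) \<noteq> snd (orient up s1 t1)" using st by simp
    show "order_sign (fst (orient up s2 t2)) (snd (orient up s2 t2)) =
        order_sign (fst (orient up s1 t1)) (snd (orient up s1 t1))"
      "order_sign (fst (orient up s1 t1)) (snd (orient up s2 t2)) =
        order_sign (fst (orient up s1 t1)) (snd (orient up s1 t1))"
      "order_sign (fst (orient up s2 t2)) (snd (orient up s1 t1)) =
        order_sign (fst (orient up s1 t1)) (snd (orient up s1 t1))"
      by (simp_all add: across)
  qed
  from C' consider "real_crossings D' = real_crossings D"
    | up where "real_crossings D' = insert (orient up s1 t1) (insert (orient up s2 t2) (real_crossings D))"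
    unfolding crossings by blast
  then show ?thesis
  proof cases
    case 1
    then show ?thesis using state_sum_cong[OF sign] by simp
  next
    case 2
    then show ?thesis using bigon by simp
  qed
qed

text \<open>
  As the slope of \<open>f\<close> is less than 1, the function \<open>d f(x) - x\<close> decreases strictly, so its sign at 0
  tells on which side of 0 its zero lies. Here \<open>d = 1\<close> is the diagonal \<open>y = x\<close> and \<open>d = - 1\<close> the other
  one.
\<close>

lemma diagonal_meets_graph:
  fixes f :: "real \<Rightarrow> real"
  assumes diff: "\<And>x. x \<in> {-1..1} \<Longrightarrow> f differentiable (at x)"
    and slope: "\<And>x. x \<in> {-1..1} \<Longrightarrow> \<bar>deriv f x\<bar> < 1"
    and bound: "\<And>x. x \<in> {-1..1} \<Longrightarrow> \<bar>f x\<bar> < 1"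
    and d: "d = 1 \<or> d = -1" and f0: "f 0 \<noteq> 0"
  obtains x where "x \<in> {-1..1}" "f x = d * x" "sgn x = d * sgn (f 0)"
    "\<forall>y\<in>{-1..1}. f y = d * y \<longrightarrow> y = x"
proof -
  define h where "h y = d * f y - y" for y
  have h': "(h has_real_derivative d * deriv f y - 1) (at y)" if "y \<in> {-1..1}" for y
    unfolding h_def using diff[OF that]
    by (intro DERIV_diff DERIV_cmult DERIV_ident) (simp add: DERIV_deriv_iff_real_differentiable)
  have decreasing: "h y < h z" if zy: "z \<in> {-1..1}" "y \<in> {-1..1}" "z < y" for y z
  proof (rule DERIV_neg_imp_decreasing[OF zy(3)])
    fix x assume "z \<le> x" "x \<le> y"
    then have x: "x \<in> {-1..1}" using zy by auto
    show "\<exists>l. (h has_real_derivative l) (at x) \<and> l < 0"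
      using h'[OF x] slope[OF x] d by (intro exI[of _ "d * deriv f x - 1"]) auto
  qed
  have h_zero: "h y = 0 \<longleftrightarrow> f y = d * y" for y using d by (auto simp: h_def)
  have "\<exists>x\<ge>-1. x \<le> 1 \<and> h x = 0"
  proof (rule IVT2)
    show "h 1 \<le> 0" "0 \<le> h (-1)" using bound[of 1] bound[of "-1"] d by (auto simp: h_def)
    show "\<forall>x. -1 \<le> x \<and> x \<le> 1 \<longrightarrow> isCont h x"
    proof (intro allI impI)
      fix x :: real assume "-1 \<le> x \<and> x \<le> 1"
      then show "isCont h x" using h'[of x] DERIV_isCont by auto
    qed
  qed auto
  then obtain x where x: "x \<in> {-1..1}" "h x = 0" by auto
  have "sgn x = sgn (h 0)"
    using decreasing[of x 0] decreasing[of 0 x] x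
    by (cases x "0::real" rule: linorder_cases) auto
  also have "\<dots> = d * sgn (f 0)" using d by (auto simp: h_def)
  finally have "sgn x = d * sgn (f 0)" .
  moreover have "y = x" if "y \<in> {-1..1}" "f y = d * y" for y
    using decreasing[of x y] decreasing[of y x] x that h_zero[of y]
    by (cases x y rule: linorder_cases) auto
  ultimately show ?thesis using that[of x] x h_zero by blast
qed

text \<open>
  The three crossings of the planar picture of a third move, where \<open>k = 1\<close> if the strand \<open>E\<close> passes
  above the crossing of the diagonals \<open>A\<close> and \<open>B\<close>, and \<open>k = - 1\<close> if it passes below. The passages
  are named as in the combinatorial triangle above, to which this data is passed on.
\<close>

definition flat_triangle ::
    "long_diagram \<Rightarrow> real set \<Rightarrow> real set \<Rightarrow> real set \<Rightarrow> int \<Rightarrow> int \<Rightarrow> int \<Rightarrow> int \<Rightarrow>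
     real \<Rightarrow> real \<Rightarrow> real \<Rightarrow> real \<Rightarrow> real \<Rightarrow> real \<Rightarrow> bool" where
  "flat_triangle D A B E \<sigma>A \<sigma>B \<sigma>E k a1 a2 b1 b2 e1 e2 \<longleftrightarrow>
     {a1, a2} \<subseteq> A \<and> {b1, b2} \<subseteq> B \<and> {e1, e2} \<subseteq> E \<and>
     order_sign a1 a2 = k * \<sigma>A \<and> order_sign b1 b2 = - (k * \<sigma>B) \<and> order_sign e1 e2 = - (k * \<sigma>E) \<and>
     (\<forall>up. flat_sign (crossing_sign D) up a1 b1 = - (\<sigma>A * \<sigma>B) \<and>
        flat_sign (crossing_sign D) up a2 e1 = - (\<sigma>A * \<sigma>E) \<and>
        flat_sign (crossing_sign D) up b2 e2 = \<sigma>B * \<sigma>E) \<and>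
     (\<forall>s t. s \<in> A \<and> t \<in> B \<and> curve D s = curve D t \<longleftrightarrow> s = a1 \<and> t = b1) \<and>
     (\<forall>s t. s \<in> A \<and> t \<in> E \<and> curve D s = curve D t \<longleftrightarrow> s = a2 \<and> t = e1) \<and>
     (\<forall>s t. s \<in> B \<and> t \<in> E \<and> curve D s = curve D t \<longleftrightarrow> s = b2 \<and> t = e2)"

lemma graphs_meet_once:
  assumes D: "is_long_diagram D" and \<phi>: "plane_diffeo \<phi>"
    and A: "graph_strand (inv \<phi> \<circ> curve D) A F \<sigma>" and B: "graph_strand (inv \<phi> \<circ> curve D) B G \<tau>"
    and "A \<inter> B = {}"
    and x: "x \<in> {-1..1}" "F x = G x" and unique: "\<And>y. y \<in> {-1..1} \<Longrightarrow> F y = G y \<Longrightarrow> y = x"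
  obtains s t where "s \<in> A" "t \<in> B"
    "Re (inv \<phi> (curve D s)) = x" "Re (inv \<phi> (curve D t)) = x"
    "\<forall>s' t'. s' \<in> A \<and> t' \<in> B \<and> curve D s' = curve D t' \<longleftrightarrow> s' = s \<and> t' = t"
    "\<forall>up. real_of_int (flat_sign (crossing_sign D) up s t) = \<sigma> * \<tau> * sgn (deriv G x - deriv F x)"
proof -
  let ?c = "inv \<phi> \<circ> curve D"
  obtain s t where st: "s \<in> A" "t \<in> B" "?c s = Complex x (F x)" "?c t = Complex x (F x)"
    and u: "\<forall>s'\<in>A. \<forall>t'\<in>B. ?c s' = ?c t' \<longrightarrow> Re (?c t') = x \<longrightarrow> s' = s \<and> t' = t"
    by (rule over_crossings_graphs[OF A B x])
  have eq: "curve D s' = curve D t' \<longleftrightarrow> ?c s' = ?c t'" for s' t'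
    unfolding comp_def chart_eq_iff[OF \<phi>] by (rule refl)
  have meet: "s' \<in> A \<and> t' \<in> B \<and> curve D s' = curve D t' \<longleftrightarrow> s' = s \<and> t' = t" for s' t'
  proof
    assume *: "s' \<in> A \<and> t' \<in> B \<and> curve D s' = curve D t'"
    then have st': "s' \<in> A" "t' \<in> B" and m: "curve D s' = curve D t'" by blast+
    have c: "?c s' = ?c t'" by (rule iffD1[OF eq m])
    have "F (Re (?c t')) = Im (?c t')"
      unfolding c[symmetric] by (rule graph_strand_value(2)[OF A st'(1), symmetric])
    also have "\<dots> = G (Re (?c t'))" by (rule graph_strand_value(2)[OF B st'(2)])
    finally have "Re (?c t') = x"
      by (rule unique[OF graph_strand_value(1)[OF B st'(2)]])
    then show "s' = s \<and> t' = t"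
      by (rule u[THEN bspec, OF st'(1), THEN bspec, OF st'(2), THEN mp, OF c, THEN mp])
  next
    assume *: "s' = s \<and> t' = t"
    have "?c s = ?c t" unfolding st(3,4) by (rule refl)
    then have "curve D s = curve D t" by (rule iffD2[OF eq])
    with * st(1,2) show "s' \<in> A \<and> t' \<in> B \<and> curve D s' = curve D t'" by blast
  qed
  have "s \<noteq> t" using st assms(5) by auto
  have re: "Re (inv \<phi> (curve D s)) = x" "Re (inv \<phi> (curve D t)) = x"
    using st(3,4) by (simp_all add: comp_def)
  have ceq: "inv \<phi> (curve D s) = inv \<phi> (curve D t)" using st(3,4) by (simp add: comp_def)
  have "real_of_int (flat_sign (crossing_sign D) up s t) = \<sigma> * \<tau> * sgn (deriv G x - deriv F x)" for up
    using flat_sign_graphs(1)[OF D \<phi> A B st(1,2) \<open>s \<noteq> t\<close> ceq, of up] re(2) by simp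
  with meet show ?thesis by (intro that[OF st(1,2) re] allI)
qed

text \<open>
  The diagonals meet over 0. The graph of \<open>f\<close> meets the diagonal \<open>A\<close> over a point \<open>x\<close> with the sign \<open>k\<close>
  and the diagonal \<open>B\<close> over a point \<open>y\<close> with the sign \<open>- k\<close>, which gives the three orders. Since the
  slope of \<open>f\<close> lies between those of the diagonals, the flat signs depend on the directions only.
\<close>

lemma flat_triangle_of_graphs:
  assumes D: "is_long_diagram D" and \<phi>: "plane_diffeo \<phi>"
    and A: "graph_strand (inv \<phi> \<circ> curve D) A (\<lambda>x. x) (real_of_int \<sigma>A)"
    and B: "graph_strand (inv \<phi> \<circ> curve D) B (\<lambda>x. - x) (real_of_int \<sigma>B)"
    and E: "graph_strand (inv \<phi> \<circ> curve D) E f (real_of_int \<sigma>E)"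
    and disjoint: "A \<inter> B = {}" "A \<inter> E = {}" "B \<inter> E = {}"
    and f: "\<And>x. x \<in> {-1..1} \<Longrightarrow> f differentiable (at x) \<and> \<bar>deriv f x\<bar> < 1 \<and> \<bar>f x\<bar> < 1"
    and k: "k = 1 \<or> k = -1" and f0: "sgn (f 0) = real_of_int k"
  obtains a1 a2 b1 b2 e1 e2 where "flat_triangle D A B E \<sigma>A \<sigma>B \<sigma>E k a1 a2 b1 b2 e1 e2"
proof -
  note f_facts = f[THEN conjunct1] f[THEN conjunct2, THEN conjunct1] f[THEN conjunct2, THEN conjunct2]
  have f0_nz: "f 0 \<noteq> 0" using k f0 by auto
  obtain x where x_raw: "x \<in> {-1..1}" "f x = 1 * x" "sgn x = 1 * sgn (f 0)"
    and ux_raw: "\<forall>y\<in>{-1..1}. f y = 1 * y \<longrightarrow> y = x"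
    by (rule diagonal_meets_graph[OF f_facts disjI1[OF refl] f0_nz])
  obtain y where y_raw: "y \<in> {-1..1}" "f y = -1 * y" "sgn y = -1 * sgn (f 0)"
    and uy_raw: "\<forall>z\<in>{-1..1}. f z = -1 * z \<longrightarrow> z = y"
    by (rule diagonal_meets_graph[OF f_facts disjI2[OF refl] f0_nz])
  have x: "x \<in> {-1..1}" "x = f x" "sgn x = real_of_int k"
    by (rule x_raw(1), simp only: x_raw(2) mult_1_left, simp only: x_raw(3) f0 mult_1_left)
  have y: "y \<in> {-1..1}" "- y = f y" "sgn y = - real_of_int k"
    by (rule y_raw(1), simp only: y_raw(2) mult_minus1, simp only: y_raw(3) f0 mult_minus1)
  have ux: "z = x" if "z \<in> {-1..1}" "z = f z" for z
    by (rule ux_raw[THEN bspec, OF that(1), THEN mp]) (simp only: that(2)[symmetric] mult_1_left)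
  have uy: "z = y" if "z \<in> {-1..1}" "- z = f z" for z
    by (rule uy_raw[THEN bspec, OF that(1), THEN mp]) (simp only: that(2)[symmetric] mult_minus1)
  have deriv: "deriv (\<lambda>x::real. x) z = 1" "deriv (\<lambda>x::real. - x) z = -1" for z
    by (rule DERIV_imp_deriv[OF DERIV_ident], rule DERIV_imp_deriv[OF DERIV_minus[OF DERIV_ident]])
  have slopes: "\<bar>deriv f x\<bar> < 1" "\<bar>deriv f y\<bar> < 1" by (rule f_facts(2)[OF x(1)], rule f_facts(2)[OF y(1)])
  have origin: "(0::real) \<in> {-1..1}" "(0::real) = - 0" by simp_all
  have only_origin: "z = 0" if "z \<in> {-1..1}" "z = - z" for z :: real
    using that(2) by linarith
  obtain a1 b1 where ab: "a1 \<in> A" "b1 \<in> B" "Re (inv \<phi> (curve D a1)) = 0" "Re (inv \<phi> (curve D b1)) = 0"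
    "\<forall>s t. s \<in> A \<and> t \<in> B \<and> curve D s = curve D t \<longleftrightarrow> s = a1 \<and> t = b1"
    "\<forall>up. real_of_int (flat_sign (crossing_sign D) up a1 b1) =
      real_of_int \<sigma>A * real_of_int \<sigma>B * sgn (deriv (\<lambda>x. - x) 0 - deriv (\<lambda>x. x) (0::real))"
    by (rule graphs_meet_once[OF D \<phi> A B disjoint(1) origin only_origin])
  obtain a2 e1 where ae: "a2 \<in> A" "e1 \<in> E" "Re (inv \<phi> (curve D a2)) = x" "Re (inv \<phi> (curve D e1)) = x"
    "\<forall>s t. s \<in> A \<and> t \<in> E \<and> curve D s = curve D t \<longleftrightarrow> s = a2 \<and> t = e1"
    "\<forall>up. real_of_int (flat_sign (crossing_sign D) up a2 e1) =
      real_of_int \<sigma>A * real_of_int \<sigma>E * sgn (deriv f x - deriv (\<lambda>x. x) x)"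
    by (rule graphs_meet_once[OF D \<phi> A E disjoint(2) x(1,2) ux])
  obtain b2 e2 where be: "b2 \<in> B" "e2 \<in> E" "Re (inv \<phi> (curve D b2)) = y" "Re (inv \<phi> (curve D e2)) = y"
    "\<forall>s t. s \<in> B \<and> t \<in> E \<and> curve D s = curve D t \<longleftrightarrow> s = b2 \<and> t = e2"
    "\<forall>up. real_of_int (flat_sign (crossing_sign D) up b2 e2) =
      real_of_int \<sigma>B * real_of_int \<sigma>E * sgn (deriv f y - deriv (\<lambda>x. - x) y)"
    by (rule graphs_meet_once[OF D \<phi> B E disjoint(3) y(1,2) uy])
  have yx: "sgn (y - x) = - real_of_int k"
    using x(3) y(3) k by (auto simp: sgn_if split: if_splits)
  have "real_of_int (order_sign a1 a2) = real_of_int (k * \<sigma>A)"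
    unfolding graph_strand_order[OF A ab(1) ae(1)] by (simp add: ab(3) ae(3) x(3))
  then have order_A: "order_sign a1 a2 = k * \<sigma>A" by (simp only: of_int_eq_iff)
  have "real_of_int (order_sign b1 b2) = real_of_int (- (k * \<sigma>B))"
    unfolding graph_strand_order[OF B ab(2) be(1)] by (simp add: ab(4) be(3) y(3))
  then have order_B: "order_sign b1 b2 = - (k * \<sigma>B)" by (simp only: of_int_eq_iff)
  have "real_of_int (order_sign e1 e2) = real_of_int (- (k * \<sigma>E))"
    unfolding graph_strand_order[OF E ae(2) be(2)] by (simp add: ae(4) be(4) yx)
  then have order_E: "order_sign e1 e2 = - (k * \<sigma>E)" by (simp only: of_int_eq_iff)
  have sgn: "sgn (deriv f x - 1) = -1" "sgn (deriv f y - - 1) = 1"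
    using slopes by (simp_all add: sgn_if abs_less_iff)
  have signs: "flat_sign (crossing_sign D) up a1 b1 = - (\<sigma>A * \<sigma>B) \<and>
      flat_sign (crossing_sign D) up a2 e1 = - (\<sigma>A * \<sigma>E) \<and>
      flat_sign (crossing_sign D) up b2 e2 = \<sigma>B * \<sigma>E" for up
  proof -
    have "real_of_int (flat_sign (crossing_sign D) up a1 b1) = real_of_int (- (\<sigma>A * \<sigma>B))"
      unfolding ab(6)[THEN spec, of up] deriv by simp
    moreover have "real_of_int (flat_sign (crossing_sign D) up a2 e1) = real_of_int (- (\<sigma>A * \<sigma>E))"
      unfolding ae(6)[THEN spec, of up] deriv sgn by simp
    moreover have "real_of_int (flat_sign (crossing_sign D) up b2 e2) = real_of_int (\<sigma>B * \<sigma>E)"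
      unfolding be(6)[THEN spec, of up] deriv sgn by simp
    ultimately show ?thesis by (simp only: of_int_eq_iff)
  qed
  have "flat_triangle D A B E \<sigma>A \<sigma>B \<sigma>E k a1 a2 b1 b2 e1 e2"
    unfolding flat_triangle_def using ab(1,2) ae(1,2) be(1,2)
    by (intro conjI ab(5) ae(5) be(5) allI signs order_A order_B order_E) simp_all
  then show ?thesis by (rule that)
qed

text \<open>
  The directions can be read off at the first parameters of the strands, where the curve is the
  same before and after the move, so they agree in both pictures.
\<close>

lemma slide_flat_triangles:
  assumes D: "is_long_diagram D" and D': "is_long_diagram D'" and "slide A B E D D'"
  obtains \<sigma>A \<sigma>B \<sigma>E a1 a2 b1 b2 e1 e2 a1' a2' b1' b2' e1' e2' where
    "\<sigma>A \<in> {1, -1}" "\<sigma>B \<in> {1, -1}" "\<sigma>E \<in> {1, -1}"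
    "flat_triangle D A B E \<sigma>A \<sigma>B \<sigma>E 1 a1 a2 b1 b2 e1 e2"
    "flat_triangle D' A B E \<sigma>A \<sigma>B \<sigma>E (-1) a1' a2' b1' b2' e1' e2'"
proof -
  obtain \<phi> f g where strands: "strand A" "strand B" "strand E"
    and disjoint: "A \<inter> B = {}" "A \<inter> E = {}" "B \<inter> E = {}"
    and ch: "changes \<phi> (A \<union> B \<union> E) E D D'"
    and fs: "\<forall>x\<in>{-1..1}. f differentiable (at x) \<and> \<bar>deriv f x\<bar> < 1 \<and> \<bar>f x\<bar> < 1" "f 0 > 0"
    and gs: "\<forall>x\<in>{-1..1}. g differentiable (at x) \<and> \<bar>deriv g x\<bar> < 1 \<and> \<bar>g x\<bar> < 1" "g 0 < 0"
    and graphs: "curve D ` A \<subseteq> \<phi> ` function_graph (\<lambda>x. x)" "curve D ` B \<subseteq> \<phi> ` function_graph (\<lambda>x. - x)"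
      "curve D ` E \<subseteq> \<phi> ` function_graph f" "curve D' ` E \<subseteq> \<phi> ` function_graph g"
    using assms(3) unfolding slide_def by (elim exE conjE) (rule that)
  note f = bspec[OF fs(1)] fs(2) and g = bspec[OF gs(1)] gs(2)
  note \<phi> = changesD(1)[OF ch] and disk = changesD(2,3)[OF ch] and same = changesD(4)[OF ch]
  obtain aA bA where iA: "A = {aA..bA}" "aA < bA" using strands(1) unfolding strand_def by (elim exE conjE) (rule that)
  obtain aB bB where iB: "B = {aB..bB}" "aB < bB" using strands(2) unfolding strand_def by (elim exE conjE) (rule that)
  obtain aE bE where iE: "E = {aE..bE}" "aE < bE" using strands(3) unfolding strand_def by (elim exE conjE) (rule that)
  have image: "curve D' ` X = curve D ` X" if "X \<inter> E = {}" for X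
    by (rule image_cong) (use same that in auto)
  have graphs': "curve D' ` A \<subseteq> \<phi> ` function_graph (\<lambda>x. x)" "curve D' ` B \<subseteq> \<phi> ` function_graph (\<lambda>x. - x)"
    using graphs(1,2) image disjoint by simp_all
  have cl: "closed (B \<union> E)" "closed (A \<union> E)" "closed (A \<union> B)"
    using closed_strand strands by (simp_all add: closed_Un)
  have dj: "A \<inter> (B \<union> E) = {}" "B \<inter> (A \<union> E) = {}" "E \<inter> (A \<union> B) = {}"
    using disjoint by (simp_all add: Int_Un_distrib Int_commute)
  have un: "A \<union> B \<union> E = A \<union> (B \<union> E)" "A \<union> B \<union> E = B \<union> (A \<union> E)" "A \<union> B \<union> E = E \<union> (A \<union> B)"
    by (simp_all add: Un_ac)
  have lin: "(\<lambda>x. x) differentiable (at (x::real))" "(\<lambda>x. - x) differentiable (at (x::real))" for x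
    by (auto intro!: derivative_intros)
  have lin_bound: "\<bar>x\<bar> < 1" "\<bar>- x\<bar> < 1" if "\<bar>x\<bar> < 1" for x :: real
    using that by simp_all
  have f': "f differentiable (at x)" if "x \<in> {-1..1}" for x using f(1)[OF that] by simp
  have f_bound: "\<bar>f x\<bar> < 1" if "\<bar>x\<bar> < 1" for x using f(1)[of x] that by (simp add: abs_less_iff)
  have g': "g differentiable (at x)" if "x \<in> {-1..1}" for x using g(1)[OF that] by simp
  have g_bound: "\<bar>g x\<bar> < 1" if "\<bar>x\<bar> < 1" for x using g(1)[of x] that by (simp add: abs_less_iff)
  obtain \<alpha> where A: "graph_strand (inv \<phi> \<circ> curve D) A (\<lambda>x. x) \<alpha>" "Re (inv \<phi> (curve D aA)) = - \<alpha>"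
    by (rule strand_is_graph[OF D \<phi> iA cl(1) dj(1) disk(1)[unfolded un(1)] graphs(1) lin(1) lin_bound(1)])
  obtain \<beta> where B: "graph_strand (inv \<phi> \<circ> curve D) B (\<lambda>x. - x) \<beta>" "Re (inv \<phi> (curve D aB)) = - \<beta>"
    by (rule strand_is_graph[OF D \<phi> iB cl(2) dj(2) disk(1)[unfolded un(2)] graphs(2) lin(2) lin_bound(2)])
  obtain \<eta> where E: "graph_strand (inv \<phi> \<circ> curve D) E f \<eta>" "Re (inv \<phi> (curve D aE)) = - \<eta>"
    by (rule strand_is_graph[OF D \<phi> iE cl(3) dj(3) disk(1)[unfolded un(3)] graphs(3) f' f_bound])
  obtain \<alpha>' where A': "graph_strand (inv \<phi> \<circ> curve D') A (\<lambda>x. x) \<alpha>'" "Re (inv \<phi> (curve D' aA)) = - \<alpha>'"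
    by (rule strand_is_graph[OF D' \<phi> iA cl(1) dj(1) disk(2)[unfolded un(1)] graphs'(1) lin(1) lin_bound(1)])
  obtain \<beta>' where B': "graph_strand (inv \<phi> \<circ> curve D') B (\<lambda>x. - x) \<beta>'" "Re (inv \<phi> (curve D' aB)) = - \<beta>'"
    by (rule strand_is_graph[OF D' \<phi> iB cl(2) dj(2) disk(2)[unfolded un(2)] graphs'(2) lin(2) lin_bound(2)])
  obtain \<eta>' where E': "graph_strand (inv \<phi> \<circ> curve D') E g \<eta>'" "Re (inv \<phi> (curve D' aE)) = - \<eta>'"
    by (rule strand_is_graph[OF D' \<phi> iE cl(3) dj(3) disk(2)[unfolded un(3)] graphs(4) g' g_bound])
  have "aA \<in> A" "aB \<in> B" using iA iB by simp_all
  then have "aA \<notin> E" "aB \<notin> E" using disjoint(2,3) by blast+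
  then have "curve D' aA = curve D aA" "curve D' aB = curve D aB" by (simp_all add: same)
  moreover have "curve D' aE = curve D aE"
    by (rule changed_ends_agree[OF long_diagramD(3)[OF D] long_diagramD(3)[OF D'] same]) (simp add: iE)
  ultimately have eq: "\<alpha>' = \<alpha>" "\<beta>' = \<beta>" "\<eta>' = \<eta>" using A(2) A'(2) B(2) B'(2) E(2) E'(2) by simp_all
  have unit: "\<exists>n::int. n \<in> {1, -1} \<and> \<sigma> = real_of_int n" if "graph_strand c X F \<sigma>" for c X F \<sigma>
  proof -
    have "\<sigma> = 1 \<or> \<sigma> = -1" using that by (simp add: graph_strand_def)
    then show ?thesis by (auto intro: exI[of _ 1] exI[of _ "-1"])
  qed
  obtain \<sigma>A :: int where \<sigma>A: "\<sigma>A \<in> {1, -1} \<and> \<alpha> = real_of_int \<sigma>A"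
    using unit[OF A(1)] by (rule exE)
  obtain \<sigma>B :: int where \<sigma>B: "\<sigma>B \<in> {1, -1} \<and> \<beta> = real_of_int \<sigma>B"
    using unit[OF B(1)] by (rule exE)
  obtain \<sigma>E :: int where \<sigma>E: "\<sigma>E \<in> {1, -1} \<and> \<eta> = real_of_int \<sigma>E"
    using unit[OF E(1)] by (rule exE)
  note of_int = \<sigma>A[THEN conjunct2] \<sigma>B[THEN conjunct2] \<sigma>E[THEN conjunct2]
  have height: "sgn (f 0) = real_of_int 1" "sgn (g 0) = real_of_int (-1)" using f(2) g(2) by simp_all
  obtain a1 a2 b1 b2 e1 e2 where tri: "flat_triangle D A B E \<sigma>A \<sigma>B \<sigma>E 1 a1 a2 b1 b2 e1 e2"
    by (rule flat_triangle_of_graphs[OF D \<phi> A(1)[unfolded of_int] B(1)[unfolded of_int]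
          E(1)[unfolded of_int] disjoint f(1) disjI1[OF refl] height(1)])
  obtain a1' a2' b1' b2' e1' e2'
    where tri': "flat_triangle D' A B E \<sigma>A \<sigma>B \<sigma>E (-1) a1' a2' b1' b2' e1' e2'"
    by (rule flat_triangle_of_graphs[OF D' \<phi> A'(1)[unfolded eq of_int] B'(1)[unfolded eq of_int]
          E'(1)[unfolded eq of_int] disjoint g(1) disjI2[OF refl] height(2)])
  show ?thesis
    by (rule that[OF \<sigma>A[THEN conjunct1] \<sigma>B[THEN conjunct1] \<sigma>E[THEN conjunct1] tri tri'])
qed

lemma slideE:
  assumes "slide A B E D D'"
  obtains \<phi> where "strand A" "strand B" "strand E" "A \<inter> B = {}" "A \<inter> E = {}" "B \<inter> E = {}"
    "changes \<phi> (A \<union> B \<union> E) E D D'"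
  using assms unfolding slide_def by (elim exE conjE) (rule that)

lemma slide_crossing_ends:
  assumes D: "is_long_diagram D" and "slide A B E D D'" and d: "d \<in> real_crossings D"
  shows "fst d \<in> A \<union> B \<union> E \<longleftrightarrow> snd d \<in> A \<union> B \<union> E"
proof -
  obtain \<phi> where ch: "changes \<phi> (A \<union> B \<union> E) E D D'" using slideE[OF assms(2)] .
  show ?thesis by (rule crossing_in_disk[OF D changesD(2)[OF ch] d])
qed

lemma slide_crossing_sign:
  assumes "slide A B E D D'" "fst d \<notin> E" "snd d \<notin> E"
  shows "crossing_sign D' d = crossing_sign D d"
proof -
  obtain \<phi> where E: "strand E" and ch: "changes \<phi> (A \<union> B \<union> E) E D D'" using slideE[OF assms(1)] .
  show ?thesis by (rule crossing_sign_eq_off_closed[OF closed_strand[OF E] changesD(4)[OF ch] assms(2,3)])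
qed

text \<open>
  Each of the six orders of the layers fixes, for any two strands, which one is on top, in the same
  way before and after the move.
\<close>

lemma layered_flat_triangle:
  assumes perm: "{P, Q, R} = {A, B, E}" and distinct: "A \<noteq> B" "A \<noteq> E" "B \<noteq> E"
    and tri: "flat_triangle D A B E \<sigma>A \<sigma>B \<sigma>E k a1 a2 b1 b2 e1 e2"
    and tri': "flat_triangle D' A B E \<sigma>A \<sigma>B \<sigma>E k' a1' a2' b1' b2' e1' e2'"
  obtains p q r where
    "layered_crossings (curve D) P Q R = {orient p a1 b1, orient q a2 e1, orient r b2 e2}"
    "layered_crossings (curve D') P Q R = {orient p a1' b1', orient q a2' e1', orient r b2' e2'}"
proof -
  have over: "over_crossings (curve D) A B = {orient True a1 b1}"
      "over_crossings (curve D) B A = {orient False a1 b1}"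
      "over_crossings (curve D) A E = {orient True a2 e1}"
      "over_crossings (curve D) E A = {orient False a2 e1}"
      "over_crossings (curve D) B E = {orient True b2 e2}"
      "over_crossings (curve D) E B = {orient False b2 e2}"
    if "flat_triangle D A B E \<sigma>A \<sigma>B \<sigma>E k a1 a2 b1 b2 e1 e2"
    for D \<sigma>A \<sigma>B \<sigma>E k a1 a2 b1 b2 e1 e2
  proof -
    have m: "s \<in> A \<and> t \<in> B \<and> curve D s = curve D t \<longleftrightarrow> s = a1 \<and> t = b1"
      "s \<in> A \<and> t \<in> E \<and> curve D s = curve D t \<longleftrightarrow> s = a2 \<and> t = e1"
      "s \<in> B \<and> t \<in> E \<and> curve D s = curve D t \<longleftrightarrow> s = b2 \<and> t = e2" for s t
      using that by (simp_all add: flat_triangle_def)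
    have m': "t \<in> B \<and> s \<in> A \<and> curve D t = curve D s \<longleftrightarrow> s = a1 \<and> t = b1"
      "t \<in> E \<and> s \<in> A \<and> curve D t = curve D s \<longleftrightarrow> s = a2 \<and> t = e1"
      "t \<in> E \<and> s \<in> B \<and> curve D t = curve D s \<longleftrightarrow> s = b2 \<and> t = e2" for s t
      using m[of s t] by auto
    show "over_crossings (curve D) A B = {orient True a1 b1}"
      "over_crossings (curve D) B A = {orient False a1 b1}"
      "over_crossings (curve D) A E = {orient True a2 e1}"
      "over_crossings (curve D) E A = {orient False a2 e1}"
      "over_crossings (curve D) B E = {orient True b2 e2}"
      "over_crossings (curve D) E B = {orient False b2 e2}"
      unfolding over_crossings_def m m' by (auto simp: orient_def)
  qed
  note layered = layered_crossings_def over[OF tri] over[OF tri']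
  have "P \<in> {A, B, E}" "Q \<in> {A, B, E}" "R \<in> {A, B, E}" using perm by blast+
  moreover have "A \<in> {P, Q, R}" "B \<in> {P, Q, R}" "E \<in> {P, Q, R}" using perm by blast+
  ultimately consider "P = A" "Q = B" "R = E" | "P = A" "Q = E" "R = B" | "P = B" "Q = A" "R = E"
    | "P = B" "Q = E" "R = A" | "P = E" "Q = A" "R = B" | "P = E" "Q = B" "R = A"
    using distinct by auto
  then show ?thesis
  proof cases
    case 1 show ?thesis by (rule that[of True True True]) (simp_all add: 1 layered insert_commute)
  next
    case 2 show ?thesis by (rule that[of True True False]) (simp_all add: 2 layered insert_commute)
  next
    case 3 show ?thesis by (rule that[of False True True]) (simp_all add: 3 layered insert_commute)
  next
    case 4 show ?thesis by (rule that[of False False True]) (simp_all add: 4 layered insert_commute)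
  next
    case 5 show ?thesis by (rule that[of True False False]) (simp_all add: 5 layered insert_commute)
  next
    case 6 show ?thesis by (rule that[of False False False]) (simp_all add: 6 layered insert_commute)
  qed
qed

lemma diagram_sum_move_III:
  assumes D: "is_long_diagram D" and D': "is_long_diagram D'" and "move_III D D'"
  shows "diagram_sum \<Phi> a b D' = diagram_sum \<Phi> a b D"
proof -
  obtain A B E P Q R where sl: "slide A B E D D'" and perm: "{P, Q, R} = {A, B, E}"
    and far: "real_crossings D' - (A \<union> B \<union> E) \<times> (A \<union> B \<union> E) =
      real_crossings D - (A \<union> B \<union> E) \<times> (A \<union> B \<union> E)"
    and near: "real_crossings D \<inter> (A \<union> B \<union> E) \<times> (A \<union> B \<union> E) = layered_crossings (curve D) P Q R"
      "real_crossings D' \<inter> (A \<union> B \<union> E) \<times> (A \<union> B \<union> E) = layered_crossings (curve D') P Q R"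
    using assms(3) unfolding move_III_def Let_def by (elim exE conjE) (rule that)
  define T where "T = A \<union> B \<union> E"
  define C where "C = real_crossings D - T \<times> T"
  have strands: "strand A" "strand B" "strand E"
    and disjoint: "A \<inter> B = {}" "A \<inter> E = {}" "B \<inter> E = {}"
    using slideE[OF sl] by blast+
  have "A \<noteq> {}" "B \<noteq> {}" using strands by (auto simp: strand_def)
  then have distinct: "A \<noteq> B" "A \<noteq> E" "B \<noteq> E" using disjoint by auto
  obtain \<sigma>A \<sigma>B \<sigma>E a1 a2 b1 b2 e1 e2 a1' a2' b1' b2' e1' e2' where
    \<sigma>: "\<sigma>A \<in> {1, -1}" "\<sigma>B \<in> {1, -1}" "\<sigma>E \<in> {1, -1}"
    and tri: "flat_triangle D A B E \<sigma>A \<sigma>B \<sigma>E 1 a1 a2 b1 b2 e1 e2"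
    and tri': "flat_triangle D' A B E \<sigma>A \<sigma>B \<sigma>E (-1) a1' a2' b1' b2' e1' e2'"
    by (rule slide_flat_triangles[OF D D' sl])
  obtain p q r where layered:
    "layered_crossings (curve D) P Q R = {orient p a1 b1, orient q a2 e1, orient r b2 e2}"
    "layered_crossings (curve D') P Q R = {orient p a1' b1', orient q a2' e1', orient r b2' e2'}"
    by (rule layered_flat_triangle[OF perm distinct tri tri'])
  have near_D: "real_crossings D \<inter> T \<times> T = {orient p a1 b1, orient q a2 e1, orient r b2 e2}"
    unfolding T_def near(1) by (rule layered(1))
  have near_D': "real_crossings D' \<inter> T \<times> T = {orient p a1' b1', orient q a2' e1', orient r b2' e2'}"
    unfolding T_def near(2) by (rule layered(2))
  have far_D': "real_crossings D' - T \<times> T = C"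
    unfolding C_def T_def by (rule far)
  have split: "real_crossings D = {orient p a1 b1, orient q a2 e1, orient r b2 e2} \<union> C"
    unfolding near_D[symmetric] C_def by (rule Int_Diff_Un[symmetric])
  have split': "real_crossings D' = {orient p a1' b1', orient q a2' e1', orient r b2' e2'} \<union> C"
    unfolding near_D'[symmetric] far_D'[symmetric] by (rule Int_Diff_Un[symmetric])
  have C_D: "c \<in> real_crossings D" if "c \<in> C" for c using that by (simp add: C_def)
  have outside: "fst c \<notin> T \<and> snd c \<notin> T" if "c \<in> C" for c
    using slide_crossing_ends[OF D sl C_D[OF that]] that by (auto simp: C_def T_def mem_Times_iff)
  have "state_sum \<Phi> a b (crossing_sign D') ({orient p a1' b1', orient q a2' e1', orient r b2' e2'} \<union> C) =
      state_sum \<Phi> a b (crossing_sign D) ({orient p a1 b1, orient q a2 e1, orient r b2 e2} \<union> C)"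
  proof (rule state_sum_triangle[OF _ strands disjoint _ _ _ _ \<sigma>])
    show "finite C" using long_diagramD(4)[OF D] by (simp add: C_def)
    show "z \<notin> A \<union> B \<union> E" if "c \<in> C" "z \<in> {fst c, snd c}" for c z
      using outside[OF that(1)] that(2) by (auto simp: T_def)
    show "crossing_sign D' c = crossing_sign D c" if "c \<in> C" for c
      using outside[OF that] by (intro slide_crossing_sign[OF sl]) (auto simp: T_def)
  qed (use tri tri' in \<open>simp_all add: flat_triangle_def\<close>)
  then show ?thesis by (simp only: split split')
qed

text \<open>
  The sliding strand has virtual crossings only, so both the real crossings and the velocities at
  their passages stay the same.
\<close>

lemma diagram_sum_slide_virtual:
  assumes D: "is_long_diagram D" and sl: "slide A B E D D'"
    and C: "real_crossings D' = real_crossings D"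
    and near: "real_crossings D \<inter> (A \<union> B \<union> E) \<times> (A \<union> B \<union> E) \<subseteq> (A \<union> B) \<times> (A \<union> B)"
  shows "diagram_sum \<Phi> a b D' = diagram_sum \<Phi> a b D"
proof -
  have disjoint: "A \<inter> E = {}" "B \<inter> E = {}" using slideE[OF sl] by blast+
  have "crossing_sign D' c = crossing_sign D c" if c: "c \<in> real_crossings D" for c
  proof (rule slide_crossing_sign[OF sl])
    show "fst c \<notin> E" "snd c \<notin> E"
      using slide_crossing_ends[OF D sl c] near c disjoint by (cases c; auto)+
  qed
  then show ?thesis unfolding C by (rule state_sum_cong)
qed

lemma diagram_sum_generalized_reidemeister:
  assumes "kink_free \<Phi>" "generalized_reidemeister D D'"
  shows "diagram_sum \<Phi> a b D' = diagram_sum \<Phi> a b D"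
proof -
  have D: "is_long_diagram D" "is_long_diagram D'"
    using assms(2) by (simp_all add: generalized_reidemeister_def)
  from assms(2) consider "planar_isotopy D D'" | "move_I D D'" | "move_II D D'" | "move_III D D'"
    | "virtual_move_III D D'" | "mixed_move D D'"
    unfolding generalized_reidemeister_def by blast
  then show ?thesis
  proof cases
    case 5
    then obtain A B E where sl: "slide A B E D D'" and C: "real_crossings D' = real_crossings D"
      and near: "real_crossings D \<inter> (A \<union> B \<union> E) \<times> (A \<union> B \<union> E) = {}"
      unfolding virtual_move_III_def Let_def by (elim exE conjE) (rule that)
    show ?thesis by (rule diagram_sum_slide_virtual[OF D(1) sl C]) (simp only: near empty_subsetI)
  next
    case 6
    then obtain A B E where sl: "slide A B E D D'" and C: "real_crossings D' = real_crossings D"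
      and near: "real_crossings D \<inter> (A \<union> B \<union> E) \<times> (A \<union> B \<union> E) \<in>
        {over_crossings (curve D) A B, over_crossings (curve D) B A}"
      unfolding mixed_move_def Let_def by (elim exE conjE) (rule that)
    have "over_crossings (curve D) A B \<subseteq> (A \<union> B) \<times> (A \<union> B)"
      "over_crossings (curve D) B A \<subseteq> (A \<union> B) \<times> (A \<union> B)"
      by (auto simp: over_crossings_def)
    with near have "real_crossings D \<inter> (A \<union> B \<union> E) \<times> (A \<union> B \<union> E) \<subseteq> (A \<union> B) \<times> (A \<union> B)"
      by (elim insertE emptyE) simp_all
    then show ?thesis by (rule diagram_sum_slide_virtual[OF D(1) sl C])
  qed (use diagram_sum_planar_isotopy[OF D(1)] diagram_sum_move_I[OF D(1) _ assms(1)]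
      diagram_sum_move_II[OF D] diagram_sum_move_III[OF D] in simp_all)
qed

lemma diagram_sum_invariant:
  assumes "kink_free \<Phi>" "same_long_virtual_knot D D'"
  shows "diagram_sum \<Phi> a b D' = diagram_sum \<Phi> a b D"
  using assms(2) unfolding same_long_virtual_knot_def
proof (induction rule: equivclp_induct)
  case (step D' D'')
  then show ?case using diagram_sum_generalized_reidemeister[OF assms(1)] by metis
qed simp

section \<open>The polynomials as state sums\<close>

context
  fixes D :: long_diagram and S :: "('d, 'm) surface_knot_scheme" and p :: "real \<Rightarrow> nat"
  assumes realization: "surface_realization D S p"
begin

lemma realizing_knot: "surface_knot_diagram S"
  using realization by (simp add: surface_realization_def)

lemma crossing_in_Field: "c \<in> real_crossings D \<Longrightarrow> fst c \<in> Field (real_crossings D) \<and> snd c \<in> Field (real_crossings D)"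
  by (cases c) (auto simp: Field_def)

lemma realized_double:
  assumes "c \<in> real_crossings D"
  shows "double_passage S (fst (map_prod p p c)) (snd (map_prod p p c))"
proof -
  have "map_prod p p c \<in> knot_crossings S"
    using assms realization by (auto simp: surface_realization_def)
  then show ?thesis using knot_crossing_double[OF realizing_knot] by (metis prod.collapse)
qed

lemma realized_pairing:
  assumes "\<And>c x. c \<in> real_crossings D \<Longrightarrow> x \<in> {fst c, snd c} \<Longrightarrow> U' (p x) = U x"
    and "\<And>c x. c \<in> real_crossings D \<Longrightarrow> x \<in> {fst c, snd c} \<Longrightarrow> V' (p x) = V x"
  shows "pairing (surface_crossing_sign S) (knot_crossings S) U' V' = pairing (crossing_sign D) (real_crossings D) U V"
proof -
  have mono: "strict_mono_on (Field (real_crossings D)) p" and img: "map_prod p p ` real_crossings D = knot_crossings S"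
    and sgn: "\<And>c. c \<in> real_crossings D \<Longrightarrow> surface_crossing_sign S (map_prod p p c) = crossing_sign D c"
    using realization by (simp_all add: surface_realization_def)
  have "inj_on p (Field (real_crossings D))" by (rule strict_mono_on_imp_inj_on[OF mono])
  then have inj_p: "x = y" if "p x = p y" "x \<in> Field (real_crossings D)" "y \<in> Field (real_crossings D)" for x y
    using that by (rule inj_onD)
  have inj: "inj_on (map_prod p p) (real_crossings D)"
  proof (rule inj_onI)
    fix c d assume c: "c \<in> real_crossings D" and d: "d \<in> real_crossings D"
      and eq: "map_prod p p c = map_prod p p d"
    have "p (fst c) = p (fst d)" "p (snd c) = p (snd d)"
      using arg_cong[OF eq, of fst] arg_cong[OF eq, of snd] by simp_all
    then show "c = d"
      using crossing_in_Field[OF c] crossing_in_Field[OF d] by (simp add: prod_eq_iff inj_p)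
  qed
  show ?thesis
    unfolding img[symmetric] pairing_image[OF inj]
    by (rule pairing_cong) (use assms sgn in auto)
qed

text \<open>
  The realisation preserves the order of the passages and the signs, so the pairing on the surface
  is the pairing of the Gauss diagram.
\<close>

lemma intersection_numbers:
  assumes i: "i \<in> real_crossings D" and j: "j \<in> real_crossings D"
  shows "4 * intersection_number S (alpha S p i) (alpha S p j) = loop_pairing (crossing_sign D) (real_crossings D) i j"
    and "4 * intersection_number S (alpha S p i) (beta S p j) =
      loop_index (crossing_sign D) (real_crossings D) i - loop_pairing (crossing_sign D) (real_crossings D) i j"
    and "4 * intersection_number S (beta S p i) (beta S p j) =
      loop_index (crossing_sign D) (real_crossings D) j - loop_index (crossing_sign D) (real_crossings D) i + loop_pairing (crossing_sign D) (real_crossings D) i j"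
proof -
  note K = realizing_knot
  have less: "p x < length (knot S)" if "c \<in> real_crossings D" "x \<in> {fst c, snd c}" for c x
    using double_less[OF K realized_double[OF that(1)]] that(2) by auto
  have mono: "strict_mono_on (Field (real_crossings D)) p" using realization by (simp add: surface_realization_def)
  have aw: "arc_weight (map_prod p p i) (p x) = arc_weight i x"
    if "i \<in> real_crossings D" "c \<in> real_crossings D" "x \<in> {fst c, snd c}" for i c x
    by (rule arc_weight_strict_mono_on[OF mono]) (use that crossing_in_Field[OF that(1)] crossing_in_Field[OF that(2)] in auto)
  have alpha_weight: "passage_weight S (set (alpha_passages (map_prod p p i))) (p x) = arc_weight i x"
    if "i \<in> real_crossings D" "c \<in> real_crossings D" "x \<in> {fst c, snd c}" for i c x
    using passage_weight_alpha[OF K realized_double[OF that(1)] less[OF that(2,3)]] aw[OF that] by simp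
  have beta_weight: "passage_weight S (set (beta_passages S (map_prod p p i))) (p x) = 2 - arc_weight i x"
    if "i \<in> real_crossings D" "c \<in> real_crossings D" "x \<in> {fst c, snd c}" for i c x
    using passage_weight_beta[OF K realized_double[OF that(1)] less[OF that(2,3)]] aw[OF that] by simp
  have alpha: "alpha S p i = map ((!) (knot S)) (alpha_passages (map_prod p p i))" if "i \<in> real_crossings D" for i
    unfolding alpha_def using double_less[OF K realized_double[OF that]]
    by (intro alpha_loop_passages[OF K]) simp_all
  have beta: "beta S p i = map ((!) (knot S)) (beta_passages S (map_prod p p i))" if "i \<in> real_crossings D" for i
    unfolding beta_def using double_less[OF K realized_double[OF that]]
    by (intro beta_loop_passages[OF K]) simp_all
  note loops = knot_loop_alpha[OF K realized_double] knot_loop_beta[OF K realized_double]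
  note number = intersection_number_knot_loops[OF K]
  show "4 * intersection_number S (alpha S p i) (alpha S p j) = loop_pairing (crossing_sign D) (real_crossings D) i j"
    unfolding alpha[OF i] alpha[OF j] number[OF loops(1)[OF i] loops(1)[OF j]]
    by (rule realized_pairing) (use i j alpha_weight in auto)
  have "4 * intersection_number S (alpha S p i) (beta S p j) =
      pairing (crossing_sign D) (real_crossings D) (arc_weight i) (\<lambda>x. 2 - arc_weight j x)"
    unfolding alpha[OF i] beta[OF j] number[OF loops(1)[OF i] loops(2)[OF j]]
    by (rule realized_pairing) (use i j alpha_weight beta_weight in auto)
  then show "4 * intersection_number S (alpha S p i) (beta S p j) =
      loop_index (crossing_sign D) (real_crossings D) i - loop_pairing (crossing_sign D) (real_crossings D) i j"
    by (simp add: pairing_diff_right)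
  have "4 * intersection_number S (beta S p i) (beta S p j) =
      pairing (crossing_sign D) (real_crossings D) (\<lambda>x. 2 - arc_weight i x) (\<lambda>x. 2 - arc_weight j x)"
    unfolding beta[OF i] beta[OF j] number[OF loops(2)[OF i] loops(2)[OF j]]
    by (rule realized_pairing) (use i j beta_weight in auto)
  also have "\<dots> = loop_index (crossing_sign D) (real_crossings D) j - loop_index (crossing_sign D) (real_crossings D) i + loop_pairing (crossing_sign D) (real_crossings D) i j"
    using pairing_swap[of "crossing_sign D" "real_crossings D" "arc_weight j" "\<lambda>_. 2"]
    by (simp add: pairing_diff_right pairing_diff_left pairing_self)
  finally show "4 * intersection_number S (beta S p i) (beta S p j) =
      loop_index (crossing_sign D) (real_crossings D) j - loop_index (crossing_sign D) (real_crossings D) i + loop_pairing (crossing_sign D) (real_crossings D) i j" .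
qed

end

lemma t_power_0: "t_power 0 = 1"
  by (simp add: t_power_def)

lemma invert_t_add: "invert_t (p + q) = invert_t p + invert_t q"
  by (rule poly_mapping_eqI) (simp add: invert_t_def map_key.rep_eq lookup_add)

lemma invert_t_diff: "invert_t (p - q) = invert_t p - invert_t q"
  using invert_t_add[of "p - q" q] by simp

lemma invert_t_sum: "invert_t (sum f X) = (\<Sum>x\<in>X. invert_t (f x))"
proof (induction X rule: infinite_finite_induct)
  case (insert x X)
  then show ?case by (simp add: invert_t_add)
qed (use invert_t_diff[of 0 0] in simp_all)

lemma invert_t_power: "invert_t (t_power k) = t_power (- k)"
  by (rule poly_mapping_eqI)
    (auto simp: invert_t_def t_power_def map_key.rep_eq lookup_single when_def)

text \<open>
  The sign is \<open>1\<close> or \<open>- 1\<close>, so this follows from additivity.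
\<close>

lemma invert_t_crossing_sign:
  "invert_t (of_int (crossing_sign D i) * q) = of_int (crossing_sign D i) * invert_t q"
  using invert_t_diff[of 0 q] invert_t_diff[of 0 0] by (simp add: crossing_sign_def)

lemma state_sum_types:
  assumes "finite (real_crossings D)"
  shows "diagram_sum \<Phi> a b D = (\<Sum>i\<in>crossings_of_type D a. \<Sum>j\<in>crossings_of_type D b.
    of_int (crossing_sign D i * crossing_sign D j) *
      \<Phi> (loop_index (crossing_sign D) (real_crossings D) i)
        (loop_index (crossing_sign D) (real_crossings D) j)
        (loop_pairing (crossing_sign D) (real_crossings D) i j))"
  unfolding state_sum_def
proof (rule sum.mono_neutral_cong_right[OF assms])
  show "crossings_of_type D a \<subseteq> real_crossings D" by (auto simp: crossings_of_type_def)
  fix i assume "i \<in> crossings_of_type D a"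
  then have "typed_sign (crossing_sign D) a i = crossing_sign D i"
    by (simp add: typed_sign_def crossings_of_type_def)
  then show "(\<Sum>j\<in>real_crossings D.
        of_int (typed_sign (crossing_sign D) a i * typed_sign (crossing_sign D) b j) *
        \<Phi> (loop_index (crossing_sign D) (real_crossings D) i)
          (loop_index (crossing_sign D) (real_crossings D) j)
          (loop_pairing (crossing_sign D) (real_crossings D) i j)) =
      (\<Sum>j\<in>crossings_of_type D b. of_int (crossing_sign D i * crossing_sign D j) *
        \<Phi> (loop_index (crossing_sign D) (real_crossings D) i)
          (loop_index (crossing_sign D) (real_crossings D) j)
          (loop_pairing (crossing_sign D) (real_crossings D) i j))"
    by (intro sum.mono_neutral_cong_right[OF assms])
      (auto simp: typed_sign_def crossings_of_type_def)
qed (auto simp: typed_sign_def crossings_of_type_def)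

text \<open>
  The three functions of \<open>y = 4 \<alpha>\<^sub>i \<cdot> \<beta>\<^sub>i\<close>, \<open>z = 4 \<alpha>\<^sub>j \<cdot> \<beta>\<^sub>j\<close> and \<open>x = 4 \<alpha>\<^sub>i \<cdot> \<alpha>\<^sub>j\<close> that remain when the
  correction terms are distributed over the double sums. The divisions are exact at the values that
  occur.
\<close>

definition F_weight :: "int \<Rightarrow> int \<Rightarrow> int \<Rightarrow> laurent" where
  "F_weight y z x = t_power (x div 4) - 1"

definition G_weight :: "int \<Rightarrow> int \<Rightarrow> int \<Rightarrow> laurent" where
  "G_weight y z x = t_power ((y - x) div 4) - t_power (y div 4)"

definition H_weight :: "int \<Rightarrow> int \<Rightarrow> int \<Rightarrow> laurent" where
  "H_weight y z x = t_power ((z - y + x) div 4) - t_power (z div 4) - t_power (- y div 4) + 1"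

lemma kink_free_weights: "kink_free F_weight" "kink_free G_weight" "kink_free H_weight"
  by (simp_all add: kink_free_def F_weight_def G_weight_def H_weight_def t_power_0)

text \<open>
  A writhe is a sum of signs, so its product with a writhe polynomial is a double sum over the same
  pairs of crossings.
\<close>

lemma polynomials_as_state_sums:
  assumes D: "is_long_diagram D" and R: "surface_realization D S p"
  shows "F_poly D S p a b = diagram_sum F_weight a b D"
    and "G_poly D S p a b = diagram_sum G_weight a b D"
    and "H_poly D S p a b = diagram_sum H_weight a b D"
proof -
  let ?e = "crossing_sign D" and ?A = "crossings_of_type D a" and ?B = "crossings_of_type D b"
  let ?X = "loop_pairing ?e (real_crossings D)" and ?Y = "loop_index ?e (real_crossings D)"
  have C: "i \<in> real_crossings D" if "i \<in> crossings_of_type D a" for i a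
    using that by (simp add: crossings_of_type_def)
  have div4: "n = m div 4" if "4 * n = m" for n m :: int using that by auto
  note nums = intersection_numbers[OF R C C]
  have aa: "intersection_number S (alpha S p i) (alpha S p j) = ?X i j div 4"
    and ab: "intersection_number S (alpha S p i) (beta S p j) = (?Y i - ?X i j) div 4"
    and bb: "intersection_number S (beta S p i) (beta S p j) = (?Y j - ?Y i + ?X i j) div 4"
    if "i \<in> crossings_of_type D a" "j \<in> crossings_of_type D b" for i j a b
    using nums[OF that] by (simp_all add: div4)
  have self: "intersection_number S (alpha S p i) (beta S p i) = ?Y i div 4"
    and self_neg: "- (?Y i div 4) = - ?Y i div 4" if "i \<in> crossings_of_type D a" for i a
  proof -
    have *: "4 * intersection_number S (alpha S p i) (beta S p i) = ?Y i"
      using nums(2)[OF that that] by (simp add: pairing_self)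
    then show "intersection_number S (alpha S p i) (beta S p i) = ?Y i div 4" by (rule div4)
    show "- (?Y i div 4) = - ?Y i div 4" unfolding *[symmetric] by simp
  qed
  note sums = state_sum_types[OF long_diagramD(4)[OF D]]
  have W: "writhe_polynomial D S p c = (\<Sum>i\<in>crossings_of_type D c. of_int (?e i) * (t_power (?Y i div 4) - 1))" for c
    unfolding writhe_polynomial_def by (rule sum.cong) (simp_all add: self)
  have W_inv: "invert_t (writhe_polynomial D S p a) =
      (\<Sum>i\<in>?A. of_int (?e i) * (t_power (- ?Y i div 4) - 1))"
    unfolding W invert_t_sum
  proof (rule sum.cong[OF refl])
    fix i assume "i \<in> ?A"
    have "invert_t (1 :: laurent) = 1" using invert_t_power[of 0] by (simp add: t_power_0)
    then show "invert_t (of_int (?e i) * (t_power (?Y i div 4) - 1)) =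
        of_int (?e i) * (t_power (- ?Y i div 4) - 1)"
      by (simp add: invert_t_crossing_sign invert_t_diff invert_t_power self_neg[OF \<open>i \<in> ?A\<close>])
  qed
  have w: "of_int (writhe D c) = (\<Sum>i\<in>crossings_of_type D c. of_int (?e i) :: laurent)" for c
    by (simp add: writhe_def)
  show "F_poly D S p a b = diagram_sum F_weight a b D"
    unfolding F_poly_def f_poly_def sums F_weight_def
    by (intro sum.cong refl) (simp add: aa)
  have wW: "of_int (writhe D b) * writhe_polynomial D S p a =
      (\<Sum>i\<in>?A. \<Sum>j\<in>?B. of_int (?e i * ?e j) * (t_power (?Y i div 4) - 1))"
    unfolding mult.commute[of "of_int (writhe D b)"] unfolding w W sum_product
    by (intro sum.cong refl) (simp add: algebra_simps)
  show "G_poly D S p a b = diagram_sum G_weight a b D"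
    unfolding G_poly_def g_poly_def sums G_weight_def wW sum_subtractf[symmetric]
    by (intro sum.cong refl) (simp add: ab algebra_simps)
  have wW2: "of_int (writhe D a) * writhe_polynomial D S p b =
      (\<Sum>i\<in>?A. \<Sum>j\<in>?B. of_int (?e i * ?e j) * (t_power (?Y j div 4) - 1))"
    unfolding w W sum_product by (intro sum.cong refl) (simp add: algebra_simps)
  have wW3: "of_int (writhe D b) * invert_t (writhe_polynomial D S p a) =
      (\<Sum>i\<in>?A. \<Sum>j\<in>?B. of_int (?e i * ?e j) * (t_power (- ?Y i div 4) - 1))"
    unfolding mult.commute[of "of_int (writhe D b)"] unfolding w W_inv sum_product
    by (intro sum.cong refl) (simp add: algebra_simps)
  show "H_poly D S p a b = diagram_sum H_weight a b D"
    unfolding H_poly_def h_poly_def sums H_weight_def wW2 wW3 sum_subtractf[symmetric]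
    by (intro sum.cong refl) (simp add: bb algebra_simps)
qed

theorem theorem2p3:
  fixes D D' :: long_diagram
    and S :: "'d surface_knot" and S' :: "'e surface_knot"
    and p p' :: "real \<Rightarrow> nat"
    and a b :: nat
  assumes "is_long_diagram D" and "is_long_diagram D'"
    and "same_long_virtual_knot D D'"
    and "surface_realization D S p" and "surface_realization D' S' p'"
    and "a \<in> {0, 1}" and "b \<in> {0, 1}"
  shows "F_poly D S p a b = F_poly D' S' p' a b \<and>
         G_poly D S p a b = G_poly D' S' p' a b \<and>
         H_poly D S p a b = H_poly D' S' p' a b"
  unfolding polynomials_as_state_sums[OF assms(1,4)] polynomials_as_state_sums[OF assms(2,5)]
  using kink_free_weights[THEN diagram_sum_invariant, OF assms(3)] by simp

end
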